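(* Let $\mathcal H$ be a Hopf algebroid and let $B\subseteq A$ be an $\mathcal H$-cleft extension. Then the functor $-\otimes_B A:\mathcal M_B\to \mathcal M^{\mathcal H}_A$, from the category of right $B$-modules to the category of right-right $(\mathcal H,A)$-relative Hopf modules (where, for a right $B$-module $W$, $W\otimes_B A$ carries the $A$-action and the $\mathcal H$-coactions of the second factor), is an equivalence of categories.
   Context: Throughout $k$ is a commutative, associative, unital ring; algebras are associative unital $k$-algebras. For a $k$-algebra $R$, an $R$-ring is a monoid in the category of $R$-$R$ bimodules (equivalently an algebra $A$ with an algebra map $\eta:R\to A$), and an $R$-coring is a comonoid in that category. A right comodule of an $R$-coring $\mathcal C$ is a right $R$-module $M$ with a right $R$-linear coassociative counital coaction $M\to M\otimes_R\mathcal C$. An $R\otimes_k R^{op}$-ring is a triple $(H,s,t)$ of an algebra $H$ and algebra maps $s:R\to H$, $t:R^{op}\to H$ with commuting ranges. Right bialgebroid over $R$: an $R\otimes_kR^{op}$-ring $(H,s,t)$ and an $R$-coring $(H,\Delta,\epsilon)$ on the same $k$-module such that (i) $rhr'=hs(r')t(r)$; (ii) $\Delta$ corestricts to a map of $R\otimes_kR^{op}$-rings from $H$ to $H\times_RH=\{\sum_i h_i\otimes_R h_i' \mid \sum_i s(r)h_i\otimes_R h'_i=\sum_i h_i\otimes_R t(r)h'_i\ \forall r\in R\}$ (factorwise multiplication, unit map $r\otimes_k r'\mapsto t(r')\otimes_R s(r)$); (iii) $h\mapsto \epsilon(s(-)h)$ is a map of $R\otimes_kR^{op}$-rings $H\to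 \mathrm{End}_k(R)^{op}$ (the latter with unit map $r\otimes_k r'\mapsto r'(-)r$). A left bialgebroid over $L$ is the opposite notion: an $L\otimes_kL^{op}$-ring $(H,s,t)$ and an $L$-coring $(H,\Delta,\epsilon)$ with $lhl'=s(l)t(l')h$, $\Delta$ corestricting to a map of $L\otimes_k L^{op}$-rings into $H\times_LH=\{\sum_i h_i\otimes_L h'_i\mid \sum_i h_it(l)\otimes_L h'_i=\sum_i h_i\otimes_L h'_is(l)\ \forall l\in L\}$ (unit map $l\otimes_k l'\mapsto s(l)\otimes_L t(l')$), and $h\mapsto\epsilon(hs(-))$ a map of $L\otimes_k L^{op}$-rings $H\to\mathrm{End}_k(L)$ (unit map $l\otimes_k l'\mapsto l(-)l'$). Right comodules of a bialgebroid are right comodules of its underlying coring. Hopf algebroid $\mathcal H$: a left bialgebroid $\mathcal H_L$ over $L$ (structure $(H,s_L,t_L)$, $(H,\Delta_L,\epsilon_L)$) and a right bialgebroid $\mathcal H_R$ over $R$ (structure $(H,s_R,t_R)$, $(H,\Delta_R,\epsilon_R)$) on the same total algebra $H$ (multiplication $\mu$), with a $k$-linear antipode $S:H\to H$, such that (i) $s_L\epsilon_Lt_R=t_R$, $t_L\epsilon_Ls_R=s_R$, $s_R\epsilon_Rt_L=t_L$, $t_R\epsilon_Rs_L=s_L$; (ii) $(\Delta_L\otimes_RH)\Delta_R=(H\otimes_L\Delta_R)\Delta_L$ and $(\Delta_R\otimes_LH)\Delta_L=(H\otimes_R\Delta_L)\Delta_R$; (iii) $S(t_L(l)ht_R(r))=s_R(r)S(h)s_L(l)$;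 (iv) $\mu(S\otimes_LH)\Delta_L=s_R\epsilon_R$ and $\mu(H\otimes_RS)\Delta_R=s_L\epsilon_L$. A right $\mathcal H$-comodule is a right $L$-module and right $R$-module $M$ with a right $\mathcal H_R$-coaction $\varrho_R:M\to M\otimes_RH$, $m\mapsto m^{[0]}\otimes_Rm^{[1]}$, and a right $\mathcal H_L$-coaction $\varrho_L:M\to M\otimes_LH$, $m\mapsto m_{[0]}\otimes_Lm_{[1]}$, such that $\varrho_R$ is right $L$-linear, $\varrho_L$ is right $R$-linear, $(M\otimes_R\Delta_L)\varrho_R=(\varrho_R\otimes_LH)\varrho_L$ and $(M\otimes_L\Delta_R)\varrho_L=(\varrho_L\otimes_RH)\varrho_R$. Morphisms are maps that are both $\mathcal H_R$- and $\mathcal H_L$-comodule maps; the category is $\mathcal M^{\mathcal H}$. It is monoidal via $\otimes_R$ (left $R$-action $rm=m^{[0]}\epsilon_R(s_R(r)m^{[1]})$) and diagonal coactions $m\otimes_R n\mapsto m^{[0]}\otimes_Rn^{[0]}\otimes_Rm^{[1]}n^{[1]}$ and $m\otimes_R n\mapsto (m_{[0]}\otimes_R n_{[0]})\otimes_L m_{[1]}n_{[1]}$. A right $\mathcal H$-comodule algebra is a monoid $A$ in $\mathcal M^{\mathcal H}$; i.e. an $R$-ring (unit map $\eta_R:R\to A$) and right $\mathcal H$-comodule with $1^{[0]}\otimes_R1^{[1]}=1_A\otimes_R1_H$, $(aa')^{[0]}\otimes_R(aa')^{[1]}=a^{[0]}a'^{[0]}\otimes_Ra^{[1]}a'^{[1]}$,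 and likewise for the $\mathcal H_L$-coaction. A right-right $(\mathcal H,A)$-relative Hopf module is a right module of the monoid $A$ in $\mathcal M^{\mathcal H}$; the category of these is $\mathcal M^{\mathcal H}_A$. An $\mathcal H$-extension $B\subseteq A$ is a right $\mathcal H$-comodule algebra $A$ with $B=A^{co\mathcal H_R}=\{b\in A\mid b^{[0]}\otimes_Rb^{[1]}=b\otimes_R1_H\}$. An $\mathcal H$-extension $B\subseteq A$ is ($\mathcal H$-)cleft if: (1) in addition to its $R$-ring structure, $A$ is an $L$-ring with some unit map $\eta_L:L\to A$; (2) $B$ is an $L$-subring of $A$; (3) there exist $j\in{}_L\mathrm{Hom}^{\mathcal H}(H,A)$ (an $\mathcal H$-comodule map, with $\mathcal H$-coactions on $H$ given by the two coproducts, satisfying $j(s_L(l)h)=\eta_L(l)j(h)$) and $\widetilde j\in{}_R\mathrm{Hom}_L(H,A)$ (a map with $\widetilde j(t_L(l)ht_R(r))=\eta_R(r)\widetilde j(h)\eta_L(l)$) such that $\mu_R\circ(j\otimes_R\widetilde j)\circ\Delta_R=\eta_L\circ\epsilon_L$ and $\mu_L\circ(\widetilde j\otimes_Lj)\circ\Delta_L=\eta_R\circ\epsilon_R$, where $\mu_L,\mu_R$ denote the multiplication of $A$ as an $L$-ring and as an $R$-ring. *)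

theory Defs
  imports "HOL-Algebra.Free_Abelian_Groups"
begin

text \<open>
  The fixed rings are types of sort \<open>{ring, monoid_mult}\<close>: associative unital rings in which
  \<open>0 = 1\<close> is allowed, unlike in \<open>ring_1\<close>. Modules and comodules, which range over the objects of a
  category, are records with an explicit carrier that extend the record \<open>monoid\<close> of HOL-Algebra;
  their underlying abelian group is therefore written multiplicatively.
\<close>


section \<open>Algebras over \<open>k\<close> and modules\<close>

locale k_algebra =
  fixes sc :: "'k::{comm_ring,comm_monoid_mult} \<Rightarrow> 'b::{ring,monoid_mult} \<Rightarrow> 'b"
  assumes sc_add_right: "sc c (x + y) = sc c x + sc c y"
    and sc_add_left: "sc (c + d) x = sc c x + sc d x"
    and sc_mult: "sc (c * d) x = sc c (sc d x)"
    and sc_one: "sc 1 x = x"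
    and sc_mult_left: "sc c (x * y) = sc c x * y"
    and sc_mult_right: "sc c (x * y) = x * sc c y"

definition algebra_map ::
    "('k \<Rightarrow> 'b::{ring,monoid_mult} \<Rightarrow> 'b) \<Rightarrow> ('k \<Rightarrow> 'c::{ring,monoid_mult} \<Rightarrow> 'c) \<Rightarrow> ('b \<Rightarrow> 'c) \<Rightarrow> bool" where
  "algebra_map sb sc f \<longleftrightarrow>
     (\<forall>x y. f (x + y) = f x + f y) \<and> (\<forall>x y. f (x * y) = f x * f y) \<and> f 1 = 1 \<and>
     (\<forall>c x. f (sb c x) = sc c (f x))"

text \<open>Algebra maps from the opposite algebra.\<close>

definition algebra_antimap ::
    "('k \<Rightarrow> 'b::{ring,monoid_mult} \<Rightarrow> 'b) \<Rightarrow> ('k \<Rightarrow> 'c::{ring,monoid_mult} \<Rightarrow> 'c) \<Rightarrow> ('b \<Rightarrow> 'c) \<Rightarrow> bool" where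
  "algebra_antimap sb sc f \<longleftrightarrow>
     (\<forall>x y. f (x + y) = f x + f y) \<and> (\<forall>x y. f (x * y) = f y * f x) \<and> f 1 = 1 \<and>
     (\<forall>c x. f (sb c x) = sc c (f x))"

definition additive_group :: "'b::ab_group_add monoid" where
  "additive_group = \<lparr>carrier = UNIV, monoid.mult = (+), one = 0\<rparr>"

text \<open>Only the elements of the subring \<open>S\<close> of the ring type act.\<close>

definition right_module ::
    "'s::{ring,monoid_mult} set \<Rightarrow> ('m, 'x) monoid_scheme \<Rightarrow> ('m \<Rightarrow> 's \<Rightarrow> 'm) \<Rightarrow> bool" where
  "right_module S M ac \<longleftrightarrow> comm_group M \<and>
     (\<forall>m\<in>carrier M. \<forall>s\<in>S. ac m s \<in> carrier M) \<and>
     (\<forall>m\<in>carrier M. \<forall>m'\<in>carrier M. \<forall>s\<in>S. ac (m \<otimes>\<^bsub>M\<^esub> m') s = ac m s \<otimes>\<^bsub>M\<^esub> ac m' s) \<and>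
     (\<forall>m\<in>carrier M. \<forall>s\<in>S. \<forall>s'\<in>S. ac m (s + s') = ac m s \<otimes>\<^bsub>M\<^esub> ac m s') \<and>
     (\<forall>m\<in>carrier M. \<forall>s\<in>S. \<forall>s'\<in>S. ac m (s * s') = ac (ac m s) s') \<and>
     (\<forall>m\<in>carrier M. ac m 1 = m)"


section \<open>Tensor products\<close>

text \<open>
  \<open>M \<otimes>\<^sub>S N\<close> is the free abelian group on \<open>M \<times> N\<close> modulo the subgroup generated by the biadditivity
  and \<open>S\<close>-balancing relations. Its elements are cosets of formal sums.
\<close>

definition tensor ::
    "'s set \<Rightarrow> ('m, 'x) monoid_scheme \<Rightarrow> ('m \<Rightarrow> 's \<Rightarrow> 'm) \<Rightarrow> ('n, 'y) monoid_scheme \<Rightarrow> ('s \<Rightarrow> 'n \<Rightarrow> 'n)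
      \<Rightarrow> ('m \<times> 'n \<Rightarrow>\<^sub>0 int) set monoid" where
  "tensor S M ra N la =
     (let F = free_Abelian_group (carrier M \<times> carrier N) in
      F Mod generate F
       ({frag_of (m \<otimes>\<^bsub>M\<^esub> m', n) - frag_of (m, n) - frag_of (m', n) | m m' n.
           m \<in> carrier M \<and> m' \<in> carrier M \<and> n \<in> carrier N} \<union>
        {frag_of (m, n \<otimes>\<^bsub>N\<^esub> n') - frag_of (m, n) - frag_of (m, n') | m n n'.
           m \<in> carrier M \<and> n \<in> carrier N \<and> n' \<in> carrier N} \<union>
        {frag_of (ra m s, n) - frag_of (m, la s n) | m s n.
           m \<in> carrier M \<and> s \<in> S \<and> n \<in> carrier N}))"

text \<open>\<open>M \<otimes> N \<otimes> P\<close>, balanced via \<open>ra\<close>, \<open>la\<close> on the left and via \<open>ra'\<close>, \<open>la'\<close> on the right.\<close>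

definition tensor3 ::
    "('m, 'x) monoid_scheme \<Rightarrow> ('m \<Rightarrow> 's \<Rightarrow> 'm)
      \<Rightarrow> ('n, 'y) monoid_scheme \<Rightarrow> ('s \<Rightarrow> 'n \<Rightarrow> 'n) \<Rightarrow> ('n \<Rightarrow> 't \<Rightarrow> 'n)
      \<Rightarrow> ('p, 'z) monoid_scheme \<Rightarrow> ('t \<Rightarrow> 'p \<Rightarrow> 'p) \<Rightarrow> ('m \<times> 'n \<times> 'p \<Rightarrow>\<^sub>0 int) set monoid" where
  "tensor3 M ra N la ra' P la' =
     (let F = free_Abelian_group (carrier M \<times> carrier N \<times> carrier P) in
      F Mod generate F
       ({frag_of (m \<otimes>\<^bsub>M\<^esub> m', n, p) - frag_of (m, n, p) - frag_of (m', n, p) | m m' n p.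
           m \<in> carrier M \<and> m' \<in> carrier M \<and> n \<in> carrier N \<and> p \<in> carrier P} \<union>
        {frag_of (m, n \<otimes>\<^bsub>N\<^esub> n', p) - frag_of (m, n, p) - frag_of (m, n', p) | m n n' p.
           m \<in> carrier M \<and> n \<in> carrier N \<and> n' \<in> carrier N \<and> p \<in> carrier P} \<union>
        {frag_of (m, n, p \<otimes>\<^bsub>P\<^esub> p') - frag_of (m, n, p) - frag_of (m, n, p') | m n p p'.
           m \<in> carrier M \<and> n \<in> carrier N \<and> p \<in> carrier P \<and> p' \<in> carrier P} \<union>
        {frag_of (ra m s, n, p) - frag_of (m, la s n, p) | m s n p.
           m \<in> carrier M \<and> n \<in> carrier N \<and> p \<in> carrier P} \<union>
        {frag_of (m, ra' n t, p) - frag_of (m, n, la' t p) | m n t p.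
           m \<in> carrier M \<and> n \<in> carrier N \<and> p \<in> carrier P}))"

text \<open>
  The class of a formal sum; the unit of a factor group is the subgroup that is divided out.
\<close>

definition frag_class :: "('x \<Rightarrow>\<^sub>0 int) set monoid \<Rightarrow> ('x \<Rightarrow>\<^sub>0 int) \<Rightarrow> ('x \<Rightarrow>\<^sub>0 int) set" where
  "frag_class T x = (\<lambda>h. h + x) ` \<one>\<^bsub>T\<^esub>"

definition pure_tensor :: "('m \<times> 'n \<Rightarrow>\<^sub>0 int) set monoid \<Rightarrow> 'm \<Rightarrow> 'n \<Rightarrow> ('m \<times> 'n \<Rightarrow>\<^sub>0 int) set" where
  "pure_tensor T m n = frag_class T (frag_of (m, n))"

definition tensor_rep :: "('x \<Rightarrow>\<^sub>0 int) set \<Rightarrow> ('x \<Rightarrow>\<^sub>0 int)" where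
  "tensor_rep X = (SOME x. x \<in> X)"

text \<open>
  The additive maps out of a tensor product that are given on generators by \<open>f\<close>, with values in a
  tensor product \<open>T'\<close> and in an abelian group \<open>G\<close>. They are evaluated on a representative, and are
  only used for \<open>f\<close> that respect the relations, so that the choice does not matter.
\<close>

definition tensor_map ::
    "('y \<Rightarrow>\<^sub>0 int) set monoid \<Rightarrow> ('x \<Rightarrow> ('y \<Rightarrow>\<^sub>0 int)) \<Rightarrow> ('x \<Rightarrow>\<^sub>0 int) set \<Rightarrow> ('y \<Rightarrow>\<^sub>0 int) set" where
  "tensor_map T' f X = frag_class T' (frag_extend f (tensor_rep X))"

definition tensor_eval ::
    "('g, 'z) monoid_scheme \<Rightarrow> ('x \<Rightarrow> 'g) \<Rightarrow> ('x \<Rightarrow>\<^sub>0 int) set \<Rightarrow> 'g" where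
  "tensor_eval G f X =
     (let x = tensor_rep X in
      finprod G (\<lambda>p. f p [^]\<^bsub>G\<^esub> (Poly_Mapping.lookup x p :: int)) (Poly_Mapping.keys x))"

text \<open>\<open>f \<otimes> g\<close>, \<open>M \<otimes> d\<close> and \<open>d \<otimes> N\<close>, where \<open>d\<close> takes values in a tensor product.\<close>

definition tensor_map2 ::
    "('m' \<times> 'n' \<Rightarrow>\<^sub>0 int) set monoid \<Rightarrow> ('m \<Rightarrow> 'm') \<Rightarrow> ('n \<Rightarrow> 'n')
      \<Rightarrow> ('m \<times> 'n \<Rightarrow>\<^sub>0 int) set \<Rightarrow> ('m' \<times> 'n' \<Rightarrow>\<^sub>0 int) set" where
  "tensor_map2 T' f g = tensor_map T' (\<lambda>(m, n). frag_of (f m, g n))"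

definition split_right ::
    "('m \<times> 'n \<times> 'p \<Rightarrow>\<^sub>0 int) set monoid \<Rightarrow> ('q \<Rightarrow> ('n \<times> 'p \<Rightarrow>\<^sub>0 int) set)
      \<Rightarrow> ('m \<times> 'q \<Rightarrow>\<^sub>0 int) set \<Rightarrow> ('m \<times> 'n \<times> 'p \<Rightarrow>\<^sub>0 int) set" where
  "split_right T3 d =
     tensor_map T3 (\<lambda>(m, q). frag_extend (\<lambda>(n, p). frag_of (m, n, p)) (tensor_rep (d q)))"

definition split_left ::
    "('m \<times> 'n \<times> 'p \<Rightarrow>\<^sub>0 int) set monoid \<Rightarrow> ('q \<Rightarrow> ('m \<times> 'n \<Rightarrow>\<^sub>0 int) set)
      \<Rightarrow> ('q \<times> 'p \<Rightarrow>\<^sub>0 int) set \<Rightarrow> ('m \<times> 'n \<times> 'p \<Rightarrow>\<^sub>0 int) set" where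
  "split_left T3 d =
     tensor_map T3 (\<lambda>(q, p). frag_extend (\<lambda>(m, n). frag_of (m, n, p)) (tensor_rep (d q)))"

text \<open>
  The factorwise operation \<open>(m \<otimes> h) (a \<otimes> h') = f m a \<otimes> h h'\<close>. On a tensor product over a
  noncommutative ring it is meaningful only between elements satisfying a Takeuchi condition; this
  holds wherever it is applied below.
\<close>

definition tensor_mult ::
    "('p \<times> 'h::times \<Rightarrow>\<^sub>0 int) set monoid \<Rightarrow> ('m \<Rightarrow> 'a \<Rightarrow> 'p)
      \<Rightarrow> ('m \<times> 'h \<Rightarrow>\<^sub>0 int) set \<Rightarrow> ('a \<times> 'h \<Rightarrow>\<^sub>0 int) set \<Rightarrow> ('p \<times> 'h \<Rightarrow>\<^sub>0 int) set" where
  "tensor_mult T f X Y = frag_class T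
     (frag_extend (\<lambda>(m, h). frag_extend (\<lambda>(a, h'). frag_of (f m a, h * h')) (tensor_rep Y))
       (tensor_rep X))"


section \<open>Corings and their comodules\<close>

locale coring =
  fixes la :: "'b::{ring,monoid_mult} \<Rightarrow> 'c::ab_group_add \<Rightarrow> 'c"
    and ra :: "'c \<Rightarrow> 'b \<Rightarrow> 'c"
    and \<Delta> :: "'c \<Rightarrow> ('c \<times> 'c \<Rightarrow>\<^sub>0 int) set"
    and \<epsilon> :: "'c \<Rightarrow> 'b"
  assumes la_add: "la r (x + y) = la r x + la r y" "la (r + r') x = la r x + la r' x"
    and la_mult: "la (r * r') x = la r (la r' x)"
    and la_one: "la 1 x = x"
    and ra_add: "ra (x + y) r = ra x r + ra y r" "ra x (r + r') = ra x r + ra x r'"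
    and ra_mult: "ra x (r * r') = ra (ra x r) r'"
    and ra_one: "ra x 1 = x"
    and la_ra: "la r (ra x r') = ra (la r x) r'"
    and \<Delta>_hom: "\<Delta> \<in> hom additive_group (tensor UNIV additive_group ra additive_group la)"
    and \<Delta>_bilinear: "\<Delta> (la r (ra x r')) =
          tensor_map2 (tensor UNIV additive_group ra additive_group la) (la r) (\<lambda>y. ra y r') (\<Delta> x)"
    and \<epsilon>_add: "\<epsilon> (x + y) = \<epsilon> x + \<epsilon> y"
    and \<epsilon>_bilinear: "\<epsilon> (la r (ra x r')) = r * \<epsilon> x * r'"
    and coassoc:
      "split_left (tensor3 additive_group ra additive_group la ra additive_group la) \<Delta> (\<Delta> x) =
       split_right (tensor3 additive_group ra additive_group la ra additive_group la) \<Delta> (\<Delta> x)"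
    and counit_left: "tensor_eval additive_group (\<lambda>(x', x''). la (\<epsilon> x') x'') (\<Delta> x) = x"
    and counit_right: "tensor_eval additive_group (\<lambda>(x', x''). ra x' (\<epsilon> x'')) (\<Delta> x) = x"

locale right_comodule = coring la ra \<Delta> \<epsilon>
  for la :: "'b::{ring,monoid_mult} \<Rightarrow> 'c::ab_group_add \<Rightarrow> 'c" and ra \<Delta> \<epsilon> +
  fixes M :: "('m, 'x) monoid_scheme"
    and ac :: "'m \<Rightarrow> 'b \<Rightarrow> 'm"
    and \<rho> :: "'m \<Rightarrow> ('m \<times> 'c \<Rightarrow>\<^sub>0 int) set"
  assumes module: "right_module UNIV M ac"
    and \<rho>_hom: "\<rho> \<in> hom M (tensor UNIV M ac additive_group la)"
    and \<rho>_linear: "m \<in> carrier M \<Longrightarrow>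
          \<rho> (ac m r) = tensor_map2 (tensor UNIV M ac additive_group la) id (\<lambda>x. ra x r) (\<rho> m)"
    and \<rho>_coassoc: "m \<in> carrier M \<Longrightarrow>
          split_left (tensor3 M ac additive_group la ra additive_group la) \<rho> (\<rho> m) =
          split_right (tensor3 M ac additive_group la ra additive_group la) \<Delta> (\<rho> m)"
    and \<rho>_counit: "m \<in> carrier M \<Longrightarrow> tensor_eval M (\<lambda>(m', x). ac m' (\<epsilon> x)) (\<rho> m) = m"


section \<open>Bialgebroids\<close>

record ('b, 'h) bialgebroid =
  src :: "'b \<Rightarrow> 'h"
  tgt :: "'b \<Rightarrow> 'h"
  cop :: "'h \<Rightarrow> ('h \<times> 'h \<Rightarrow>\<^sub>0 int) set"
  cou :: "'h \<Rightarrow> 'b"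

text \<open>\<open>H\<close> as an \<open>R \<otimes> R\<^sup>o\<^sup>p\<close>-ring.\<close>

locale enveloping_ring = k_algebra kh
  for kh :: "'k::{comm_ring,comm_monoid_mult} \<Rightarrow> 'h::{ring,monoid_mult} \<Rightarrow> 'h" +
  fixes kb :: "'k \<Rightarrow> 'b::{ring,monoid_mult} \<Rightarrow> 'b"
    and X :: "('b, 'h) bialgebroid"
  assumes base: "k_algebra kb"
    and src: "algebra_map kb kh (src X)"
    and tgt: "algebra_antimap kb kh (tgt X)"
    and src_tgt: "src X r * tgt X r' = tgt X r' * src X r"

text \<open>The bimodule structures \<open>r h r' = h s(r') t(r)\<close> and \<open>l h l' = s(l) t(l') h\<close>.\<close>

definition rb_la :: "('r, 'h::times) bialgebroid \<Rightarrow> 'r \<Rightarrow> 'h \<Rightarrow> 'h" where "rb_la X r h = h * tgt X r"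
definition rb_ra :: "('r, 'h::times) bialgebroid \<Rightarrow> 'h \<Rightarrow> 'r \<Rightarrow> 'h" where "rb_ra X h r = h * src X r"
definition lb_la :: "('l, 'h::times) bialgebroid \<Rightarrow> 'l \<Rightarrow> 'h \<Rightarrow> 'h" where "lb_la X l h = src X l * h"
definition lb_ra :: "('l, 'h::times) bialgebroid \<Rightarrow> 'h \<Rightarrow> 'l \<Rightarrow> 'h" where "lb_ra X h l = tgt X l * h"

text \<open>\<open>M \<otimes>\<^sub>R H\<close> and \<open>M \<otimes>\<^sub>L H\<close> for a right module \<open>M\<close> with action \<open>ac\<close>.\<close>

definition rb_tensor ::
    "('r, 'h::{ring,monoid_mult}) bialgebroid \<Rightarrow> ('m, 'x) monoid_scheme \<Rightarrow> ('m \<Rightarrow> 'r \<Rightarrow> 'm)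
      \<Rightarrow> ('m \<times> 'h \<Rightarrow>\<^sub>0 int) set monoid" where
  "rb_tensor X M ac = tensor UNIV M ac additive_group (rb_la X)"

definition lb_tensor ::
    "('l, 'h::{ring,monoid_mult}) bialgebroid \<Rightarrow> ('m, 'x) monoid_scheme \<Rightarrow> ('m \<Rightarrow> 'l \<Rightarrow> 'm)
      \<Rightarrow> ('m \<times> 'h \<Rightarrow>\<^sub>0 int) set monoid" where
  "lb_tensor X M ac = tensor UNIV M ac additive_group (lb_la X)"

abbreviation rb_square :: "('r, 'h::{ring,monoid_mult}) bialgebroid \<Rightarrow> ('h \<times> 'h \<Rightarrow>\<^sub>0 int) set monoid" where
  "rb_square X \<equiv> rb_tensor X additive_group (rb_ra X)"

abbreviation lb_square :: "('l, 'h::{ring,monoid_mult}) bialgebroid \<Rightarrow> ('h \<times> 'h \<Rightarrow>\<^sub>0 int) set monoid" where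
  "lb_square X \<equiv> lb_tensor X additive_group (lb_ra X)"

definition rb_takeuchi :: "('r, 'h::{ring,monoid_mult}) bialgebroid \<Rightarrow> ('h \<times> 'h \<Rightarrow>\<^sub>0 int) set set" where
  "rb_takeuchi X = {Y \<in> carrier (rb_square X).
     \<forall>r. tensor_map2 (rb_square X) (\<lambda>h. src X r * h) id Y =
         tensor_map2 (rb_square X) id (\<lambda>h. tgt X r * h) Y}"

definition lb_takeuchi :: "('l, 'h::{ring,monoid_mult}) bialgebroid \<Rightarrow> ('h \<times> 'h \<Rightarrow>\<^sub>0 int) set set" where
  "lb_takeuchi X = {Y \<in> carrier (lb_square X).
     \<forall>l. tensor_map2 (lb_square X) (\<lambda>h. h * tgt X l) id Y =
         tensor_map2 (lb_square X) id (\<lambda>h. h * src X l) Y}"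

locale right_bialgebroid = enveloping_ring kh kr X + coring "rb_la X" "rb_ra X" "cop X" "cou X"
  for kh :: "'k::{comm_ring,comm_monoid_mult} \<Rightarrow> 'h::{ring,monoid_mult} \<Rightarrow> 'h"
    and kr :: "'k \<Rightarrow> 'r::{ring,monoid_mult} \<Rightarrow> 'r"
    and X :: "('r, 'h) bialgebroid" +
  assumes cop_takeuchi: "cop X h \<in> rb_takeuchi X"
    and cop_mult: "cop X (h * h') = tensor_mult (rb_square X) (*) (cop X h) (cop X h')"
    and cop_one: "cop X 1 = pure_tensor (rb_square X) 1 1"
    and cop_unit: "cop X (src X r * tgt X r') = pure_tensor (rb_square X) (tgt X r') (src X r)"
    and cou_mult: "cou X (src X x * (h * h')) = cou X (src X (cou X (src X x * h)) * h')"
    and cou_one: "cou X (src X x * 1) = x"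
    and cou_unit: "cou X (src X x * (src X r * tgt X r')) = r' * x * r"

locale left_bialgebroid = enveloping_ring kh kl X + coring "lb_la X" "lb_ra X" "cop X" "cou X"
  for kh :: "'k::{comm_ring,comm_monoid_mult} \<Rightarrow> 'h::{ring,monoid_mult} \<Rightarrow> 'h"
    and kl :: "'k \<Rightarrow> 'l::{ring,monoid_mult} \<Rightarrow> 'l"
    and X :: "('l, 'h) bialgebroid" +
  assumes cop_takeuchi: "cop X h \<in> lb_takeuchi X"
    and cop_mult: "cop X (h * h') = tensor_mult (lb_square X) (*) (cop X h) (cop X h')"
    and cop_one: "cop X 1 = pure_tensor (lb_square X) 1 1"
    and cop_unit: "cop X (src X l * tgt X l') = pure_tensor (lb_square X) (src X l) (tgt X l')"
    and cou_mult: "cou X (h * h' * src X x) = cou X (h * src X (cou X (h' * src X x)))"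
    and cou_one: "cou X (1 * src X x) = x"
    and cou_unit: "cou X (src X l * tgt X l' * src X x) = l * x * l'"


section \<open>Hopf algebroids\<close>

record ('k, 'l, 'r, 'h) hopf_algebroid =
  scH :: "'k \<Rightarrow> 'h \<Rightarrow> 'h"
  scL :: "'k \<Rightarrow> 'l \<Rightarrow> 'l"
  scR :: "'k \<Rightarrow> 'r \<Rightarrow> 'r"
  lb :: "('l, 'h) bialgebroid"
  rb :: "('r, 'h) bialgebroid"
  antipode :: "'h \<Rightarrow> 'h"

text \<open>\<open>M \<otimes>\<^sub>R H \<otimes>\<^sub>L H\<close> and \<open>M \<otimes>\<^sub>L H \<otimes>\<^sub>R H\<close>.\<close>

definition tensor_RL ::
    "('k, 'l, 'r, 'h::{ring,monoid_mult}) hopf_algebroid \<Rightarrow> ('m, 'x) monoid_scheme \<Rightarrow> ('m \<Rightarrow> 'r \<Rightarrow> 'm)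
      \<Rightarrow> ('m \<times> 'h \<times> 'h \<Rightarrow>\<^sub>0 int) set monoid" where
  "tensor_RL \<H> M ac =
     tensor3 M ac additive_group (rb_la (rb \<H>)) (lb_ra (lb \<H>)) additive_group (lb_la (lb \<H>))"

definition tensor_LR ::
    "('k, 'l, 'r, 'h::{ring,monoid_mult}) hopf_algebroid \<Rightarrow> ('m, 'x) monoid_scheme \<Rightarrow> ('m \<Rightarrow> 'l \<Rightarrow> 'm)
      \<Rightarrow> ('m \<times> 'h \<times> 'h \<Rightarrow>\<^sub>0 int) set monoid" where
  "tensor_LR \<H> M ac =
     tensor3 M ac additive_group (lb_la (lb \<H>)) (rb_ra (rb \<H>)) additive_group (rb_la (rb \<H>))"

locale is_hopf_algebroid =
  left: left_bialgebroid "scH \<H>" "scL \<H>" "lb \<H>" + right: right_bialgebroid "scH \<H>" "scR \<H>" "rb \<H>"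
  for \<H> :: "('k::{comm_ring,comm_monoid_mult}, 'l::{ring,monoid_mult}, 'r::{ring,monoid_mult},
             'h::{ring,monoid_mult}) hopf_algebroid" +
  assumes S_add: "antipode \<H> (h + h') = antipode \<H> h + antipode \<H> h'"
    and S_scale: "antipode \<H> (scH \<H> c h) = scH \<H> c (antipode \<H> h)"
    and base_maps:
      "src (lb \<H>) (cou (lb \<H>) (tgt (rb \<H>) r)) = tgt (rb \<H>) r"
      "tgt (lb \<H>) (cou (lb \<H>) (src (rb \<H>) r)) = src (rb \<H>) r"
      "src (rb \<H>) (cou (rb \<H>) (tgt (lb \<H>) l)) = tgt (lb \<H>) l"
      "tgt (rb \<H>) (cou (rb \<H>) (src (lb \<H>) l)) = src (lb \<H>) l"
    and mixed_coassoc: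
      "split_left (tensor_LR \<H> additive_group (lb_ra (lb \<H>))) (cop (lb \<H>)) (cop (rb \<H>) h) =
       split_right (tensor_LR \<H> additive_group (lb_ra (lb \<H>))) (cop (rb \<H>)) (cop (lb \<H>) h)"
      "split_left (tensor_RL \<H> additive_group (rb_ra (rb \<H>))) (cop (rb \<H>)) (cop (lb \<H>) h) =
       split_right (tensor_RL \<H> additive_group (rb_ra (rb \<H>))) (cop (lb \<H>)) (cop (rb \<H>) h)"
    and S_twist: "antipode \<H> (tgt (lb \<H>) l * h * tgt (rb \<H>) r) =
                  src (rb \<H>) r * antipode \<H> h * src (lb \<H>) l"
    and S_left: "tensor_eval additive_group (\<lambda>(h', h''). antipode \<H> h' * h'') (cop (lb \<H>) h) =
                 src (rb \<H>) (cou (rb \<H>) h)"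
    and S_right: "tensor_eval additive_group (\<lambda>(h', h''). h' * antipode \<H> h'') (cop (rb \<H>) h) =
                  src (lb \<H>) (cou (lb \<H>) h)"


section \<open>Comodules, comodule algebras and relative Hopf modules\<close>

record ('m, 'l, 'r, 'h) comod = "'m monoid" +
  actR :: "'m \<Rightarrow> 'r \<Rightarrow> 'm"
  actL :: "'m \<Rightarrow> 'l \<Rightarrow> 'm"
  coactR :: "'m \<Rightarrow> ('m \<times> 'h \<Rightarrow>\<^sub>0 int) set"
  coactL :: "'m \<Rightarrow> ('m \<times> 'h \<Rightarrow>\<^sub>0 int) set"

text \<open>\<open>act_scale\<close>: the two module structures live on one and the same \<open>k\<close>-module.\<close>

locale is_comodule =
  right: right_comodule "rb_la (rb \<H>)" "rb_ra (rb \<H>)" "cop (rb \<H>)" "cou (rb \<H>)" M "actR M" "coactR M" +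
  left: right_comodule "lb_la (lb \<H>)" "lb_ra (lb \<H>)" "cop (lb \<H>)" "cou (lb \<H>)" M "actL M" "coactL M"
  for \<H> :: "('k::{comm_ring,comm_monoid_mult}, 'l::{ring,monoid_mult}, 'r::{ring,monoid_mult},
             'h::{ring,monoid_mult}) hopf_algebroid"
    and M :: "('m, 'l, 'r, 'h, 'x) comod_scheme" +
  assumes act_scale: "m \<in> carrier M \<Longrightarrow> actR M m (scR \<H> c 1) = actL M m (scL \<H> c 1)"
    and coactR_L_linear: "m \<in> carrier M \<Longrightarrow> coactR M (actL M m l) =
          tensor_map2 (rb_tensor (rb \<H>) M (actR M)) id (\<lambda>h. lb_ra (lb \<H>) h l) (coactR M m)"
    and coactL_R_linear: "m \<in> carrier M \<Longrightarrow> coactL M (actR M m r) =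
          tensor_map2 (lb_tensor (lb \<H>) M (actL M)) id (\<lambda>h. rb_ra (rb \<H>) h r) (coactL M m)"
    and mixed_coassoc_RL: "m \<in> carrier M \<Longrightarrow>
          split_right (tensor_RL \<H> M (actR M)) (cop (lb \<H>)) (coactR M m) =
          split_left (tensor_RL \<H> M (actR M)) (coactR M) (coactL M m)"
    and mixed_coassoc_LR: "m \<in> carrier M \<Longrightarrow>
          split_right (tensor_LR \<H> M (actL M)) (cop (rb \<H>)) (coactL M m) =
          split_left (tensor_LR \<H> M (actL M)) (coactL M) (coactR M m)"

definition comod_hom ::
    "('k, 'l, 'r, 'h::{ring,monoid_mult}) hopf_algebroid \<Rightarrow> ('m, 'l, 'r, 'h, 'x) comod_scheme
      \<Rightarrow> ('n, 'l, 'r, 'h, 'y) comod_scheme \<Rightarrow> ('m \<Rightarrow> 'n) set" where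
  "comod_hom \<H> M N = {f \<in> hom M N. \<forall>m\<in>carrier M.
     (\<forall>r. f (actR M m r) = actR N (f m) r) \<and>
     (\<forall>l. f (actL M m l) = actL N (f m) l) \<and>
     coactR N (f m) = tensor_map2 (rb_tensor (rb \<H>) N (actR N)) f id (coactR M m) \<and>
     coactL N (f m) = tensor_map2 (lb_tensor (lb \<H>) N (actL N)) f id (coactL M m)}"

definition regular_comod ::
    "('k, 'l, 'r, 'h::{ring,monoid_mult}) hopf_algebroid \<Rightarrow> ('h, 'l, 'r, 'h) comod" where
  "regular_comod \<H> = \<lparr>carrier = UNIV, monoid.mult = (+), one = 0,
     actR = rb_ra (rb \<H>), actL = lb_ra (lb \<H>), coactR = cop (rb \<H>), coactL = cop (lb \<H>)\<rparr>"

text \<open>The structure of a comodule algebra on a \<open>k\<close>-algebra; \<open>actLA\<close> is the right \<open>L\<close>-action.\<close>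

record ('k, 'l, 'r, 'h, 'a) comod_algebra =
  scA :: "'k \<Rightarrow> 'a \<Rightarrow> 'a"
  etaR :: "'r \<Rightarrow> 'a"
  actLA :: "'a \<Rightarrow> 'l \<Rightarrow> 'a"
  rhoR :: "'a \<Rightarrow> ('a \<times> 'h \<Rightarrow>\<^sub>0 int) set"
  rhoL :: "'a \<Rightarrow> ('a \<times> 'h \<Rightarrow>\<^sub>0 int) set"

definition alg_comod ::
    "('k, 'l, 'r, 'h, 'a::{ring,monoid_mult}) comod_algebra \<Rightarrow> ('a, 'l, 'r, 'h) comod" where
  "alg_comod A = \<lparr>carrier = UNIV, monoid.mult = (+), one = 0,
     actR = (\<lambda>a r. a * etaR A r), actL = actLA A, coactR = rhoR A, coactL = rhoL A\<rparr>"

text \<open>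
  \<open>left_action\<close>: a monoid in the category of comodules is an \<open>R\<close>-ring with respect to the left
  \<open>R\<close>-action \<open>r a = a\<^sup>[\<^sup>0\<^sup>] \<epsilon>\<^sub>R(s\<^sub>R(r) a\<^sup>[\<^sup>1\<^sup>])\<close> defining the monoidal structure.
\<close>

locale is_comod_algebra = is_hopf_algebroid \<H> + is_comodule \<H> "alg_comod A"
  for \<H> :: "('k::{comm_ring,comm_monoid_mult}, 'l::{ring,monoid_mult}, 'r::{ring,monoid_mult},
             'h::{ring,monoid_mult}) hopf_algebroid"
    and A :: "('k, 'l, 'r, 'h, 'a::{ring,monoid_mult}) comod_algebra" +
  assumes algebra: "k_algebra (scA A)"
    and etaR: "algebra_map (scR \<H>) (scA A) (etaR A)"
    and left_action: "etaR A r * a =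
          tensor_eval additive_group (\<lambda>(a', h). a' * etaR A (cou (rb \<H>) (src (rb \<H>) r * h))) (rhoR A a)"
    and rhoR_one: "rhoR A 1 = pure_tensor (rb_tensor (rb \<H>) (alg_comod A) (actR (alg_comod A))) 1 1"
    and rhoR_mult: "rhoR A (a * a') =
          tensor_mult (rb_tensor (rb \<H>) (alg_comod A) (actR (alg_comod A))) (*) (rhoR A a) (rhoR A a')"
    and rhoL_one: "rhoL A 1 = pure_tensor (lb_tensor (lb \<H>) (alg_comod A) (actL (alg_comod A))) 1 1"
    and rhoL_mult: "rhoL A (a * a') =
          tensor_mult (lb_tensor (lb \<H>) (alg_comod A) (actL (alg_comod A))) (*) (rhoL A a) (rhoL A a')"

record ('m, 'l, 'r, 'h, 'a) hopf_mod = "('m, 'l, 'r, 'h) comod" +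
  actA :: "'m \<Rightarrow> 'a \<Rightarrow> 'm"

text \<open>
  A right module of the monoid \<open>A\<close> in the category of comodules: \<open>actA_balanced\<close> says that the
  action is defined on \<open>M \<otimes>\<^sub>R A\<close>, and the conditions after it that it is a morphism of comodules.
  On \<open>M \<otimes>\<^sub>R A\<close> the right \<open>L\<close>-action is \<open>(m \<otimes> a) l = m l \<otimes> a\<close>, as \<open>m l = \<epsilon>\<^sub>R(t\<^sub>L(l)) m\<close> in every
  comodule.
\<close>

locale is_hopf_module = is_comod_algebra \<H> A + M: is_comodule \<H> M
  for \<H> :: "('k::{comm_ring,comm_monoid_mult}, 'l::{ring,monoid_mult}, 'r::{ring,monoid_mult},
             'h::{ring,monoid_mult}) hopf_algebroid"
    and A :: "('k, 'l, 'r, 'h, 'a::{ring,monoid_mult}) comod_algebra"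
    and M :: "('m, 'l, 'r, 'h, 'a) hopf_mod" +
  assumes actA: "right_module UNIV M (actA M)"
    and actA_balanced: "m \<in> carrier M \<Longrightarrow> actA M (actR M m r) a = actA M m (etaR A r * a)"
    and actA_R_linear: "m \<in> carrier M \<Longrightarrow> actR M (actA M m a) r = actA M m (a * etaR A r)"
    and actA_L_linear: "m \<in> carrier M \<Longrightarrow> actL M (actA M m a) l = actA M (actL M m l) a"
    and actA_coactR: "m \<in> carrier M \<Longrightarrow> coactR M (actA M m a) =
          tensor_mult (rb_tensor (rb \<H>) M (actR M)) (actA M) (coactR M m) (rhoR A a)"
    and actA_coactL: "m \<in> carrier M \<Longrightarrow> coactL M (actA M m a) =
          tensor_mult (lb_tensor (lb \<H>) M (actL M)) (actA M) (coactL M m) (rhoL A a)"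


section \<open>Cleft extensions\<close>

definition coinvariants ::
    "('k, 'l, 'r, 'h::{ring,monoid_mult}) hopf_algebroid
      \<Rightarrow> ('k, 'l, 'r, 'h, 'a::{ring,monoid_mult}) comod_algebra \<Rightarrow> 'a set" where
  "coinvariants \<H> A =
     {b. rhoR A b = pure_tensor (rb_tensor (rb \<H>) (alg_comod A) (actR (alg_comod A))) b 1}"

definition hopf_extension ::
    "('k::{comm_ring,comm_monoid_mult}, 'l::{ring,monoid_mult}, 'r::{ring,monoid_mult},
      'h::{ring,monoid_mult}) hopf_algebroid
      \<Rightarrow> ('k, 'l, 'r, 'h, 'a::{ring,monoid_mult}) comod_algebra \<Rightarrow> 'a set \<Rightarrow> bool" where
  "hopf_extension \<H> A B \<longleftrightarrow> is_comod_algebra \<H> A \<and> B = coinvariants \<H> A"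

definition unital_subring :: "'a::{ring,monoid_mult} set \<Rightarrow> bool" where
  "unital_subring B \<longleftrightarrow> 1 \<in> B \<and> (\<forall>x\<in>B. \<forall>y\<in>B. x - y \<in> B \<and> x * y \<in> B)"

definition cleft_extension ::
    "('k::{comm_ring,comm_monoid_mult}, 'l::{ring,monoid_mult}, 'r::{ring,monoid_mult},
      'h::{ring,monoid_mult}) hopf_algebroid
      \<Rightarrow> ('k, 'l, 'r, 'h, 'a::{ring,monoid_mult}) comod_algebra \<Rightarrow> 'a set \<Rightarrow> bool" where
  "cleft_extension \<H> A B \<longleftrightarrow> hopf_extension \<H> A B \<and>
     (\<exists>etaL. algebra_map (scL \<H>) (scA A) etaL \<and>
       unital_subring B \<and> range etaL \<subseteq> B \<and>
       (\<exists>j \<in> comod_hom \<H> (regular_comod \<H>) (alg_comod A).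
        \<exists>j' \<in> hom additive_group additive_group.
          (\<forall>l h. j (src (lb \<H>) l * h) = etaL l * j h) \<and>
          (\<forall>l h r. j' (tgt (lb \<H>) l * h * tgt (rb \<H>) r) = etaR A r * j' h * etaL l) \<and>
          (\<forall>h. tensor_eval additive_group (\<lambda>(x, y). j x * j' y) (cop (rb \<H>) h) = etaL (cou (lb \<H>) h)) \<and>
          (\<forall>h. tensor_eval additive_group (\<lambda>(x, y). j' x * j y) (cop (lb \<H>) h) = etaR A (cou (rb \<H>) h))))"


section \<open>Categories and equivalences\<close>

text \<open>\<open>Comp C X Y Z g f\<close> is the composite of \<open>f : X \<rightarrow> Y\<close> and \<open>g : Y \<rightarrow> Z\<close>.\<close>

record ('o, 'f) cat =
  Obj :: "'o set"
  Hom :: "'o \<Rightarrow> 'o \<Rightarrow> 'f set"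
  Comp :: "'o \<Rightarrow> 'o \<Rightarrow> 'o \<Rightarrow> 'f \<Rightarrow> 'f \<Rightarrow> 'f"
  Ident :: "'o \<Rightarrow> 'f"

definition is_category :: "('o, 'f) cat \<Rightarrow> bool" where
  "is_category C \<longleftrightarrow>
     (\<forall>X\<in>Obj C. Ident C X \<in> Hom C X X) \<and>
     (\<forall>X\<in>Obj C. \<forall>Y\<in>Obj C. \<forall>Z\<in>Obj C. \<forall>f\<in>Hom C X Y. \<forall>g\<in>Hom C Y Z. Comp C X Y Z g f \<in> Hom C X Z) \<and>
     (\<forall>X\<in>Obj C. \<forall>Y\<in>Obj C. \<forall>f\<in>Hom C X Y.
        Comp C X X Y f (Ident C X) = f \<and> Comp C X Y Y (Ident C Y) f = f) \<and>
     (\<forall>W\<in>Obj C. \<forall>X\<in>Obj C. \<forall>Y\<in>Obj C. \<forall>Z\<in>Obj C. \<forall>f\<in>Hom C W X. \<forall>g\<in>Hom C X Y. \<forall>h\<in>Hom C Y Z.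
        Comp C W X Z (Comp C X Y Z h g) f = Comp C W Y Z h (Comp C W X Y g f))"

definition is_functor ::
    "('o, 'f) cat \<Rightarrow> ('p, 'g) cat \<Rightarrow> ('o \<Rightarrow> 'p) \<Rightarrow> ('o \<Rightarrow> 'o \<Rightarrow> 'f \<Rightarrow> 'g) \<Rightarrow> bool" where
  "is_functor C D F\<^sub>o F\<^sub>m \<longleftrightarrow>
     (\<forall>X\<in>Obj C. F\<^sub>o X \<in> Obj D) \<and>
     (\<forall>X\<in>Obj C. \<forall>Y\<in>Obj C. \<forall>f\<in>Hom C X Y. F\<^sub>m X Y f \<in> Hom D (F\<^sub>o X) (F\<^sub>o Y)) \<and>
     (\<forall>X\<in>Obj C. F\<^sub>m X X (Ident C X) = Ident D (F\<^sub>o X)) \<and>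
     (\<forall>X\<in>Obj C. \<forall>Y\<in>Obj C. \<forall>Z\<in>Obj C. \<forall>f\<in>Hom C X Y. \<forall>g\<in>Hom C Y Z.
        F\<^sub>m X Z (Comp C X Y Z g f) = Comp D (F\<^sub>o X) (F\<^sub>o Y) (F\<^sub>o Z) (F\<^sub>m Y Z g) (F\<^sub>m X Y f))"

definition is_iso_in :: "('o, 'f) cat \<Rightarrow> 'o \<Rightarrow> 'o \<Rightarrow> 'f \<Rightarrow> bool" where
  "is_iso_in C X Y f \<longleftrightarrow> f \<in> Hom C X Y \<and>
     (\<exists>g\<in>Hom C Y X. Comp C X Y X g f = Ident C X \<and> Comp C Y X Y f g = Ident C Y)"

definition natural_iso ::
    "('o, 'f) cat \<Rightarrow> ('p, 'g) cat \<Rightarrow> ('o \<Rightarrow> 'p) \<Rightarrow> ('o \<Rightarrow> 'o \<Rightarrow> 'f \<Rightarrow> 'g)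
      \<Rightarrow> ('o \<Rightarrow> 'p) \<Rightarrow> ('o \<Rightarrow> 'o \<Rightarrow> 'f \<Rightarrow> 'g) \<Rightarrow> ('o \<Rightarrow> 'g) \<Rightarrow> bool" where
  "natural_iso C D F\<^sub>o F\<^sub>m G\<^sub>o G\<^sub>m \<eta> \<longleftrightarrow>
     (\<forall>X\<in>Obj C. is_iso_in D (F\<^sub>o X) (G\<^sub>o X) (\<eta> X)) \<and>
     (\<forall>X\<in>Obj C. \<forall>Y\<in>Obj C. \<forall>f\<in>Hom C X Y.
        Comp D (F\<^sub>o X) (F\<^sub>o Y) (G\<^sub>o Y) (\<eta> Y) (F\<^sub>m X Y f) = Comp D (F\<^sub>o X) (G\<^sub>o X) (G\<^sub>o Y) (G\<^sub>m X Y f) (\<eta> X))"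

definition is_equivalence ::
    "('o, 'f) cat \<Rightarrow> ('p, 'g) cat \<Rightarrow> ('o \<Rightarrow> 'p) \<Rightarrow> ('o \<Rightarrow> 'o \<Rightarrow> 'f \<Rightarrow> 'g) \<Rightarrow> bool" where
  "is_equivalence C D F\<^sub>o F\<^sub>m \<longleftrightarrow>
     is_category C \<and> is_category D \<and> is_functor C D F\<^sub>o F\<^sub>m \<and>
     (\<exists>G\<^sub>o G\<^sub>m. is_functor D C G\<^sub>o G\<^sub>m \<and>
       (\<exists>\<eta>. natural_iso C C id (\<lambda>X Y f. f) (G\<^sub>o \<circ> F\<^sub>o) (\<lambda>X Y f. G\<^sub>m (F\<^sub>o X) (F\<^sub>o Y) (F\<^sub>m X Y f)) \<eta>) \<and>
       (\<exists>\<epsilon>. natural_iso D D (F\<^sub>o \<circ> G\<^sub>o) (\<lambda>X Y f. F\<^sub>m (G\<^sub>o X) (G\<^sub>o Y) (G\<^sub>m X Y f)) id (\<lambda>X Y f. f) \<epsilon>))"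


section \<open>The functor \<open>- \<otimes>\<^sub>B A\<close>\<close>

record ('m, 'a) rmod = "'m monoid" +
  act :: "'m \<Rightarrow> 'a \<Rightarrow> 'm"

text \<open>
  The objects of both categories are the (co)modules whose carrier is a subset of the type \<open>'u\<close>,
  which plays the role of the universe. Morphisms are undefined outside the carrier of their domain,
  so that they are determined by their values on it.
\<close>

definition module_cat ::
    "'a::{ring,monoid_mult} set \<Rightarrow> (('u, 'a) rmod, 'u \<Rightarrow> 'u) cat" where
  "module_cat B = \<lparr>
     Obj = {W. right_module B W (act W)},
     Hom = (\<lambda>V W. {f \<in> hom V W \<inter> extensional (carrier V).
                    \<forall>v\<in>carrier V. \<forall>b\<in>B. f (act V v b) = act W (f v) b}),
     Comp = (\<lambda>U V W g f. compose (carrier U) g f),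
     Ident = (\<lambda>W. \<lambda>w\<in>carrier W. w)\<rparr>"

definition hopf_module_cat ::
    "('k::{comm_ring,comm_monoid_mult}, 'l::{ring,monoid_mult}, 'r::{ring,monoid_mult},
      'h::{ring,monoid_mult}) hopf_algebroid
      \<Rightarrow> ('k, 'l, 'r, 'h, 'a::{ring,monoid_mult}) comod_algebra
      \<Rightarrow> (('u, 'l, 'r, 'h, 'a) hopf_mod, 'u \<Rightarrow> 'u) cat" where
  "hopf_module_cat \<H> A = \<lparr>
     Obj = {M. is_hopf_module \<H> A M},
     Hom = (\<lambda>M N. {f \<in> comod_hom \<H> M N \<inter> extensional (carrier M).
                    \<forall>m\<in>carrier M. \<forall>a. f (actA M m a) = actA N (f m) a}),
     Comp = (\<lambda>L M N g f. compose (carrier L) g f),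
     Ident = (\<lambda>M. \<lambda>m\<in>carrier M. m)\<rparr>"

text \<open>
  \<open>W \<otimes>\<^sub>B A\<close> consists of cosets of formal sums over \<open>W \<times> A\<close>, hence is not literally an object over
  \<open>'u\<close>. Given an injection \<open>code\<close> of the formal sums over \<open>'u \<times> 'a\<close> into \<open>'u\<close>, it is transported
  into \<open>'u\<close> along the injection \<open>encode\<close>.
\<close>

lemma universe_closed:
  assumes "infinite (UNIV :: 'u set)" and "inj (i :: 'a \<Rightarrow> 'u)"
  shows "\<exists>code :: ('u \<times> 'a \<Rightarrow>\<^sub>0 int) \<Rightarrow> 'u. inj code"
proof -
  have "infinite (UNIV :: ('u \<times> 'a) set)"
    using assms(1) by (simp add: finite_prod)
  then have "carrier (free_Abelian_group (UNIV :: ('u \<times> 'a) set)) \<lesssim> (UNIV :: ('u \<times> 'a) set)"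
    using eqpoll_free_Abelian_group_infinite eqpoll_imp_lepoll by blast
  moreover have "carrier (free_Abelian_group (UNIV :: ('u \<times> 'a) set)) = UNIV"
    by (simp add: free_Abelian_group_def)
  ultimately obtain f :: "('u \<times> 'a \<Rightarrow>\<^sub>0 int) \<Rightarrow> 'u \<times> 'a" where f: "inj f"
    unfolding lepoll_def by auto
  have "|UNIV \<times> UNIV :: ('u \<times> 'u) set| =o |UNIV :: 'u set|"
    by (rule card_of_Times_same_infinite) (rule assms(1))
  then obtain g :: "'u \<times> 'u \<Rightarrow> 'u" where g: "inj g"
    unfolding card_of_ordIso[symmetric] by (auto simp: bij_betw_def)
  have "inj (map_prod id i :: 'u \<times> 'a \<Rightarrow> 'u \<times> 'u)"
    using assms(2) by (intro prod.inj_map) auto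
  then have "inj (g \<circ> map_prod id i \<circ> f)"
    using f g by (intro inj_compose)
  then show ?thesis by blast
qed

definition encode :: "(('x \<Rightarrow>\<^sub>0 int) \<Rightarrow> 'u) \<Rightarrow> ('x \<Rightarrow>\<^sub>0 int) set \<Rightarrow> 'u" where
  "encode code X = code (tensor_rep X)"

definition decode :: "(('x \<Rightarrow>\<^sub>0 int) \<Rightarrow> 'u) \<Rightarrow> ('x \<Rightarrow>\<^sub>0 int) set monoid \<Rightarrow> 'u \<Rightarrow> ('x \<Rightarrow>\<^sub>0 int) set" where
  "decode code T = inv_into (carrier T) (encode code)"

definition tensor_over ::
    "'a::{ring,monoid_mult} set \<Rightarrow> ('u, 'a) rmod \<Rightarrow> ('u \<times> 'a \<Rightarrow>\<^sub>0 int) set monoid" where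
  "tensor_over B W = tensor B W (act W) additive_group (\<lambda>b a. b * a)"

definition tensor_group ::
    "(('u \<times> 'a \<Rightarrow>\<^sub>0 int) \<Rightarrow> 'u) \<Rightarrow> 'a::{ring,monoid_mult} set \<Rightarrow> ('u, 'a) rmod \<Rightarrow> 'u monoid" where
  "tensor_group code B W = (let T = tensor_over B W in
     \<lparr>carrier = encode code ` carrier T,
      monoid.mult = (\<lambda>u v. encode code (decode code T u \<otimes>\<^bsub>T\<^esub> decode code T v)),
      one = encode code \<one>\<^bsub>T\<^esub>\<rparr>)"

text \<open>\<open>W \<otimes>\<^sub>B f\<close> for an additive \<open>f : A \<rightarrow> A\<close>, and \<open>W \<otimes>\<^sub>B \<rho>\<close> for a coaction \<open>\<rho>\<close> on \<open>A\<close>.\<close>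

definition tensor_act ::
    "(('u \<times> 'a \<Rightarrow>\<^sub>0 int) \<Rightarrow> 'u) \<Rightarrow> 'a::{ring,monoid_mult} set \<Rightarrow> ('u, 'a) rmod \<Rightarrow> ('a \<Rightarrow> 'a) \<Rightarrow> 'u \<Rightarrow> 'u" where
  "tensor_act code B W f u = (let T = tensor_over B W in
     encode code (tensor_map2 T id f (decode code T u)))"

definition tensor_coact ::
    "(('u \<times> 'a \<Rightarrow>\<^sub>0 int) \<Rightarrow> 'u) \<Rightarrow> 'a::{ring,monoid_mult} set \<Rightarrow> ('u, 'a) rmod
      \<Rightarrow> ('u \<times> 'h \<Rightarrow>\<^sub>0 int) set monoid \<Rightarrow> ('a \<Rightarrow> ('a \<times> 'h \<Rightarrow>\<^sub>0 int) set) \<Rightarrow> 'u \<Rightarrow> ('u \<times> 'h \<Rightarrow>\<^sub>0 int) set" where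
  "tensor_coact code B W T' \<rho> u = (let T = tensor_over B W in
     tensor_map T' (\<lambda>(w, a).
       frag_extend (\<lambda>(a', h). frag_of (encode code (pure_tensor T w a'), h)) (tensor_rep (\<rho> a)))
     (decode code T u))"

definition tensor_obj ::
    "('k, 'l, 'r, 'h::{ring,monoid_mult}) hopf_algebroid
      \<Rightarrow> ('k, 'l, 'r, 'h, 'a::{ring,monoid_mult}) comod_algebra \<Rightarrow> 'a set
      \<Rightarrow> (('u \<times> 'a \<Rightarrow>\<^sub>0 int) \<Rightarrow> 'u) \<Rightarrow> ('u, 'a) rmod \<Rightarrow> ('u, 'l, 'r, 'h, 'a) hopf_mod" where
  "tensor_obj \<H> A B code W =
     (let G = tensor_group code B W;
          aR = (\<lambda>u r. tensor_act code B W (\<lambda>a. a * etaR A r) u);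
          aL = (\<lambda>u l. tensor_act code B W (\<lambda>a. actLA A a l) u)
      in \<lparr>carrier = carrier G, monoid.mult = monoid.mult G, one = one G,
          actR = aR, actL = aL,
          coactR = tensor_coact code B W (rb_tensor (rb \<H>) G aR) (rhoR A),
          coactL = tensor_coact code B W (lb_tensor (lb \<H>) G aL) (rhoL A),
          actA = (\<lambda>u a'. tensor_act code B W (\<lambda>a. a * a') u)\<rparr>)"

definition tensor_mor ::
    "'a::{ring,monoid_mult} set \<Rightarrow> (('u \<times> 'a \<Rightarrow>\<^sub>0 int) \<Rightarrow> 'u)
      \<Rightarrow> ('u, 'a) rmod \<Rightarrow> ('u, 'a) rmod \<Rightarrow> ('u \<Rightarrow> 'u) \<Rightarrow> 'u \<Rightarrow> 'u" where
  "tensor_mor B code V W f = (\<lambda>u \<in> carrier (tensor_group code B V).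
     encode code (tensor_map2 (tensor_over B W) f id (decode code (tensor_over B V) u)))"

end

theory Submission
  imports Defs
begin

text \<open>
  Write \<open>m \<mapsto> m\<^sup>0 \<otimes>\<^sub>R m\<^sup>1\<close> and \<open>m \<mapsto> m\<^sub>0 \<otimes>\<^sub>L m\<^sub>1\<close> for the two coactions of a comodule, and \<open>j\<close>, \<open>j'\<close> for the
  cleaving map and its convolution inverse. The quasi-inverse of \<open>- \<otimes>\<^sub>B A\<close> sends a relative Hopf
  module \<open>M\<close> to its coinvariants \<open>M\<^sup>c\<^sup>o = {n. n\<^sup>0 \<otimes> n\<^sup>1 = n \<otimes> 1}\<close>, a right \<open>B\<close>-module; unit and counit are
  \<open>w \<mapsto> w \<otimes> 1\<close> and \<open>n \<otimes> a \<mapsto> n a\<close>. As in the fundamental theorem of Hopf modules, everything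
  follows from the map \<open>\<pi>(m) = m\<^sup>0 j'(m\<^sup>1)\<close> (\<open>cleft_pi\<close>), which has three properties.

  First, \<open>m = \<pi>(m\<^sub>0) j(m\<^sub>1)\<close>, by mixed coassociativity and \<open>j' * j = \<eta>\<^sub>R \<epsilon>\<^sub>R\<close>
  (\<open>cleft_pi_reconstruct\<close>). Secondly, \<open>\<pi>(m)\<close> is coinvariant (\<open>cleft_pi_coinvariant\<close>). Indeed \<open>M \<otimes>\<^sub>R H\<close> is a
  right \<open>A\<close>-module by the diagonal action and the coaction \<open>\<rho>\<close> of \<open>M\<close> is \<open>A\<close>-linear; one shows
  \<open>\<rho>(m) = (\<pi>(m\<^sub>0) \<otimes> 1) j(m\<^sub>1)\<close>, and then \<open>\<rho>(\<pi>(m)) = \<rho>(m\<^sup>0) j'(m\<^sup>1)\<close> collapses to \<open>\<pi>(m) \<otimes> 1\<close> by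
  mixed coassociativity and \<open>j * j' = \<eta>\<^sub>L \<epsilon>\<^sub>L\<close>, because \<open>\<eta>\<^sub>L\<close> takes values in \<open>B\<close>. Thirdly,
  \<open>\<pi>(n a) = n \<pi>(a)\<close> for coinvariant \<open>n\<close> (\<open>cleft_pi_coinvariant_da\<close>). Hence \<open>m \<mapsto> \<pi>(m) j(1)\<close> is a projection onto
  \<open>M\<^sup>c\<^sup>o\<close>, the unit has the inverse \<open>w \<otimes> a \<mapsto> w \<pi>(a) j(1)\<close> (\<open>unit_iso\<close>), and the counit has the
  inverse \<open>m \<mapsto> \<pi>(m\<^sub>0) \<otimes> j(m\<^sub>1)\<close> (\<open>counit_bij\<close>). The last inverse involves the \<open>L\<close>-coaction of \<open>n a\<close>, for
  which one needs that coinvariants of the \<open>R\<close>-coaction are coinvariant for the \<open>L\<close>-coaction; this is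
  proved with the antipode (\<open>coinvariant_coactL\<close>).

  The structure of \<open>A\<close> descends to \<open>W \<otimes>\<^sub>B A\<close> because the coactions of \<open>A\<close> are left \<open>B\<close>-linear. The axioms
  of a relative Hopf module are equations between additive maps on \<open>W \<otimes>\<^sub>B A\<close>, so it is enough to verify
  them on pure tensors, where they are those of \<open>A\<close> (\<open>coact_split\<close>, \<open>hopf_module_G\<close>). The factorwise products
  that occur in them make sense because the \<open>R\<close>-coaction of \<open>A\<close> satisfies a Takeuchi condition
  (\<open>ev_rhoR_takeuchi\<close>).

  The calculations are carried out with Sweedler sums \<open>ev K F X\<close>, the value at the tensor \<open>X\<close> of the
  additive map into \<open>K\<close> induced by \<open>F\<close>. Identities of tensors are replaced by identities of such sums, where
  representatives do not occur and coassociativity, counits and Takeuchi conditions become rules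
  for exchanging iterated sums.
\<close>

section \<open>Additive maps out of presented abelian groups\<close>

text \<open>
  The additive extension of \<open>f\<close> to formal sums. \<^const>\<open>tensor_eval\<close> is its value at a chosen representative.
\<close>

definition frag_eval :: "('g, 'z) monoid_scheme \<Rightarrow> ('x \<Rightarrow> 'g) \<Rightarrow> ('x \<Rightarrow>\<^sub>0 int) \<Rightarrow> 'g" where
  "frag_eval G f x = finprod G (\<lambda>p. f p [^]\<^bsub>G\<^esub> (Poly_Mapping.lookup x p :: int)) (Poly_Mapping.keys x)"

lemma tensor_eval_frag_eval: "tensor_eval G f X = frag_eval G f (tensor_rep X)"
  by (simp add: tensor_eval_def frag_eval_def Let_def)

lemma hom_closedD: "h \<in> hom G K \<Longrightarrow> x \<in> carrier G \<Longrightarrow> h x \<in> carrier K"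
  by (auto simp: hom_def)

lemma comm_group_m_closed: "comm_group K \<Longrightarrow> x \<in> carrier K \<Longrightarrow> y \<in> carrier K \<Longrightarrow> x \<otimes>\<^bsub>K\<^esub> y \<in> carrier K"
  by (simp add: comm_group_def comm_monoid_def monoid.m_closed)

lemma frag_eval_superset:
  assumes "comm_group G" "f \<in> P \<rightarrow> carrier G" "finite K" "Poly_Mapping.keys x \<subseteq> K" "K \<subseteq> P"
  shows "frag_eval G f x = finprod G (\<lambda>p. f p [^]\<^bsub>G\<^esub> (Poly_Mapping.lookup x p :: int)) K"
proof -
  interpret comm_group G by fact
  show ?thesis
    unfolding frag_eval_def
    by (rule finprod_mono_neutral_cong_left)
       (use assms in \<open>auto simp: in_keys_iff Pi_iff subset_iff\<close>)
qed

lemma frag_eval_hom: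
  assumes "comm_group G" "f \<in> P \<rightarrow> carrier G"
  shows "frag_eval G f \<in> hom (free_Abelian_group P) G"
proof (rule homI)
  interpret comm_group G by fact
  fix x y
  assume x: "x \<in> carrier (free_Abelian_group P)" and y: "y \<in> carrier (free_Abelian_group P)"
  show "frag_eval G f x \<in> carrier G"
    unfolding frag_eval_def by (rule finprod_closed) (use assms x in \<open>auto simp: Pi_iff subset_iff\<close>)
  let ?K = "Poly_Mapping.keys x \<union> Poly_Mapping.keys y"
  have K: "finite ?K" "?K \<subseteq> P" using x y by auto
  have "frag_eval G f (x + y) = finprod G (\<lambda>p. f p [^]\<^bsub>G\<^esub> (Poly_Mapping.lookup (x + y) p :: int)) ?K"
    by (rule frag_eval_superset[OF assms K(1) _ K(2)]) (rule keys_add)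
  also have "\<dots> = finprod G (\<lambda>p. f p [^]\<^bsub>G\<^esub> (Poly_Mapping.lookup x p :: int) \<otimes>\<^bsub>G\<^esub> f p [^]\<^bsub>G\<^esub> (Poly_Mapping.lookup y p :: int)) ?K"
    by (rule finprod_cong) (use assms K in \<open>auto simp: Poly_Mapping.lookup_add int_pow_mult Pi_iff subset_iff simp_implies_def\<close>)
  also have "\<dots> = finprod G (\<lambda>p. f p [^]\<^bsub>G\<^esub> (Poly_Mapping.lookup x p :: int)) ?K \<otimes>\<^bsub>G\<^esub> finprod G (\<lambda>p. f p [^]\<^bsub>G\<^esub> (Poly_Mapping.lookup y p :: int)) ?K"
    by (rule finprod_multf) (use assms K in \<open>auto simp: Pi_iff subset_iff\<close>)
  also have "\<dots> = frag_eval G f x \<otimes>\<^bsub>G\<^esub> frag_eval G f y"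
    using frag_eval_superset[OF assms K(1) _ K(2)] by auto
  finally show "frag_eval G f (x \<otimes>\<^bsub>free_Abelian_group P\<^esub> y) = frag_eval G f x \<otimes>\<^bsub>G\<^esub> frag_eval G f y"
    by simp
qed

lemma frag_eval_of:
  assumes "comm_group G" "f p \<in> carrier G"
  shows "frag_eval G f (frag_of p) = f p"
proof -
  interpret comm_group G by fact
  show ?thesis using assms by (simp add: frag_eval_def keys_frag_of finprod_insert)
qed

lemma free_Abelian_group_hom_ext:
  assumes "group G" "h \<in> hom (free_Abelian_group P) G" "h' \<in> hom (free_Abelian_group P) G"
    and "\<And>p. p \<in> P \<Longrightarrow> h (frag_of p) = h' (frag_of p)" "Poly_Mapping.keys x \<subseteq> P"
  shows "h x = h' x"
proof -
  interpret h: group_hom "free_Abelian_group P" G h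
    using assms by (simp add: group_hom_def group_hom_axioms_def)
  interpret h': group_hom "free_Abelian_group P" G h'
    using assms by (simp add: group_hom_def group_hom_axioms_def)
  show ?thesis
  proof (rule free_Abelian_group_induct[OF assms(5), of "\<lambda>x. h x = h' x"])
    show "h 0 = h' 0" using h.hom_one h'.hom_one by simp
    fix x y assume *: "Poly_Mapping.keys x \<subseteq> P" "Poly_Mapping.keys y \<subseteq> P" "h x = h' x" "h y = h' y"
    have "h (- y) = inv\<^bsub>G\<^esub> h y" "h' (- y) = inv\<^bsub>G\<^esub> h' y"
      using h.hom_inv[of y] h'.hom_inv[of y] * by simp_all
    then have "h (x + - y) = h' (x + - y)"
      using h.hom_mult[of x "- y"] h'.hom_mult[of x "- y"] * by simp
    then show "h (x - y) = h' (x - y)" using * by simp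
  qed (rule assms(4))
qed

text \<open>
  Every manipulation of sums over a formal sum is an instance of this uniqueness: both sides are additive
  in the formal sum, so it is enough to compare them on generators.
\<close>

lemma frag_eval_unique:
  assumes "comm_group G" "h \<in> hom (free_Abelian_group P) G"
    and "\<And>p. p \<in> P \<Longrightarrow> h (frag_of p) = f p" "Poly_Mapping.keys x \<subseteq> P"
  shows "h x = frag_eval G f x"
proof (rule free_Abelian_group_hom_ext[OF _ assms(2) _ _ assms(4)])
  have f: "f p \<in> carrier G" if "p \<in> P" for p
    using hom_closedD[OF assms(2), of "frag_of p"] assms(3)[OF that] that by simp
  then show "frag_eval G f \<in> hom (free_Abelian_group P) G"
    by (intro frag_eval_hom[OF assms(1)]) auto
  show "group G" using assms(1) by (simp add: comm_group_def)
  show "h (frag_of p) = frag_eval G f (frag_of p)" if "p \<in> P" for p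
    using frag_eval_of[where G = G and f = f and p = p, OF assms(1) f[OF that]] assms(3)[OF that] by simp
qed

lemma frag_extend_hom:
  assumes "\<And>p. p \<in> P \<Longrightarrow> Poly_Mapping.keys (g p) \<subseteq> P'"
  shows "frag_extend g \<in> hom (free_Abelian_group P) (free_Abelian_group P')"
proof (rule homI)
  fix x assume "x \<in> carrier (free_Abelian_group P)"
  then have "Poly_Mapping.keys x \<subseteq> P" by simp
  then have "(\<Union>p\<in>Poly_Mapping.keys x. Poly_Mapping.keys (g p)) \<subseteq> P'" using assms by blast
  then show "frag_extend g x \<in> carrier (free_Abelian_group P')"
    using keys_frag_extend[of g x] by simp
qed (simp add: frag_extend_add)

lemma frag_eval_extend:
  assumes "comm_group G" "f \<in> P' \<rightarrow> carrier G" "\<And>p. p \<in> P \<Longrightarrow> Poly_Mapping.keys (g p) \<subseteq> P'"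
    and "Poly_Mapping.keys x \<subseteq> P"
  shows "frag_eval G f (frag_extend g x) = frag_eval G (\<lambda>p. frag_eval G f (g p)) x"
proof (rule frag_eval_unique[where h = "\<lambda>x. frag_eval G f (frag_extend g x)", OF assms(1) _ _ assms(4)])
  show "(\<lambda>x. frag_eval G f (frag_extend g x)) \<in> hom (free_Abelian_group P) G"
    using hom_compose[OF frag_extend_hom[OF assms(3)] frag_eval_hom[OF assms(1,2)]]
    by (simp add: comp_def)
qed simp

lemma frag_eval_cong:
  assumes "comm_group G" "f \<in> P \<rightarrow> carrier G" "\<And>p. p \<in> P \<Longrightarrow> f p = f' p" "Poly_Mapping.keys x \<subseteq> P"
  shows "frag_eval G f x = frag_eval G f' x"
  by (rule frag_eval_unique[OF assms(1) frag_eval_hom[OF assms(1,2)] _ assms(4)])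
     (metis PiE assms(1,2,3) frag_eval_of)

lemma hom_frag_eval:
  assumes "comm_group G" "comm_group K" "h \<in> hom G K" "f \<in> P \<rightarrow> carrier G" "Poly_Mapping.keys x \<subseteq> P"
  shows "h (frag_eval G f x) = frag_eval K (\<lambda>p. h (f p)) x"
proof (rule frag_eval_unique[where h = "\<lambda>x. h (frag_eval G f x)", OF assms(2) _ _ assms(5)])
  show "(\<lambda>x. h (frag_eval G f x)) \<in> hom (free_Abelian_group P) K"
    using hom_compose[OF frag_eval_hom[OF assms(1,4)] assms(3)] by (simp add: comp_def)
  show "h (frag_eval G f (frag_of p)) = h (f p)" if "p \<in> P" for p
    using that assms(4) by (subst frag_eval_of[OF assms(1)]) auto
qed

lemma frag_eval_mult:
  assumes "comm_group G" "f \<in> P \<rightarrow> carrier G" "f' \<in> P \<rightarrow> carrier G" "Poly_Mapping.keys x \<subseteq> P"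
  shows "frag_eval G (\<lambda>p. f p \<otimes>\<^bsub>G\<^esub> f' p) x = frag_eval G f x \<otimes>\<^bsub>G\<^esub> frag_eval G f' x"
proof -
  interpret comm_group G by fact
  have "(\<lambda>x. frag_eval G f x \<otimes>\<^bsub>G\<^esub> frag_eval G f' x) \<in> hom (free_Abelian_group P) G"
    using hom_mult[OF frag_eval_hom[OF assms(1,2)]] hom_mult[OF frag_eval_hom[OF assms(1,3)]]
      hom_closedD[OF frag_eval_hom[OF assms(1,2)]] hom_closedD[OF frag_eval_hom[OF assms(1,3)]]
    by (intro homI) (simp_all add: m_ac)
  from frag_eval_unique[OF assms(1) this _ assms(4), of "\<lambda>p. f p \<otimes>\<^bsub>G\<^esub> f' p"] show ?thesis
    using assms(2,3) by (simp add: frag_eval_of[OF assms(1)] Pi_iff)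
qed

text \<open>
  An abelian group given by generators \<open>P\<close> and relations \<open>rel\<close>. Twofold and threefold tensor products are
  both of this form, so that their universal property is proved once.
\<close>

locale presentation =
  fixes P :: "'x set" and rel :: "('x \<Rightarrow>\<^sub>0 int) set" and T :: "('x \<Rightarrow>\<^sub>0 int) set monoid"
  assumes rel: "rel \<subseteq> carrier (free_Abelian_group P)"
    and T_def: "T = free_Abelian_group P Mod generate (free_Abelian_group P) rel"
begin

abbreviation "F \<equiv> free_Abelian_group P"
abbreviation "I \<equiv> generate F rel"

lemma subgroup_I: "subgroup I F"
  by (rule group.generate_is_subgroup) (use rel in auto)

lemma comm_group_T: "comm_group T"
  unfolding T_def by (rule comm_group.abelian_FactGroup[OF abelian_free_Abelian_group subgroup_I])

lemma normal_I: "I \<lhd> F"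
  using comm_group.subgroup_imp_normal[OF abelian_free_Abelian_group subgroup_I] .

lemma frag_class_coset: "frag_class T x = I #>\<^bsub>F\<^esub> x"
  by (auto simp: frag_class_def T_def r_coset_def)

lemma frag_class_hom: "frag_class T \<in> hom F T"
proof -
  have "frag_class T = (\<lambda>x. I #>\<^bsub>F\<^esub> x)" by (rule ext) (rule frag_class_coset)
  then show ?thesis using normal.r_coset_hom_Mod[OF normal_I] by (simp add: T_def)
qed

lemma carrier_T: "carrier T = frag_class T ` carrier F"
  using frag_class_coset by (simp add: T_def carrier_FactGroup)

lemma in_frag_class: "Poly_Mapping.keys x \<subseteq> P \<Longrightarrow> x \<in> frag_class T x"
  unfolding frag_class_coset
  by (rule group.rcos_self) (simp_all add: subgroup_I)

lemma tensor_rep: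
  assumes "X \<in> carrier T"
  shows "tensor_rep X \<in> X" "Poly_Mapping.keys (tensor_rep X) \<subseteq> P" "frag_class T (tensor_rep X) = X"
proof -
  obtain x where x: "Poly_Mapping.keys x \<subseteq> P" "X = frag_class T x" using assms carrier_T by auto
  then have "x \<in> X" by (simp add: in_frag_class)
  then show *: "tensor_rep X \<in> X" unfolding tensor_rep_def by (rule someI)
  have X: "X = I #>\<^bsub>F\<^esub> x" using x by (simp add: frag_class_coset)
  have "X \<subseteq> carrier F" unfolding X
    by (rule monoid.r_coset_subset_G[OF group.is_monoid[OF group_free_Abelian_group]])
       (use x subgroup.subset[OF subgroup_I] in auto)
  with * show "Poly_Mapping.keys (tensor_rep X) \<subseteq> P" using subsetD by fastforce
  show "frag_class T (tensor_rep X) = X"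
    using group.repr_independence[OF group_free_Abelian_group, of "tensor_rep X" P I x] * x
    by (simp add: X subgroup_I frag_class_coset)
qed

text \<open>
  The maps on generators that induce an additive map on \<open>T\<close>.
\<close>

definition kills_rel :: "('g, 'z) monoid_scheme \<Rightarrow> ('x \<Rightarrow> 'g) \<Rightarrow> bool" where
  "kills_rel K f \<longleftrightarrow> comm_group K \<and> f \<in> P \<rightarrow> carrier K \<and> (\<forall>r\<in>rel. frag_eval K f r = \<one>\<^bsub>K\<^esub>)"

text \<open>
  Two representatives of a class differ by an element of the subgroup generated by the relations, and the
  kernel of the additive extension is a subgroup that contains the relations. Hence \<^const>\<open>tensor_eval\<close> does
  not see the choice made by \<^const>\<open>tensor_rep\<close>.
\<close>

lemma frag_eval_class_eq:
  assumes "kills_rel K f" "Poly_Mapping.keys x \<subseteq> P" "Poly_Mapping.keys y \<subseteq> P" "frag_class T x = frag_class T y"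
  shows "frag_eval K f x = frag_eval K f y"
proof -
  have hom: "frag_eval K f \<in> hom F K"
    using assms(1) by (auto simp: kills_rel_def intro: frag_eval_hom)
  interpret K: comm_group K using assms(1) by (simp add: kills_rel_def)
  interpret h: group_hom F K "frag_eval K f"
    using hom K.is_group by (simp add: group_hom_def group_hom_axioms_def)
  have "I \<subseteq> kernel F K (frag_eval K f)"
    by (rule group.generate_subgroup_incl[OF group_free_Abelian_group _ h.subgroup_kernel])
       (use rel assms(1) in \<open>auto simp: kills_rel_def kernel_def subset_iff\<close>)
  moreover have "x \<in> I #>\<^bsub>F\<^esub> y"
    using in_frag_class[OF assms(2)] assms(4) by (simp add: frag_class_coset)
  then obtain i where "i \<in> I" "x = i + y" by (auto simp: r_coset_def)
  ultimately have "frag_eval K f i = \<one>\<^bsub>K\<^esub>" "i \<in> carrier F" by (auto simp: kernel_def)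
  then show ?thesis using h.hom_mult[of i y] assms(3) \<open>x = i + y\<close> h.hom_closed[of y] by simp
qed

lemma tensor_eval_class:
  assumes "kills_rel K f" "Poly_Mapping.keys x \<subseteq> P"
  shows "tensor_eval K f (frag_class T x) = frag_eval K f x"
proof -
  have "frag_class T x \<in> carrier T" using assms by (simp add: carrier_T)
  from tensor_rep[OF this] show ?thesis
    unfolding tensor_eval_frag_eval by (intro frag_eval_class_eq[OF assms(1) _ assms(2)])
qed

lemma tensor_eval_hom:
  assumes "kills_rel K f"
  shows "tensor_eval K f \<in> hom T K"
proof (rule homI)
  have h: "frag_eval K f \<in> hom F K"
    using assms by (auto simp: kills_rel_def intro: frag_eval_hom)
  fix X Y assume "X \<in> carrier T" "Y \<in> carrier T"
  then obtain x y where x: "Poly_Mapping.keys x \<subseteq> P" "X = frag_class T x" and y: "Poly_Mapping.keys y \<subseteq> P" "Y = frag_class T y"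
    using carrier_T by auto
  show "tensor_eval K f X \<in> carrier K"
    using hom_closedD[OF h, of x] x by (simp add: tensor_eval_class[OF assms])
  have "Poly_Mapping.keys (x + y) \<subseteq> P" using x y keys_add[of x y] by blast
  then show "tensor_eval K f (X \<otimes>\<^bsub>T\<^esub> Y) = tensor_eval K f X \<otimes>\<^bsub>K\<^esub> tensor_eval K f Y"
    using hom_mult[OF frag_class_hom, of x y, symmetric] hom_mult[OF h, of x y] x y
    by (simp add: tensor_eval_class[OF assms])
qed

lemma frag_class_eq_eval:
  assumes "Poly_Mapping.keys x \<subseteq> P"
  shows "frag_class T x = frag_eval T (\<lambda>p. frag_class T (frag_of p)) x"
  by (rule frag_eval_unique[OF comm_group_T frag_class_hom _ assms]) simp

text \<open>
  An element is the sum of its own generators. This turns equations between elements of \<open>T\<close> into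
  equations between values of additive maps.
\<close>

lemma tensor_eval_generators:
  "X \<in> carrier T \<Longrightarrow> tensor_eval T (\<lambda>p. frag_class T (frag_of p)) X = X"
  using tensor_rep(2,3)[of X] frag_class_eq_eval[of "tensor_rep X"]
  by (simp add: tensor_eval_frag_eval)

lemma frag_class_closed: "Poly_Mapping.keys x \<subseteq> P \<Longrightarrow> frag_class T x \<in> carrier T"
  by (simp add: carrier_T)

lemma kills_rel_generators: "kills_rel T (\<lambda>p. frag_class T (frag_of p))"
  unfolding kills_rel_def
proof (intro conjI ballI)
  show "(\<lambda>p. frag_class T (frag_of p)) \<in> P \<rightarrow> carrier T" by (auto intro!: frag_class_closed)
  fix r assume r: "r \<in> rel"
  then have k: "Poly_Mapping.keys r \<subseteq> P" using subsetD[OF rel] by simp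
  have "frag_class T r = I"
    unfolding frag_class_coset
    by (rule subgroup.rcos_const[OF subgroup_I]) (use r in \<open>auto intro: generate.incl\<close>)
  then show "frag_eval T (\<lambda>p. frag_class T (frag_of p)) r = \<one>\<^bsub>T\<^esub>"
    unfolding frag_class_eq_eval[OF k, symmetric] by (simp add: T_def)
qed (rule comm_group_T)

lemma hom_tensor_eval:
  assumes "comm_group G" "comm_group K" "h \<in> hom G K" "f \<in> P \<rightarrow> carrier G" "X \<in> carrier T"
  shows "h (tensor_eval G f X) = tensor_eval K (\<lambda>p. h (f p)) X"
  unfolding tensor_eval_frag_eval by (rule hom_frag_eval[OF assms(1-4) tensor_rep(2)[OF assms(5)]])

lemma tensor_eval_closed:
  assumes "comm_group G" "f \<in> P \<rightarrow> carrier G" "X \<in> carrier T"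
  shows "tensor_eval G f X \<in> carrier G"
  unfolding tensor_eval_frag_eval
  using hom_closedD[OF frag_eval_hom[OF assms(1,2)]] tensor_rep(2)[OF assms(3)] by simp

lemma tensor_eval_cong:
  assumes "comm_group G" "f \<in> P \<rightarrow> carrier G" "X \<in> carrier T" "\<And>p. p \<in> P \<Longrightarrow> f p = f' p"
  shows "tensor_eval G f X = tensor_eval G f' X"
  unfolding tensor_eval_frag_eval
  by (rule frag_eval_cong[OF assms(1,2,4) tensor_rep(2)[OF assms(3)]])

lemma tensor_eval_mult:
  assumes "comm_group G" "f \<in> P \<rightarrow> carrier G" "f' \<in> P \<rightarrow> carrier G" "X \<in> carrier T"
  shows "tensor_eval G (\<lambda>p. f p \<otimes>\<^bsub>G\<^esub> f' p) X = tensor_eval G f X \<otimes>\<^bsub>G\<^esub> tensor_eval G f' X"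
  unfolding tensor_eval_frag_eval
  by (rule frag_eval_mult[OF assms(1-3) tensor_rep(2)[OF assms(4)]])

end

lemma tensor_map_eval:
  assumes P: "presentation P rel T" and P': "presentation P' rel' T'"
    and "X \<in> carrier T" "\<And>p. p \<in> P \<Longrightarrow> Poly_Mapping.keys (g p) \<subseteq> P'"
  shows "tensor_map T' g X \<in> carrier T'"
    and "presentation.kills_rel P' rel' K f \<Longrightarrow>
      tensor_eval K f (tensor_map T' g X) = tensor_eval K (\<lambda>p. frag_eval K f (g p)) X"
proof -
  interpret P: presentation P rel T by fact
  interpret P': presentation P' rel' T' by fact
  have k: "Poly_Mapping.keys (tensor_rep X) \<subseteq> P" by (rule P.tensor_rep) fact
  have k': "Poly_Mapping.keys (frag_extend g (tensor_rep X)) \<subseteq> P'"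
    using hom_closedD[OF frag_extend_hom[OF assms(4)]] k by simp
  show "tensor_map T' g X \<in> carrier T'"
    unfolding tensor_map_def by (rule P'.frag_class_closed[OF k'])
  assume r: "presentation.kills_rel P' rel' K f"
  then have "comm_group K" "f \<in> P' \<rightarrow> carrier K" by (simp_all add: P'.kills_rel_def)
  from frag_eval_extend[OF this assms(4) k]
  show "tensor_eval K f (tensor_map T' g X) = tensor_eval K (\<lambda>p. frag_eval K f (g p)) X"
    unfolding tensor_map_def P'.tensor_eval_class[OF r k'] unfolding tensor_eval_frag_eval .
qed

text \<open>
  A map given on generators by a sum over a representative of a second tensor \<open>D p\<close>. The maps \<open>M \<otimes> d\<close>,
  \<open>d \<otimes> N\<close>, the factorwise product of tensors and the coaction of \<open>W \<otimes>\<^sub>B A\<close> all have this shape. Followed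
  by an additive map out of \<open>T2\<close> it becomes an iterated sum, in which the two choices of
  representatives no longer occur.
\<close>

lemma tensor_map_flatten:
  fixes \<iota> :: "'x \<Rightarrow> 'y \<Rightarrow> 'w"
  assumes p0: "presentation P0 rel0 T0" and X: "X \<in> carrier T0"
    and p1: "presentation P1 rel1 T1" and D: "\<forall>p\<in>P0. D p \<in> carrier T1"
    and p2: "presentation P2 rel2 T2" and \<iota>: "\<forall>p\<in>P0. \<forall>r\<in>P1. \<iota> p r \<in> P2"
  defines "g \<equiv> \<lambda>p. frag_extend (\<lambda>r. frag_of (\<iota> p r)) (tensor_rep (D p))"
  shows "tensor_map T2 g X \<in> carrier T2"
    and "presentation.kills_rel P2 rel2 K f \<Longrightarrow>
      tensor_eval K f (tensor_map T2 g X) = tensor_eval K (\<lambda>p. tensor_eval K (\<lambda>r. f (\<iota> p r)) (D p)) X"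
proof -
  interpret P2: presentation P2 rel2 T2 by fact
  have rep: "Poly_Mapping.keys (tensor_rep (D p)) \<subseteq> P1" if "p \<in> P0" for p
    using presentation.tensor_rep(2)[OF p1] D that by blast
  have of: "Poly_Mapping.keys (frag_of (\<iota> p r)) \<subseteq> P2" if "p \<in> P0" "r \<in> P1" for p r
    using \<iota> that by (simp add: keys_frag_of)
  have g: "Poly_Mapping.keys (g p) \<subseteq> P2" if "p \<in> P0" for p
    using hom_closedD[OF frag_extend_hom[OF of[OF that]], where x = "tensor_rep (D p)"] rep[OF that] by (simp add: g_def)
  show "tensor_map T2 g X \<in> carrier T2"
    by (rule tensor_map_eval(1)[OF p0 p2 X g])
  assume kill: "P2.kills_rel K f"
  then have K: "comm_group K" and f: "f \<in> P2 \<rightarrow> carrier K" by (simp_all add: P2.kills_rel_def)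
  have "tensor_eval K f (tensor_map T2 g X) = tensor_eval K (\<lambda>p. frag_eval K f (g p)) X"
    by (rule tensor_map_eval(2)[OF p0 p2 X g kill])
  also have "\<dots> = tensor_eval K (\<lambda>p. tensor_eval K (\<lambda>r. f (\<iota> p r)) (D p)) X"
  proof (rule presentation.tensor_eval_cong[OF p0 K _ X])
    show "(\<lambda>p. frag_eval K f (g p)) \<in> P0 \<rightarrow> carrier K"
      using hom_closedD[OF frag_eval_hom[OF K f]] g by simp
    fix p assume p: "p \<in> P0"
    have "frag_eval K f (g p) = frag_eval K (\<lambda>r. frag_eval K f (frag_of (\<iota> p r))) (tensor_rep (D p))"
      unfolding g_def by (rule frag_eval_extend[OF K f of[OF p] rep[OF p]])
    also have "\<dots> = frag_eval K (\<lambda>r. f (\<iota> p r)) (tensor_rep (D p))"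
    proof (rule frag_eval_cong[OF K _ _ rep[OF p]])
      show "frag_eval K f (frag_of (\<iota> p r)) = f (\<iota> p r)" if "r \<in> P1" for r
        using \<iota> p that f by (intro frag_eval_of[OF K]) auto
      then show "(\<lambda>r. frag_eval K f (frag_of (\<iota> p r))) \<in> P1 \<rightarrow> carrier K" using \<iota> p f by auto
    qed
    finally show "frag_eval K f (g p) = tensor_eval K (\<lambda>r. f (\<iota> p r)) (D p)"
      by (simp add: tensor_eval_frag_eval)
  qed
  finally show "tensor_eval K f (tensor_map T2 g X) = tensor_eval K (\<lambda>p. tensor_eval K (\<lambda>r. f (\<iota> p r)) (D p)) X" .
qed

text \<open>
  Fubini for finite sums: both sides are additive in \<open>y\<close>.
\<close>

lemma frag_eval_swap:
  assumes "comm_group K" "\<And>p q. p \<in> P \<Longrightarrow> q \<in> Q \<Longrightarrow> f p q \<in> carrier K"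
    and "Poly_Mapping.keys x \<subseteq> P" "Poly_Mapping.keys y \<subseteq> Q"
  shows "frag_eval K (\<lambda>p. frag_eval K (f p) y) x = frag_eval K (\<lambda>q. frag_eval K (\<lambda>p. f p q) x) y"
proof -
  interpret comm_group K by fact
  have c: "frag_eval K (f p) z \<in> carrier K" if "p \<in> P" "Poly_Mapping.keys z \<subseteq> Q" for p z
    using hom_closedD[OF frag_eval_hom[OF assms(1), of "f p" Q]] assms(2) that by auto
  have "(\<lambda>y. frag_eval K (\<lambda>p. frag_eval K (f p) y) x) \<in> hom (free_Abelian_group Q) K"
  proof (rule homI)
    fix y z assume yz: "y \<in> carrier (free_Abelian_group Q)" "z \<in> carrier (free_Abelian_group Q)"
    show "frag_eval K (\<lambda>p. frag_eval K (f p) y) x \<in> carrier K"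
      using hom_closedD[OF frag_eval_hom[OF assms(1), of "\<lambda>p. frag_eval K (f p) y" P], of x] c assms(3) yz by auto
    have "frag_eval K (\<lambda>p. frag_eval K (f p) (y + z)) x =
          frag_eval K (\<lambda>p. frag_eval K (f p) y \<otimes>\<^bsub>K\<^esub> frag_eval K (f p) z) x"
    proof (rule frag_eval_cong[OF assms(1) _ _ assms(3)])
      have "Poly_Mapping.keys (y + z) \<subseteq> Q" using yz keys_add[of y z] by auto
      then show "(\<lambda>p. frag_eval K (f p) (y + z)) \<in> P \<rightarrow> carrier K" using c by auto
      show "frag_eval K (f p) (y + z) = frag_eval K (f p) y \<otimes>\<^bsub>K\<^esub> frag_eval K (f p) z" if "p \<in> P" for p
        using hom_mult[OF frag_eval_hom[OF assms(1), of "f p" Q], of y z] assms(2) that yz by auto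
    qed
    also have "\<dots> = frag_eval K (\<lambda>p. frag_eval K (f p) y) x \<otimes>\<^bsub>K\<^esub> frag_eval K (\<lambda>p. frag_eval K (f p) z) x"
      by (rule frag_eval_mult[OF assms(1) _ _ assms(3)]) (use c yz in auto)
    finally show "frag_eval K (\<lambda>p. frag_eval K (f p) (y \<otimes>\<^bsub>free_Abelian_group Q\<^esub> z)) x =
      frag_eval K (\<lambda>p. frag_eval K (f p) y) x \<otimes>\<^bsub>K\<^esub> frag_eval K (\<lambda>p. frag_eval K (f p) z) x" by simp
  qed
  from frag_eval_unique[OF assms(1) this _ assms(4), of "\<lambda>q. frag_eval K (\<lambda>p. f p q) x"]
  show ?thesis
    using frag_eval_cong[OF assms(1) _ _ assms(3), of "\<lambda>p. frag_eval K (f p) (frag_of q)" "\<lambda>p. f p q" for q]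
      frag_eval_of[where G = K and f = "\<lambda>q. f p q" and p = q for p q, OF assms(1) assms(2)] assms(2) by (simp add: Pi_iff)
qed

section \<open>Balanced maps and Sweedler sums\<close>

text \<open>
  Under these closure conditions the balancing relations lie in the free group, so that the tensor product
  is a quotient of it.
\<close>

definition tensorable ::
    "'s set \<Rightarrow> ('m, 'x) monoid_scheme \<Rightarrow> ('m \<Rightarrow> 's \<Rightarrow> 'm) \<Rightarrow> ('n, 'y) monoid_scheme \<Rightarrow> ('s \<Rightarrow> 'n \<Rightarrow> 'n) \<Rightarrow> bool" where
  "tensorable S M ra N la \<longleftrightarrow> comm_group M \<and> comm_group N \<and>
     (\<forall>m\<in>carrier M. \<forall>s\<in>S. ra m s \<in> carrier M) \<and> (\<forall>n\<in>carrier N. \<forall>s\<in>S. la s n \<in> carrier N)"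

definition tensor_rels ::
    "'s set \<Rightarrow> ('m, 'x) monoid_scheme \<Rightarrow> ('m \<Rightarrow> 's \<Rightarrow> 'm) \<Rightarrow> ('n, 'y) monoid_scheme \<Rightarrow> ('s \<Rightarrow> 'n \<Rightarrow> 'n)
      \<Rightarrow> ('m \<times> 'n \<Rightarrow>\<^sub>0 int) set" where
  "tensor_rels S M ra N la =
       {frag_of (m \<otimes>\<^bsub>M\<^esub> m', n) - frag_of (m, n) - frag_of (m', n) | m m' n.
           m \<in> carrier M \<and> m' \<in> carrier M \<and> n \<in> carrier N} \<union>
        {frag_of (m, n \<otimes>\<^bsub>N\<^esub> n') - frag_of (m, n) - frag_of (m, n') | m n n'.
           m \<in> carrier M \<and> n \<in> carrier N \<and> n' \<in> carrier N} \<union>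
        {frag_of (ra m s, n) - frag_of (m, la s n) | m s n.
           m \<in> carrier M \<and> s \<in> S \<and> n \<in> carrier N}"

definition tensor3_rels ::
    "('m, 'x) monoid_scheme \<Rightarrow> ('m \<Rightarrow> 's \<Rightarrow> 'm)
      \<Rightarrow> ('n, 'y) monoid_scheme \<Rightarrow> ('s \<Rightarrow> 'n \<Rightarrow> 'n) \<Rightarrow> ('n \<Rightarrow> 't \<Rightarrow> 'n)
      \<Rightarrow> ('p, 'z) monoid_scheme \<Rightarrow> ('t \<Rightarrow> 'p \<Rightarrow> 'p) \<Rightarrow> ('m \<times> 'n \<times> 'p \<Rightarrow>\<^sub>0 int) set" where
  "tensor3_rels M ra N la ra' P la' =
       {frag_of (m \<otimes>\<^bsub>M\<^esub> m', n, p) - frag_of (m, n, p) - frag_of (m', n, p) | m m' n p.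
           m \<in> carrier M \<and> m' \<in> carrier M \<and> n \<in> carrier N \<and> p \<in> carrier P} \<union>
        {frag_of (m, n \<otimes>\<^bsub>N\<^esub> n', p) - frag_of (m, n, p) - frag_of (m, n', p) | m n n' p.
           m \<in> carrier M \<and> n \<in> carrier N \<and> n' \<in> carrier N \<and> p \<in> carrier P} \<union>
        {frag_of (m, n, p \<otimes>\<^bsub>P\<^esub> p') - frag_of (m, n, p) - frag_of (m, n, p') | m n p p'.
           m \<in> carrier M \<and> n \<in> carrier N \<and> p \<in> carrier P \<and> p' \<in> carrier P} \<union>
        {frag_of (ra m s, n, p) - frag_of (m, la s n, p) | m s n p.
           m \<in> carrier M \<and> n \<in> carrier N \<and> p \<in> carrier P} \<union>
        {frag_of (m, ra' n t, p) - frag_of (m, n, la' t p) | m n t p.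
           m \<in> carrier M \<and> n \<in> carrier N \<and> p \<in> carrier P}"

lemma keys_frag_of_diff:
  "Poly_Mapping.keys (frag_of x - frag_of y - frag_of z) \<subseteq> {x, y, z}"
  "Poly_Mapping.keys (frag_of x - frag_of y) \<subseteq> {x, y}"
  using keys_diff[of "frag_of x - frag_of y" "frag_of z"] keys_diff[of "frag_of x" "frag_of y"]
  by (auto simp: keys_frag_of)

lemma presentation_tensor:
  assumes "tensorable S M ra N la"
  shows "presentation (carrier M \<times> carrier N) (tensor_rels S M ra N la) (tensor S M ra N la)"
proof
  interpret M: comm_group M using assms by (simp add: tensorable_def)
  interpret N: comm_group N using assms by (simp add: tensorable_def)
  show "tensor_rels S M ra N la \<subseteq> carrier (free_Abelian_group (carrier M \<times> carrier N))"
    using assms unfolding tensor_rels_def tensorable_def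
    by (auto dest!: subsetD[OF keys_frag_of_diff(1)] subsetD[OF keys_frag_of_diff(2)])
qed (simp add: tensor_def tensor_rels_def Let_def)

lemma presentation_tensor3:
  assumes "tensorable UNIV M ra N la" "tensorable UNIV N ra' P la'"
  shows "presentation (carrier M \<times> carrier N \<times> carrier P) (tensor3_rels M ra N la ra' P la')
    (tensor3 M ra N la ra' P la')"
proof
  interpret M: comm_group M using assms by (simp add: tensorable_def)
  interpret N: comm_group N using assms by (simp add: tensorable_def)
  interpret P: comm_group P using assms by (simp add: tensorable_def)
  show "tensor3_rels M ra N la ra' P la' \<subseteq> carrier (free_Abelian_group (carrier M \<times> carrier N \<times> carrier P))"
    using assms unfolding tensor3_rels_def tensorable_def
    by (auto dest!: subsetD[OF keys_frag_of_diff(1)] subsetD[OF keys_frag_of_diff(2)])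
qed (simp add: tensor3_def tensor3_rels_def Let_def)

text \<open>
  Balanced biadditive maps into an abelian group \<open>K\<close>, written multiplicatively. The conditions on the modules
  and on \<open>K\<close> are included, so that being balanced is the single hypothesis of the universal property.
\<close>

locale balanced =
  fixes S :: "'s set" and M :: "('m, 'x) monoid_scheme" and ra :: "'m \<Rightarrow> 's \<Rightarrow> 'm"
    and N :: "('n, 'y) monoid_scheme" and la :: "'s \<Rightarrow> 'n \<Rightarrow> 'n"
    and K :: "('g, 'z) monoid_scheme" and F :: "'m \<Rightarrow> 'n \<Rightarrow> 'g"
  assumes tensorable: "tensorable S M ra N la" and comm_group: "comm_group K"
    and closed: "m \<in> carrier M \<Longrightarrow> n \<in> carrier N \<Longrightarrow> F m n \<in> carrier K"
    and mult_left: "m \<in> carrier M \<Longrightarrow> m' \<in> carrier M \<Longrightarrow> n \<in> carrier N \<Longrightarrow> F (m \<otimes>\<^bsub>M\<^esub> m') n = F m n \<otimes>\<^bsub>K\<^esub> F m' n"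
    and mult_right: "m \<in> carrier M \<Longrightarrow> n \<in> carrier N \<Longrightarrow> n' \<in> carrier N \<Longrightarrow> F m (n \<otimes>\<^bsub>N\<^esub> n') = F m n \<otimes>\<^bsub>K\<^esub> F m n'"
    and slide: "m \<in> carrier M \<Longrightarrow> s \<in> S \<Longrightarrow> n \<in> carrier N \<Longrightarrow> F (ra m s) n = F m (la s n)"

lemmas balancedI = balanced.intro
lemmas balancedD = balanced.tensorable balanced.comm_group balanced.closed balanced.mult_left balanced.mult_right balanced.slide

locale balanced3 =
  fixes M :: "('m, 'x) monoid_scheme" and ra :: "'m \<Rightarrow> 's \<Rightarrow> 'm"
    and N :: "('n, 'y) monoid_scheme" and la :: "'s \<Rightarrow> 'n \<Rightarrow> 'n" and ra' :: "'n \<Rightarrow> 't \<Rightarrow> 'n"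
    and P :: "('p, 'w) monoid_scheme" and la' :: "'t \<Rightarrow> 'p \<Rightarrow> 'p"
    and K :: "('g, 'z) monoid_scheme" and F :: "'m \<Rightarrow> 'n \<Rightarrow> 'p \<Rightarrow> 'g"
  assumes tensorable: "tensorable UNIV M ra N la" "tensorable UNIV N ra' P la'" and comm_group: "comm_group K"
    and closed: "m \<in> carrier M \<Longrightarrow> n \<in> carrier N \<Longrightarrow> p \<in> carrier P \<Longrightarrow> F m n p \<in> carrier K"
    and mult_left: "m \<in> carrier M \<Longrightarrow> m' \<in> carrier M \<Longrightarrow> n \<in> carrier N \<Longrightarrow> p \<in> carrier P \<Longrightarrow> F (m \<otimes>\<^bsub>M\<^esub> m') n p = F m n p \<otimes>\<^bsub>K\<^esub> F m' n p"
    and mult_middle: "m \<in> carrier M \<Longrightarrow> n \<in> carrier N \<Longrightarrow> n' \<in> carrier N \<Longrightarrow> p \<in> carrier P \<Longrightarrow> F m (n \<otimes>\<^bsub>N\<^esub> n') p = F m n p \<otimes>\<^bsub>K\<^esub> F m n' p"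
    and mult_right: "m \<in> carrier M \<Longrightarrow> n \<in> carrier N \<Longrightarrow> p \<in> carrier P \<Longrightarrow> p' \<in> carrier P \<Longrightarrow> F m n (p \<otimes>\<^bsub>P\<^esub> p') = F m n p \<otimes>\<^bsub>K\<^esub> F m n p'"
    and slide_left: "m \<in> carrier M \<Longrightarrow> n \<in> carrier N \<Longrightarrow> p \<in> carrier P \<Longrightarrow> F (ra m s) n p = F m (la s n) p"
    and slide_right: "m \<in> carrier M \<Longrightarrow> n \<in> carrier N \<Longrightarrow> p \<in> carrier P \<Longrightarrow> F m (ra' n t) p = F m n (la' t p)"

lemmas balanced3I = balanced3.intro
lemmas balanced3D = balanced3.tensorable balanced3.comm_group balanced3.closed balanced3.mult_left balanced3.mult_middle
  balanced3.mult_right balanced3.slide_left balanced3.slide_right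

text \<open>
  The Sweedler sum: for \<open>X = \<Sum>\<^sub>i m\<^sub>i \<otimes> n\<^sub>i\<close> it is \<open>\<Sum>\<^sub>i F m\<^sub>i n\<^sub>i\<close>, formed in \<open>K\<close>. In particular
  \<open>ev K F (\<rho> m)\<close> stands for what is usually written \<open>F m\<^sub>0 m\<^sub>1\<close>.
\<close>

abbreviation ev :: "('g, 'z) monoid_scheme \<Rightarrow> ('m \<Rightarrow> 'n \<Rightarrow> 'g) \<Rightarrow> ('m \<times> 'n \<Rightarrow>\<^sub>0 int) set \<Rightarrow> 'g" where
  "ev K F X \<equiv> tensor_eval K (\<lambda>(m, n). F m n) X"

abbreviation ev3 :: "('g, 'z) monoid_scheme \<Rightarrow> ('m \<Rightarrow> 'n \<Rightarrow> 'p \<Rightarrow> 'g) \<Rightarrow> ('m \<times> 'n \<times> 'p \<Rightarrow>\<^sub>0 int) set \<Rightarrow> 'g" where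
  "ev3 K F X \<equiv> tensor_eval K (\<lambda>(m, n, p). F m n p) X"

lemma frag_eval_rel:
  assumes "comm_group K" "f x \<in> carrier K" "f y \<in> carrier K" "f z \<in> carrier K"
  shows "f x = f y \<otimes>\<^bsub>K\<^esub> f z \<Longrightarrow> frag_eval K f (frag_of x - frag_of y - frag_of z) = \<one>\<^bsub>K\<^esub>"
    and "f x = f y \<Longrightarrow> frag_eval K f (frag_of x - frag_of y) = \<one>\<^bsub>K\<^esub>"
proof -
  interpret K: comm_group K by fact
  let ?P = "{x, y, z}"
  have fP: "f \<in> ?P \<rightarrow> carrier K" using assms by auto
  interpret h: group_hom "free_Abelian_group ?P" K "frag_eval K f"
    using frag_eval_hom[OF assms(1) fP] K.is_group by (simp add: group_hom_def group_hom_axioms_def)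
  have neg: "frag_eval K f (- frag_of w) = inv\<^bsub>K\<^esub> f w" if "w \<in> ?P" for w
    using h.hom_inv[of "frag_of w"] that assms(2-4) by (auto simp: keys_frag_of frag_eval_of[OF assms(1)])
  have k: "Poly_Mapping.keys (frag_of x - frag_of y) \<subseteq> ?P"
    using keys_diff[of "frag_of x" "frag_of y"] by (auto simp: keys_frag_of)
  have xy: "frag_eval K f (frag_of x - frag_of y) = f x \<otimes>\<^bsub>K\<^esub> inv\<^bsub>K\<^esub> f y"
    using h.hom_mult[of "frag_of x" "- frag_of y"] neg[of y] assms(2,3)
    by (simp add: keys_frag_of frag_eval_of[OF assms(1)])
  moreover have "frag_eval K f (frag_of x - frag_of y - frag_of z) = f x \<otimes>\<^bsub>K\<^esub> inv\<^bsub>K\<^esub> f y \<otimes>\<^bsub>K\<^esub> inv\<^bsub>K\<^esub> f z"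
    using h.hom_mult[of "frag_of x - frag_of y" "- frag_of z"] neg[of z] xy k
    by (simp add: keys_frag_of)
  moreover have "f x \<otimes>\<^bsub>K\<^esub> inv\<^bsub>K\<^esub> f y \<otimes>\<^bsub>K\<^esub> inv\<^bsub>K\<^esub> f z = f x \<otimes>\<^bsub>K\<^esub> inv\<^bsub>K\<^esub> (f y \<otimes>\<^bsub>K\<^esub> f z)"
    using assms(2-4) by (simp add: K.inv_mult K.m_assoc)
  ultimately show "f x = f y \<otimes>\<^bsub>K\<^esub> f z \<Longrightarrow> frag_eval K f (frag_of x - frag_of y - frag_of z) = \<one>\<^bsub>K\<^esub>"
    and "f x = f y \<Longrightarrow> frag_eval K f (frag_of x - frag_of y) = \<one>\<^bsub>K\<^esub>"
    using assms(2-4) by simp_all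
qed

lemma frag_eval_rel2:
  assumes "comm_group K" "f x \<in> carrier K" "f y \<in> carrier K" "f x = f y"
  shows "frag_eval K f (frag_of x - frag_of y) = \<one>\<^bsub>K\<^esub>"
  by (rule frag_eval_rel(2)[where z = y]) (use assms in simp_all)

lemma balanced_kills_rel:
  assumes "balanced S M ra N la K F"
  shows "presentation.kills_rel (carrier M \<times> carrier N) (tensor_rels S M ra N la) K (\<lambda>(m, n). F m n)"
proof -
  have t: "tensorable S M ra N la" and K: "comm_group K" by (rule balancedD[OF assms])+
  interpret presentation "carrier M \<times> carrier N" "tensor_rels S M ra N la" "tensor S M ra N la"
    by (rule presentation_tensor[OF t])
  interpret M: comm_group M using t by (simp add: tensorable_def)
  interpret N: comm_group N using t by (simp add: tensorable_def)
  show ?thesis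
    unfolding kills_rel_def
    using t balancedD[OF assms] by (auto simp: tensor_rels_def tensorable_def comm_group_m_closed[OF K] intro!: frag_eval_rel(1) frag_eval_rel2)
qed

lemma balanced3_kills_rel:
  assumes "balanced3 M ra N la ra' P la' K F"
  shows "presentation.kills_rel (carrier M \<times> carrier N \<times> carrier P) (tensor3_rels M ra N la ra' P la') K
    (\<lambda>(m, n, p). F m n p)"
proof -
  have t: "tensorable UNIV M ra N la" "tensorable UNIV N ra' P la'" and K: "comm_group K"
    by (rule balanced3D[OF assms])+
  interpret presentation "carrier M \<times> carrier N \<times> carrier P" "tensor3_rels M ra N la ra' P la'" "tensor3 M ra N la ra' P la'"
    by (rule presentation_tensor3[OF t])
  interpret M: comm_group M using t by (simp add: tensorable_def)
  interpret N: comm_group N using t by (simp add: tensorable_def)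
  interpret P: comm_group P using t by (simp add: tensorable_def)
  show ?thesis
    unfolding kills_rel_def
    using t balanced3D[OF assms] by (auto simp: tensor3_rels_def tensorable_def comm_group_m_closed[OF K] intro!: frag_eval_rel(1) frag_eval_rel2)
qed

lemma comm_group_tensor: "tensorable S M ra N la \<Longrightarrow> comm_group (tensor S M ra N la)"
  by (rule presentation.comm_group_T[OF presentation_tensor])

lemma comm_group_tensor3:
  "tensorable UNIV M ra N la \<Longrightarrow> tensorable UNIV N ra' P la' \<Longrightarrow> comm_group (tensor3 M ra N la ra' P la')"
  by (rule presentation.comm_group_T[OF presentation_tensor3])

lemma ev_closed:
  assumes "tensorable S M ra N la" "comm_group K" "X \<in> carrier (tensor S M ra N la)"
    and "\<And>m n. m \<in> carrier M \<Longrightarrow> n \<in> carrier N \<Longrightarrow> F m n \<in> carrier K"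
  shows "ev K F X \<in> carrier K"
  by (rule presentation.tensor_eval_closed[OF presentation_tensor[OF assms(1)] assms(2) _ assms(3)])
     (use assms(4) in auto)

lemma ev_cong:
  assumes "tensorable S M ra N la" "comm_group K" "X \<in> carrier (tensor S M ra N la)"
    and "\<And>m n. m \<in> carrier M \<Longrightarrow> n \<in> carrier N \<Longrightarrow> F m n \<in> carrier K"
    and "\<And>m n. m \<in> carrier M \<Longrightarrow> n \<in> carrier N \<Longrightarrow> F m n = F' m n"
  shows "ev K F X = ev K F' X"
  by (rule presentation.tensor_eval_cong[OF presentation_tensor[OF assms(1)] assms(2) _ assms(3)])
     (use assms(4,5) in auto)

lemma hom_ev:
  assumes "tensorable S M ra N la" "comm_group G" "comm_group K" "X \<in> carrier (tensor S M ra N la)"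
    and "h \<in> hom G K" "\<And>m n. m \<in> carrier M \<Longrightarrow> n \<in> carrier N \<Longrightarrow> F m n \<in> carrier G"
  shows "h (ev G F X) = ev K (\<lambda>m n. h (F m n)) X"
  using presentation.hom_tensor_eval[OF presentation_tensor[OF assms(1)] assms(2,3,5) _ assms(4), of "\<lambda>(m, n). F m n"]
    assms(6) by (auto simp: case_prod_unfold Pi_iff)

lemma ev_mult_fun:
  assumes "tensorable S M ra N la" "comm_group K" "X \<in> carrier (tensor S M ra N la)"
    and "\<And>m n. m \<in> carrier M \<Longrightarrow> n \<in> carrier N \<Longrightarrow> F m n \<in> carrier K"
    and "\<And>m n. m \<in> carrier M \<Longrightarrow> n \<in> carrier N \<Longrightarrow> F' m n \<in> carrier K"
  shows "ev K (\<lambda>m n. F m n \<otimes>\<^bsub>K\<^esub> F' m n) X = ev K F X \<otimes>\<^bsub>K\<^esub> ev K F' X"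
  using presentation.tensor_eval_mult[OF presentation_tensor[OF assms(1)] assms(2) _ _ assms(3),
      of "\<lambda>(m, n). F m n" "\<lambda>(m, n). F' m n"] assms(4,5) by (auto simp: case_prod_unfold Pi_iff)

lemma ev_pure:
  assumes "balanced S M ra N la K F" "m \<in> carrier M" "n \<in> carrier N"
  shows "ev K F (pure_tensor (tensor S M ra N la) m n) = F m n"
  using presentation.tensor_eval_class[OF presentation_tensor[OF balancedD(1)[OF assms(1)]] balanced_kills_rel[OF assms(1)],
      of "frag_of (m, n)"] frag_eval_of[of K "\<lambda>(m, n). F m n" "(m, n)"] assms balancedD[OF assms(1)]
  by (simp add: pure_tensor_def keys_frag_of)

lemma pure_tensor_closed:
  assumes "tensorable S M ra N la" "m \<in> carrier M" "n \<in> carrier N"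
  shows "pure_tensor (tensor S M ra N la) m n \<in> carrier (tensor S M ra N la)"
  unfolding pure_tensor_def
  by (rule presentation.frag_class_closed[OF presentation_tensor[OF assms(1)]])
     (use assms in \<open>simp add: keys_frag_of\<close>)

lemma ev_hom:
  assumes "balanced S M ra N la K F"
  shows "ev K F \<in> hom (tensor S M ra N la) K"
  by (rule presentation.tensor_eval_hom[OF presentation_tensor[OF balancedD(1)[OF assms]] balanced_kills_rel[OF assms]])

lemma ev_self:
  assumes "tensorable S M ra N la" "X \<in> carrier (tensor S M ra N la)"
  shows "ev (tensor S M ra N la) (pure_tensor (tensor S M ra N la)) X = X"
  using presentation.tensor_eval_generators[OF presentation_tensor[OF assms(1)] assms(2)]
  by (simp add: pure_tensor_def case_prod_unfold)

text \<open>
  The defining relations hold in the quotient; this makes the universal map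
  \<open>m, n \<mapsto> m \<otimes> n\<close> balanced.
\<close>

lemma frag_class_diffs:
  assumes p: "presentation P rel T" and "x \<in> P" "y \<in> P" "z \<in> P"
  shows "frag_of x - frag_of y - frag_of z \<in> rel \<Longrightarrow>
      frag_class T (frag_of x) = frag_class T (frag_of y) \<otimes>\<^bsub>T\<^esub> frag_class T (frag_of z)"
    and "frag_of x - frag_of y \<in> rel \<Longrightarrow> frag_class T (frag_of x) = frag_class T (frag_of y)"
proof -
  interpret presentation P rel T by fact
  interpret comm_group T by (rule comm_group_T)
  interpret h: group_hom "free_Abelian_group P" T "frag_class T"
    using frag_class_hom is_group by (simp add: group_hom_def group_hom_axioms_def)
  have z: "frag_class T r = \<one>\<^bsub>T\<^esub>" if "r \<in> rel" for r
    using kills_rel_generators that frag_class_eq_eval[of r] subsetD[OF rel that]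
    by (simp add: kills_rel_def)
  have xyz: "frag_of x = (frag_of x - frag_of y - frag_of z) + (frag_of y + frag_of z)"
    "frag_of x = (frag_of x - frag_of y) + frag_of y" by simp_all
  have k: "Poly_Mapping.keys (frag_of y + frag_of z) \<subseteq> P"
    using keys_add[of "frag_of y" "frag_of z"] assms by (auto simp: keys_frag_of)
  have c: "frag_class T (frag_of x) \<in> carrier T" "frag_class T (frag_of y) \<in> carrier T" "frag_class T (frag_of z) \<in> carrier T"
    using assms by (auto intro!: frag_class_closed simp: keys_frag_of)
  have "frag_class T (frag_of y + frag_of z) = frag_class T (frag_of y) \<otimes>\<^bsub>T\<^esub> frag_class T (frag_of z)"
    using h.hom_mult[of "frag_of y" "frag_of z"] assms by (simp add: keys_frag_of)
  moreover have "frag_class T (frag_of x) = frag_class T (frag_of y + frag_of z)"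
    if r: "frag_of x - frag_of y - frag_of z \<in> rel"
    using h.hom_mult[of "frag_of x - frag_of y - frag_of z" "frag_of y + frag_of z"] z[OF r] k subsetD[OF rel r] frag_class_closed[OF k]
    by (simp flip: xyz(1))
  ultimately show "frag_of x - frag_of y - frag_of z \<in> rel \<Longrightarrow>
      frag_class T (frag_of x) = frag_class T (frag_of y) \<otimes>\<^bsub>T\<^esub> frag_class T (frag_of z)"
    by simp
  show "frag_of x - frag_of y \<in> rel \<Longrightarrow> frag_class T (frag_of x) = frag_class T (frag_of y)"
    using h.hom_mult[of "frag_of x - frag_of y" "frag_of y"] z subsetD[OF rel] c assms
    by (simp add: keys_frag_of)
qed

lemma balanced_pure_tensor:
  assumes "tensorable S M ra N la"
  shows "balanced S M ra N la (tensor S M ra N la) (pure_tensor (tensor S M ra N la))"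
proof -
  interpret M: comm_group M using assms by (simp add: tensorable_def)
  interpret N: comm_group N using assms by (simp add: tensorable_def)
  let ?T = "tensor S M ra N la" and ?r = "tensor_rels S M ra N la"
  note d = frag_class_diffs[OF presentation_tensor[OF assms]]
  have ra: "ra m s \<in> carrier M" if "m \<in> carrier M" "s \<in> S" for m s
    using assms that by (simp add: tensorable_def)
  have la: "la s n \<in> carrier N" if "n \<in> carrier N" "s \<in> S" for n s
    using assms that by (simp add: tensorable_def)
  show ?thesis
    unfolding pure_tensor_def
  proof (rule balancedI[OF assms comm_group_tensor[OF assms] pure_tensor_closed[OF assms, unfolded pure_tensor_def]])
    fix m m' n assume *: "m \<in> carrier M" "m' \<in> carrier M" "n \<in> carrier N"
    then have "frag_of (m \<otimes>\<^bsub>M\<^esub> m', n) - frag_of (m, n) - frag_of (m', n) \<in> ?r"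
      unfolding tensor_rels_def by blast
    then show "frag_class ?T (frag_of (m \<otimes>\<^bsub>M\<^esub> m', n)) = frag_class ?T (frag_of (m, n)) \<otimes>\<^bsub>?T\<^esub> frag_class ?T (frag_of (m', n))"
      using * by (intro d(1)) simp_all
  next
    fix m n n' assume *: "m \<in> carrier M" "n \<in> carrier N" "n' \<in> carrier N"
    then have "frag_of (m, n \<otimes>\<^bsub>N\<^esub> n') - frag_of (m, n) - frag_of (m, n') \<in> ?r"
      unfolding tensor_rels_def by blast
    then show "frag_class ?T (frag_of (m, n \<otimes>\<^bsub>N\<^esub> n')) = frag_class ?T (frag_of (m, n)) \<otimes>\<^bsub>?T\<^esub> frag_class ?T (frag_of (m, n'))"
      using * by (intro d(1)) simp_all
  next
    fix m s n assume *: "m \<in> carrier M" "s \<in> S" "n \<in> carrier N"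
    then have "frag_of (ra m s, n) - frag_of (m, la s n) \<in> ?r"
      unfolding tensor_rels_def by blast
    then show "frag_class ?T (frag_of (ra m s, n)) = frag_class ?T (frag_of (m, la s n))"
      using * ra la by (intro d(2)[where z = "(m, la s n)"]) simp_all
  qed
qed

definition pure_tensor3 :: "('m \<times> 'n \<times> 'p \<Rightarrow>\<^sub>0 int) set monoid \<Rightarrow> 'm \<Rightarrow> 'n \<Rightarrow> 'p \<Rightarrow> ('m \<times> 'n \<times> 'p \<Rightarrow>\<^sub>0 int) set" where
  "pure_tensor3 T m n p = frag_class T (frag_of (m, n, p))"

lemma pure_tensor3_closed:
  assumes "tensorable UNIV M ra N la" "tensorable UNIV N ra' P la'" "m \<in> carrier M" "n \<in> carrier N" "p \<in> carrier P"
  shows "pure_tensor3 (tensor3 M ra N la ra' P la') m n p \<in> carrier (tensor3 M ra N la ra' P la')"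
  unfolding pure_tensor3_def
  by (rule presentation.frag_class_closed[OF presentation_tensor3[OF assms(1,2)]])
     (use assms in \<open>simp add: keys_frag_of\<close>)

lemma balanced3_pure_tensor3:
  assumes t: "tensorable UNIV M ra N la" "tensorable UNIV N ra' P la'"
  shows "balanced3 M ra N la ra' P la' (tensor3 M ra N la ra' P la') (pure_tensor3 (tensor3 M ra N la ra' P la'))"
proof -
  interpret M: comm_group M using t by (simp add: tensorable_def)
  interpret N: comm_group N using t by (simp add: tensorable_def)
  interpret P: comm_group P using t by (simp add: tensorable_def)
  let ?T = "tensor3 M ra N la ra' P la'" and ?r = "tensor3_rels M ra N la ra' P la'"
  note d = frag_class_diffs[OF presentation_tensor3[OF t]]
  have ra: "ra m s \<in> carrier M" if "m \<in> carrier M" for m s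
    using t that by (simp add: tensorable_def)
  have ra': "ra' n s \<in> carrier N" if "n \<in> carrier N" for n s
    using t that by (simp add: tensorable_def)
  have la: "la s n \<in> carrier N" if "n \<in> carrier N" for n s
    using t that by (simp add: tensorable_def)
  have la': "la' s p \<in> carrier P" if "p \<in> carrier P" for p s
    using t that by (simp add: tensorable_def)
  show ?thesis
    unfolding pure_tensor3_def
  proof (rule balanced3I[OF t comm_group_tensor3[OF t] pure_tensor3_closed[OF t, unfolded pure_tensor3_def]])
    fix m m' n p assume *: "m \<in> carrier M" "m' \<in> carrier M" "n \<in> carrier N" "p \<in> carrier P"
    then have "frag_of (m \<otimes>\<^bsub>M\<^esub> m', n, p) - frag_of (m, n, p) - frag_of (m', n, p) \<in> ?r"
      unfolding tensor3_rels_def by blast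
    then show "frag_class ?T (frag_of (m \<otimes>\<^bsub>M\<^esub> m', n, p)) = frag_class ?T (frag_of (m, n, p)) \<otimes>\<^bsub>?T\<^esub> frag_class ?T (frag_of (m', n, p))"
      using * by (intro d(1)) simp_all
  next
    fix m n n' p assume *: "m \<in> carrier M" "n \<in> carrier N" "n' \<in> carrier N" "p \<in> carrier P"
    then have "frag_of (m, n \<otimes>\<^bsub>N\<^esub> n', p) - frag_of (m, n, p) - frag_of (m, n', p) \<in> ?r"
      unfolding tensor3_rels_def by blast
    then show "frag_class ?T (frag_of (m, n \<otimes>\<^bsub>N\<^esub> n', p)) = frag_class ?T (frag_of (m, n, p)) \<otimes>\<^bsub>?T\<^esub> frag_class ?T (frag_of (m, n', p))"
      using * by (intro d(1)) simp_all
  next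
    fix m n p p' assume *: "m \<in> carrier M" "n \<in> carrier N" "p \<in> carrier P" "p' \<in> carrier P"
    then have "frag_of (m, n, p \<otimes>\<^bsub>P\<^esub> p') - frag_of (m, n, p) - frag_of (m, n, p') \<in> ?r"
      unfolding tensor3_rels_def by blast
    then show "frag_class ?T (frag_of (m, n, p \<otimes>\<^bsub>P\<^esub> p')) = frag_class ?T (frag_of (m, n, p)) \<otimes>\<^bsub>?T\<^esub> frag_class ?T (frag_of (m, n, p'))"
      using * by (intro d(1)) simp_all
  next
    fix m s n p assume *: "m \<in> carrier M" "n \<in> carrier N" "p \<in> carrier P"
    then have "frag_of (ra m s, n, p) - frag_of (m, la s n, p) \<in> ?r"
      unfolding tensor3_rels_def by blast
    then show "frag_class ?T (frag_of (ra m s, n, p)) = frag_class ?T (frag_of (m, la s n, p))"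
      using * ra la by (intro d(2)[where z = "(m, la s n, p)"]) simp_all
  next
    fix m n s p assume *: "m \<in> carrier M" "n \<in> carrier N" "p \<in> carrier P"
    then have "frag_of (m, ra' n s, p) - frag_of (m, n, la' s p) \<in> ?r"
      unfolding tensor3_rels_def by blast
    then show "frag_class ?T (frag_of (m, ra' n s, p)) = frag_class ?T (frag_of (m, n, la' s p))"
      using * ra' la' by (intro d(2)[where z = "(m, n, la' s p)"]) simp_all
  qed
qed


lemma ev3_self:
  assumes "tensorable UNIV M ra N la" "tensorable UNIV N ra' P la'" "X \<in> carrier (tensor3 M ra N la ra' P la')"
  shows "ev3 (tensor3 M ra N la ra' P la') (pure_tensor3 (tensor3 M ra N la ra' P la')) X = X"
  using presentation.tensor_eval_generators[OF presentation_tensor3[OF assms(1,2)] assms(3)]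
  by (simp add: pure_tensor3_def case_prod_unfold)

lemma ev_swap:
  assumes "tensorable S M ra N la" "X \<in> carrier (tensor S M ra N la)"
    and "tensorable S' M' ra' N' la'" "Y \<in> carrier (tensor S' M' ra' N' la')" "comm_group K"
    and "\<And>m n m' n'. m \<in> carrier M \<Longrightarrow> n \<in> carrier N \<Longrightarrow> m' \<in> carrier M' \<Longrightarrow> n' \<in> carrier N' \<Longrightarrow> F m n m' n' \<in> carrier K"
  shows "ev K (\<lambda>m n. ev K (\<lambda>m' n'. F m n m' n') Y) X = ev K (\<lambda>m' n'. ev K (\<lambda>m n. F m n m' n') X) Y"
  using frag_eval_swap[OF assms(5) _ presentation.tensor_rep(2)[OF presentation_tensor[OF assms(1)] assms(2)]
      presentation.tensor_rep(2)[OF presentation_tensor[OF assms(3)] assms(4)],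
      of "\<lambda>(m, n) (m', n'). F m n m' n'"] assms(6)
  by (auto simp: tensor_eval_frag_eval case_prod_unfold)

text \<open>
  The pattern recurs for \<open>M \<otimes> d\<close>, \<open>d \<otimes> N\<close> and the factorwise product: a balanced map is evaluated by
  substitution, and for the universal balanced map this writes the tensor itself as a Sweedler sum of
  pure tensors.
\<close>

lemma tensor_map2_ev:
  assumes "tensorable S M ra N la" "X \<in> carrier (tensor S M ra N la)" "tensorable S' M' ra' N' la'"
    and "\<And>m. m \<in> carrier M \<Longrightarrow> f m \<in> carrier M'" "\<And>n. n \<in> carrier N \<Longrightarrow> g n \<in> carrier N'"
  shows "tensor_map2 (tensor S' M' ra' N' la') f g X \<in> carrier (tensor S' M' ra' N' la')"
    and "tensor_map2 (tensor S' M' ra' N' la') f g X =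
      ev (tensor S' M' ra' N' la') (\<lambda>m n. pure_tensor (tensor S' M' ra' N' la') (f m) (g n)) X"
    and "balanced S' M' ra' N' la' K F \<Longrightarrow>
      ev K F (tensor_map2 (tensor S' M' ra' N' la') f g X) = ev K (\<lambda>m n. F (f m) (g n)) X"
proof -
  let ?g = "\<lambda>(m, n). frag_of (f m, g n)"
  have k: "Poly_Mapping.keys (?g p) \<subseteq> carrier M' \<times> carrier N'" if "p \<in> carrier M \<times> carrier N" for p
    using that assms(4,5) by (auto simp: keys_frag_of)
  note t = tensor_map_eval[OF presentation_tensor[OF assms(1)] presentation_tensor[OF assms(3)] assms(2) k]
  show *: "tensor_map2 (tensor S' M' ra' N' la') f g X \<in> carrier (tensor S' M' ra' N' la')"
    unfolding tensor_map2_def by (rule t(1))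
  show 2: "ev K F (tensor_map2 (tensor S' M' ra' N' la') f g X) = ev K (\<lambda>m n. F (f m) (g n)) X"
    if b: "balanced S' M' ra' N' la' K F" for K :: "('y, 'z) monoid_scheme" and F
  proof -
    have "ev K F (tensor_map2 (tensor S' M' ra' N' la') f g X) =
        tensor_eval K (\<lambda>p. frag_eval K (\<lambda>(m, n). F m n) (?g p)) X"
      unfolding tensor_map2_def using t(2)[OF _ balanced_kills_rel[OF b]] by simp
    also have "\<dots> = ev K (\<lambda>m n. F (f m) (g n)) X"
      by (rule presentation.tensor_eval_cong[OF presentation_tensor[OF assms(1)] balancedD(2)[OF b] _ assms(2)])
         (use balancedD(2,3)[OF b] assms(4,5) in \<open>auto simp: frag_eval_of\<close>)
    finally show ?thesis .
  qed
  show "tensor_map2 (tensor S' M' ra' N' la') f g X =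
      ev (tensor S' M' ra' N' la') (\<lambda>m n. pure_tensor (tensor S' M' ra' N' la') (f m) (g n)) X"
    using ev_self[OF assms(3) *] 2[OF balanced_pure_tensor[OF assms(3)]] by simp
qed

lemma split_right_ev:
  assumes "tensorable S0 M ra0 Q la0" "X \<in> carrier (tensor S0 M ra0 Q la0)"
    and "tensorable S1 N ra1 P la1" "\<And>q. q \<in> carrier Q \<Longrightarrow> d q \<in> carrier (tensor S1 N ra1 P la1)"
    and t: "tensorable UNIV M ra N la" "tensorable UNIV N ra' P la'"
  defines "T3 \<equiv> tensor3 M ra N la ra' P la'"
  shows "split_right T3 d X \<in> carrier T3"
    and "split_right T3 d X = ev T3 (\<lambda>m q. ev T3 (\<lambda>n p. pure_tensor3 T3 m n p) (d q)) X"
    and "balanced3 M ra N la ra' P la' K F \<Longrightarrow>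
      ev3 K F (split_right T3 d X) = ev K (\<lambda>m q. ev K (\<lambda>n p. F m n p) (d q)) X"
proof -
  let ?\<iota> = "\<lambda>p r. (fst p, fst r, snd r)"
  have eq: "split_right T3 d X = tensor_map T3 (\<lambda>p. frag_extend (\<lambda>r. frag_of (?\<iota> p r)) (tensor_rep (d (snd p)))) X"
    by (simp add: split_right_def case_prod_unfold)
  have d: "\<forall>p\<in>carrier M \<times> carrier Q. d (snd p) \<in> carrier (tensor S1 N ra1 P la1)"
    by (auto intro: assms(4))
  have \<iota>: "\<forall>p\<in>carrier M \<times> carrier Q. \<forall>r\<in>carrier N \<times> carrier P. ?\<iota> p r \<in> carrier M \<times> carrier N \<times> carrier P"
    by auto
  note flat = tensor_map_flatten[where \<iota> = ?\<iota> and D = "\<lambda>p. d (snd p)", OF presentation_tensor[OF assms(1)] assms(2) presentation_tensor[OF assms(3)] d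
      presentation_tensor3[OF t] \<iota>, folded T3_def]
  show *: "split_right T3 d X \<in> carrier T3" unfolding eq by (rule flat(1))
  show 2: "ev3 K F (split_right T3 d X) = ev K (\<lambda>m q. ev K (\<lambda>n p. F m n p) (d q)) X"
    if b: "balanced3 M ra N la ra' P la' K F" for K :: "('y, 'z) monoid_scheme" and F
    using flat(2)[OF balanced3_kills_rel[OF b]] unfolding eq by (simp add: case_prod_unfold)
  show "split_right T3 d X = ev T3 (\<lambda>m q. ev T3 (\<lambda>n p. pure_tensor3 T3 m n p) (d q)) X"
    using ev3_self[OF t, folded T3_def, OF *] 2[OF balanced3_pure_tensor3[OF t, folded T3_def]] by simp
qed

lemma split_left_ev:
  assumes "tensorable S0 Q ra0 P la0" "X \<in> carrier (tensor S0 Q ra0 P la0)"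
    and "tensorable S1 M ra1 N la1" "\<And>q. q \<in> carrier Q \<Longrightarrow> d q \<in> carrier (tensor S1 M ra1 N la1)"
    and t: "tensorable UNIV M ra N la" "tensorable UNIV N ra' P la'"
  defines "T3 \<equiv> tensor3 M ra N la ra' P la'"
  shows "split_left T3 d X \<in> carrier T3"
    and "split_left T3 d X = ev T3 (\<lambda>q p. ev T3 (\<lambda>m n. pure_tensor3 T3 m n p) (d q)) X"
    and "balanced3 M ra N la ra' P la' K F \<Longrightarrow>
      ev3 K F (split_left T3 d X) = ev K (\<lambda>q p. ev K (\<lambda>m n. F m n p) (d q)) X"
proof -
  let ?\<iota> = "\<lambda>p r. (fst r, snd r, snd p)"
  have eq: "split_left T3 d X = tensor_map T3 (\<lambda>p. frag_extend (\<lambda>r. frag_of (?\<iota> p r)) (tensor_rep (d (fst p)))) X"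
    by (simp add: split_left_def case_prod_unfold)
  have d: "\<forall>p\<in>carrier Q \<times> carrier P. d (fst p) \<in> carrier (tensor S1 M ra1 N la1)"
    by (auto intro: assms(4))
  have \<iota>: "\<forall>p\<in>carrier Q \<times> carrier P. \<forall>r\<in>carrier M \<times> carrier N. ?\<iota> p r \<in> carrier M \<times> carrier N \<times> carrier P"
    by auto
  note flat = tensor_map_flatten[where \<iota> = ?\<iota> and D = "\<lambda>p. d (fst p)", OF presentation_tensor[OF assms(1)] assms(2) presentation_tensor[OF assms(3)] d
      presentation_tensor3[OF t] \<iota>, folded T3_def]
  show *: "split_left T3 d X \<in> carrier T3" unfolding eq by (rule flat(1))
  show 2: "ev3 K F (split_left T3 d X) = ev K (\<lambda>q p. ev K (\<lambda>m n. F m n p) (d q)) X"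
    if b: "balanced3 M ra N la ra' P la' K F" for K :: "('y, 'z) monoid_scheme" and F
    using flat(2)[OF balanced3_kills_rel[OF b]] unfolding eq by (simp add: case_prod_unfold)
  show "split_left T3 d X = ev T3 (\<lambda>q p. ev T3 (\<lambda>m n. pure_tensor3 T3 m n p) (d q)) X"
    using ev3_self[OF t, folded T3_def, OF *] 2[OF balanced3_pure_tensor3[OF t, folded T3_def]] by simp
qed

lemma comm_group_additive [simp]: "comm_group (additive_group :: 'b::ab_group_add monoid)"
proof (rule comm_groupI)
  fix x :: 'b assume "x \<in> carrier additive_group"
  show "\<exists>y\<in>carrier additive_group. y \<otimes>\<^bsub>additive_group\<^esub> x = \<one>\<^bsub>additive_group\<^esub>"
    by (rule bexI[of _ "- x"]) (simp_all add: additive_group_def)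
qed (simp_all add: additive_group_def ac_simps)

lemma additive_group_simps [simp]:
  "carrier (additive_group :: 'b::ab_group_add monoid) = UNIV"
  "x \<otimes>\<^bsub>additive_group\<^esub> (y :: 'b) = x + y"
  "\<one>\<^bsub>additive_group\<^esub> = (0 :: 'b)"
  by (simp_all add: additive_group_def)

lemma tensor_mult_ev:
  fixes X :: "('m \<times> 'h::{ring,monoid_mult} \<Rightarrow>\<^sub>0 int) set" and Y :: "('a \<times> 'h \<Rightarrow>\<^sub>0 int) set"
  assumes "tensorable S0 M ra0 additive_group la0" "X \<in> carrier (tensor S0 M ra0 additive_group la0)"
    and "tensorable S1 A ra1 additive_group la1" "Y \<in> carrier (tensor S1 A ra1 additive_group la1)"
    and t: "tensorable S N ra additive_group la"
    and f: "\<And>m a. m \<in> carrier M \<Longrightarrow> a \<in> carrier A \<Longrightarrow> f m a \<in> carrier N"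
  defines "T \<equiv> tensor S N ra additive_group la"
  shows "tensor_mult T f X Y \<in> carrier T"
    and "tensor_mult T f X Y = ev T (\<lambda>m h. ev T (\<lambda>a h'. pure_tensor T (f m a) (h * h')) Y) X"
    and "balanced S N ra additive_group la K F \<Longrightarrow>
      ev K F (tensor_mult T f X Y) = ev K (\<lambda>m h. ev K (\<lambda>a h'. F (f m a) (h * h')) Y) X"
proof -
  let ?\<iota> = "\<lambda>p r. (f (fst p) (fst r), snd p * snd r)"
  have eq: "tensor_mult T f X Y = tensor_map T (\<lambda>p. frag_extend (\<lambda>r. frag_of (?\<iota> p r)) (tensor_rep Y)) X"
    by (simp add: tensor_mult_def tensor_map_def case_prod_unfold)
  have \<iota>: "\<forall>p\<in>carrier M \<times> carrier additive_group. \<forall>r\<in>carrier A \<times> carrier additive_group. ?\<iota> p r \<in> carrier N \<times> carrier additive_group"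
    by (auto intro: f)
  note flat = tensor_map_flatten[where \<iota> = ?\<iota> and D = "\<lambda>p. Y", OF presentation_tensor[OF assms(1)] assms(2) presentation_tensor[OF assms(3)] ballI[OF assms(4)]
      presentation_tensor[OF t] \<iota>, folded T_def]
  show *: "tensor_mult T f X Y \<in> carrier T" unfolding eq by (rule flat(1))
  show 2: "ev K F (tensor_mult T f X Y) = ev K (\<lambda>m h. ev K (\<lambda>a h'. F (f m a) (h * h')) Y) X"
    if b: "balanced S N ra additive_group la K F" for K :: "('y, 'z) monoid_scheme" and F
    using flat(2)[OF balanced_kills_rel[OF b]] unfolding eq by (simp add: case_prod_unfold)
  show "tensor_mult T f X Y = ev T (\<lambda>m h. ev T (\<lambda>a h'. pure_tensor T (f m a) (h * h')) Y) X"
    using ev_self[OF t, folded T_def, OF *] 2[OF balanced_pure_tensor[OF t, folded T_def]] by simp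
qed

section \<open>Sweedler calculus in comodules\<close>

lemma tensorable_additive [simp]: "tensorable S additive_group ra additive_group la"
  by (simp add: tensorable_def)

text \<open>
  Coassociativity in Sweedler form: an equation between \<open>(d \<otimes> N) X\<close> and \<open>(M \<otimes> d') Y\<close> in a threefold tensor
  product allows one to exchange iterated Sweedler sums of a balanced map of three arguments.
\<close>

lemma split_eqD:
  assumes eq: "split_left (tensor3 M ra N la ra' P la') d X = split_right (tensor3 M ra N la ra' P la') d' Y"
    and "tensorable S0 Q ra0 P la0" "X \<in> carrier (tensor S0 Q ra0 P la0)"
    and "tensorable S1 M ra1 N la1" "\<And>q. q \<in> carrier Q \<Longrightarrow> d q \<in> carrier (tensor S1 M ra1 N la1)"
    and "tensorable S2 M ra2 Q' la2" "Y \<in> carrier (tensor S2 M ra2 Q' la2)"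
    and "tensorable S3 N ra3 P la3" "\<And>q. q \<in> carrier Q' \<Longrightarrow> d' q \<in> carrier (tensor S3 N ra3 P la3)"
    and b: "balanced3 M ra N la ra' P la' K F"
  shows "ev K (\<lambda>q p. ev K (\<lambda>m n. F m n p) (d q)) X = ev K (\<lambda>m q. ev K (\<lambda>n p. F m n p) (d' q)) Y"
proof -
  have "ev K (\<lambda>q p. ev K (\<lambda>m n. F m n p) (d q)) X = ev3 K F (split_left (tensor3 M ra N la ra' P la') d X)"
    by (rule split_left_ev(3)[OF assms(2-4) _ balanced3D(1,2)[OF b] b, symmetric]) (rule assms(5))
  also have "\<dots> = ev3 K F (split_right (tensor3 M ra N la ra' P la') d' Y)" by (simp add: eq)
  also have "\<dots> = ev K (\<lambda>m q. ev K (\<lambda>n p. F m n p) (d' q)) Y"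
    by (rule split_right_ev(3)[OF assms(6-8) _ balanced3D(1,2)[OF b] b]) (rule assms(9))
  finally show ?thesis .
qed

context right_comodule
begin

abbreviation "T \<equiv> tensor UNIV M ac additive_group la"
abbreviation "TC \<equiv> tensor UNIV additive_group ra additive_group la"

lemma comm_group_M: "comm_group M"
  using module by (simp add: right_module_def)

lemma ac_closed: "m \<in> carrier M \<Longrightarrow> ac m r \<in> carrier M"
  and ac_mult: "m \<in> carrier M \<Longrightarrow> m' \<in> carrier M \<Longrightarrow> ac (m \<otimes>\<^bsub>M\<^esub> m') r = ac m r \<otimes>\<^bsub>M\<^esub> ac m' r"
  and ac_add: "m \<in> carrier M \<Longrightarrow> ac m (r + r') = ac m r \<otimes>\<^bsub>M\<^esub> ac m r'"
  and ac_ac: "m \<in> carrier M \<Longrightarrow> ac m (r * r') = ac (ac m r) r'"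
  and ac_one: "m \<in> carrier M \<Longrightarrow> ac m 1 = m"
  using module by (simp_all add: right_module_def)

lemma tensorable_M: "tensorable UNIV M ac additive_group la"
  using comm_group_M ac_closed by (simp add: tensorable_def)

lemma comm_group_T: "comm_group T"
  by (rule comm_group_tensor[OF tensorable_M])

lemma rho_closed: "m \<in> carrier M \<Longrightarrow> \<rho> m \<in> carrier T"
  using hom_closedD[OF \<rho>_hom] .

lemma Delta_closed: "\<Delta> x \<in> carrier TC"
  using hom_closedD[OF \<Delta>_hom] by simp

lemmas ev_rho_closed = ev_closed[OF tensorable_M _ rho_closed]
lemmas ev_rho_cong = ev_cong[OF tensorable_M _ rho_closed]
lemmas hom_ev_rho = hom_ev[OF tensorable_M _ _ rho_closed]

lemma ev_rho_additive:
  assumes "m \<in> carrier M" "comm_group K"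
    and "\<And>m h. m \<in> carrier M \<Longrightarrow> F1 m h \<in> carrier K" "\<And>m h. m \<in> carrier M \<Longrightarrow> F2 m h \<in> carrier K"
    and "\<And>m h. m \<in> carrier M \<Longrightarrow> F m h = F1 m h \<otimes>\<^bsub>K\<^esub> F2 m h"
  shows "ev K F (\<rho> m) = ev K F1 (\<rho> m) \<otimes>\<^bsub>K\<^esub> ev K F2 (\<rho> m)"
proof -
  interpret K: comm_group K by fact
  have "ev K F (\<rho> m) = ev K (\<lambda>m h. F1 m h \<otimes>\<^bsub>K\<^esub> F2 m h) (\<rho> m)"
    by (rule ev_rho_cong) (use assms in simp_all)
  also have "\<dots> = ev K F1 (\<rho> m) \<otimes>\<^bsub>K\<^esub> ev K F2 (\<rho> m)"
    by (rule ev_mult_fun[OF tensorable_M assms(2) rho_closed]) (use assms in simp_all)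
  finally show ?thesis .
qed

lemma ev_rho_mult:
  assumes "balanced UNIV M ac additive_group la K F" "m \<in> carrier M" "m' \<in> carrier M"
  shows "ev K F (\<rho> (m \<otimes>\<^bsub>M\<^esub> m')) = ev K F (\<rho> m) \<otimes>\<^bsub>K\<^esub> ev K F (\<rho> m')"
  using hom_mult[OF \<rho>_hom assms(2,3)] hom_mult[OF ev_hom[OF assms(1)] rho_closed rho_closed] assms(2,3)
  by simp

lemma ev_rho_self: "m \<in> carrier M \<Longrightarrow> ev T (pure_tensor T) (\<rho> m) = \<rho> m"
  by (rule ev_self[OF tensorable_M rho_closed])

lemma ev_rho_coassoc:
  assumes "balanced3 M ac additive_group la ra additive_group la K F" "m \<in> carrier M"
  shows "ev K (\<lambda>q p. ev K (\<lambda>m n. F m n p) (\<rho> q)) (\<rho> m) = ev K (\<lambda>m q. ev K (\<lambda>n p. F m n p) (\<Delta> q)) (\<rho> m)"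
  by (rule split_eqD[OF \<rho>_coassoc[OF assms(2)] tensorable_M rho_closed[OF assms(2)] tensorable_M rho_closed
        tensorable_M rho_closed[OF assms(2)] tensorable_additive Delta_closed assms(1)])

end

context coring
begin

text \<open>
  This makes the rules for coactions available for coproducts.
\<close>

lemma regular_right_comodule: "right_comodule la ra \<Delta> \<epsilon> additive_group ra \<Delta>"
proof (unfold_locales)
  show "right_module UNIV additive_group ra"
    by (simp add: right_module_def ra_add ra_mult ra_one)
  have "la 1 = id" by (rule ext) (simp add: la_one)
  then show "\<Delta> (ra m r) = tensor_map2 (tensor UNIV additive_group ra additive_group la) id (\<lambda>x. ra x r) (\<Delta> m)" for m r
    using \<Delta>_bilinear[of 1 m r] by (simp add: la_one)
qed (simp_all add: \<Delta>_hom coassoc counit_right)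

lemma eps_la: "\<epsilon> (la r x) = r * \<epsilon> x" and eps_ra: "\<epsilon> (ra x r) = \<epsilon> x * r"
  using \<epsilon>_bilinear[of r x 1] \<epsilon>_bilinear[of 1 x r] by (simp_all add: la_one ra_one)

end

sublocale coring \<subseteq> reg: right_comodule la ra \<Delta> \<epsilon> additive_group ra \<Delta>
  by (rule regular_right_comodule)

context coring
begin

lemma ev_Delta_la:
  assumes "balanced UNIV additive_group ra additive_group la K F"
  shows "ev K F (\<Delta> (la r x)) = ev K (\<lambda>x' y. F (la r x') y) (\<Delta> x)"
proof -
  have "(\<lambda>y. ra y 1) = id" by (rule ext) (simp add: ra_one)
  then have "\<Delta> (la r x) = tensor_map2 (tensor UNIV additive_group ra additive_group la) (la r) id (\<Delta> x)"
    using \<Delta>_bilinear[of r x 1] by (simp add: ra_one)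
  then show ?thesis
    using tensor_map2_ev(3)[OF tensorable_additive reg.rho_closed tensorable_additive _ _ assms, of x "la r" id]
    by simp
qed

end

section \<open>Hopf algebroids\<close>

lemma algebra_mapD:
  assumes "algebra_map sb sc f"
  shows "f (x + y) = f x + f y" "f (x * y) = f x * f y" "f 1 = 1"
  using assms by (simp_all add: algebra_map_def)

lemma algebra_antimapD:
  assumes "algebra_antimap sb sc f"
  shows "f (x + y) = f x + f y" "f (x * y) = f y * f x" "f 1 = 1"
  using assms by (simp_all add: algebra_antimap_def)

lemma balanced_additiveI:
  assumes "comm_group K"
    and "\<And>m n. F m n \<in> carrier K"
    and "\<And>m m' n. F (m + m') n = F m n \<otimes>\<^bsub>K\<^esub> F m' n"
    and "\<And>m n n'. F m (n + n') = F m n \<otimes>\<^bsub>K\<^esub> F m n'"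
    and "\<And>m s n. s \<in> S \<Longrightarrow> F (ra m s) n = F m (la s n)"
  shows "balanced S additive_group ra additive_group la K F"
  by (rule balancedI) (use assms in simp_all)

lemma balanced_additiveD:
  assumes "balanced S additive_group ra additive_group la K F"
  shows "comm_group K" "F m n \<in> carrier K"
    "F (m + m') n = F m n \<otimes>\<^bsub>K\<^esub> F m' n" "F m (n + n') = F m n \<otimes>\<^bsub>K\<^esub> F m n'"
    "s \<in> S \<Longrightarrow> F (ra m s) n = F m (la s n)"
  using balancedD[OF assms] by simp_all

context right_bialgebroid
begin

abbreviation "rbalanced K F \<equiv> balanced UNIV additive_group (rb_ra X) additive_group (rb_la X) K F"

lemma ev_takeuchi:
  assumes "rbalanced K F"
  shows "ev K (\<lambda>x y. F (src X r * x) y) (cop X h) = ev K (\<lambda>x y. F x (tgt X r * y)) (cop X h)"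
proof -
  have "tensor_map2 (rb_square X) (\<lambda>h. src X r * h) id (cop X h) =
    tensor_map2 (rb_square X) id (\<lambda>h. tgt X r * h) (cop X h)"
    using cop_takeuchi[of h] by (simp add: rb_takeuchi_def)
  then show ?thesis
    using tensor_map2_ev(3)[OF tensorable_additive reg.rho_closed tensorable_additive _ _ assms, of h "\<lambda>h. src X r * h" id]
      tensor_map2_ev(3)[OF tensorable_additive reg.rho_closed tensorable_additive _ _ assms, of h id "\<lambda>h. tgt X r * h"]
    by (simp add: rb_tensor_def)
qed

lemma tgt_one: "tgt X 1 = 1" and src_one: "src X 1 = 1"
  using algebra_antimapD[OF tgt] algebra_mapD[OF src] by simp_all

text \<open>
  The coproduct of \<open>t(r) h\<close> is the product of \<open>t(r) \<otimes> 1\<close> and \<open>\<Delta>(h)\<close>. The factorwise product is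
  formed with the chosen representative of \<open>t(r) \<otimes> 1\<close>; replacing it by \<open>(t(r), 1)\<close> is legitimate because
  \<open>\<Delta>(h)\<close> satisfies the Takeuchi condition.
\<close>

lemma ev_cop_tgt_mult:
  assumes "rbalanced K F"
  shows "ev K F (cop X (tgt X r * h)) = ev K (\<lambda>x y. F (tgt X r * x) y) (cop X h)"
proof -
  let ?T = "tensor UNIV additive_group (rb_ra X) additive_group (rb_la X)"
  note K = balanced_additiveD(1)[OF assms]
  let ?G = "\<lambda>x y. ev K (\<lambda>a h'. F (x * a) (y * h')) (cop X h)"
  have c: "?G x y \<in> carrier K" for x y
    by (rule reg.ev_rho_closed[OF K]) (use balanced_additiveD[OF assms] in simp_all)
  have G: "rbalanced K ?G"
  proof (rule balanced_additiveI[OF K c])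
    fix x x' y
    show "?G (x + x') y = ?G x y \<otimes>\<^bsub>K\<^esub> ?G x' y"
      by (rule reg.ev_rho_additive[OF _ K]) (use balanced_additiveD[OF assms] in \<open>simp_all add: distrib_right\<close>)
    show "?G x (y + x') = ?G x y \<otimes>\<^bsub>K\<^esub> ?G x x'"
      by (rule reg.ev_rho_additive[OF _ K]) (use balanced_additiveD[OF assms] in \<open>simp_all add: distrib_right\<close>)
    show "?G (rb_ra X x s) y = ?G x (rb_la X s y)" for s
    proof -
      have "rbalanced K (\<lambda>a h'. F (x * a) (y * h'))"
        by (rule balanced_additiveI[OF K])
           (use balanced_additiveD[OF assms] in \<open>simp_all add: distrib_left rb_ra_def rb_la_def mult.assoc[symmetric]\<close>)
      from ev_takeuchi[OF this, of s h] show ?thesis by (simp add: rb_ra_def rb_la_def mult.assoc)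
    qed
  qed
  have p: "pure_tensor ?T (tgt X r) 1 \<in> carrier ?T" by (rule pure_tensor_closed) simp_all
  have "cop X (tgt X r * h) = tensor_mult ?T (*) (pure_tensor ?T (tgt X r) 1) (cop X h)"
    using cop_mult[of "tgt X r" h] cop_unit[of 1 r] by (simp add: src_one rb_tensor_def)
  then have "ev K F (cop X (tgt X r * h)) = ev K ?G (pure_tensor ?T (tgt X r) 1)"
    using tensor_mult_ev(3)[OF tensorable_additive p tensorable_additive reg.rho_closed tensorable_additive _ assms, of h "(*)"]
    by simp
  also have "\<dots> = ?G (tgt X r) 1" by (rule ev_pure[OF G]) simp_all
  finally show ?thesis by simp
qed

end

context left_bialgebroid
begin

abbreviation "lbalanced K F \<equiv> balanced UNIV additive_group (lb_ra X) additive_group (lb_la X) K F"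

lemma ev_takeuchi:
  assumes "lbalanced K F"
  shows "ev K (\<lambda>x y. F (x * tgt X l) y) (cop X h) = ev K (\<lambda>x y. F x (y * src X l)) (cop X h)"
proof -
  have "tensor_map2 (lb_square X) (\<lambda>h. h * tgt X l) id (cop X h) =
    tensor_map2 (lb_square X) id (\<lambda>h. h * src X l) (cop X h)"
    using cop_takeuchi[of h] by (simp add: lb_takeuchi_def)
  then show ?thesis
    using tensor_map2_ev(3)[OF tensorable_additive reg.rho_closed tensorable_additive _ _ assms, of h "\<lambda>h. h * tgt X l" id]
      tensor_map2_ev(3)[OF tensorable_additive reg.rho_closed tensorable_additive _ _ assms, of h id "\<lambda>h. h * src X l"]
    by (simp add: lb_tensor_def)
qed

lemma tgt_one: "tgt X 1 = 1" and src_one: "src X 1 = 1"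
  using algebra_antimapD[OF tgt] algebra_mapD[OF src] by simp_all

text \<open>
  The mirror image: now \<open>\<Delta>(h)\<close> is the left factor of the product, and its Takeuchi condition makes the
  product independent of the representative of the right factor.
\<close>

lemma ev_cop_mult_src:
  assumes "lbalanced K F"
  shows "ev K F (cop X (h * src X l)) = ev K (\<lambda>x y. F (x * src X l) y) (cop X h)"
proof -
  let ?T = "tensor UNIV additive_group (lb_ra X) additive_group (lb_la X)"
  note K = balanced_additiveD(1)[OF assms]
  let ?G = "\<lambda>x y. ev K (\<lambda>a h'. F (a * x) (h' * y)) (cop X h)"
  have c: "?G x y \<in> carrier K" for x y
    by (rule reg.ev_rho_closed[OF K]) (use balanced_additiveD[OF assms] in simp_all)
  have G: "lbalanced K ?G"
  proof (rule balanced_additiveI[OF K c])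
    fix x x' y
    show "?G (x + x') y = ?G x y \<otimes>\<^bsub>K\<^esub> ?G x' y"
      by (rule reg.ev_rho_additive[OF _ K]) (use balanced_additiveD[OF assms] in \<open>simp_all add: distrib_left\<close>)
    show "?G x (y + x') = ?G x y \<otimes>\<^bsub>K\<^esub> ?G x x'"
      by (rule reg.ev_rho_additive[OF _ K]) (use balanced_additiveD[OF assms] in \<open>simp_all add: distrib_left\<close>)
    show "?G (lb_ra X x s) y = ?G x (lb_la X s y)" for s
    proof -
      have "lbalanced K (\<lambda>a h'. F (a * x) (h' * y))"
        by (rule balanced_additiveI[OF K])
           (use balanced_additiveD[OF assms] in \<open>simp_all add: distrib_right lb_ra_def lb_la_def mult.assoc\<close>)
      from ev_takeuchi[OF this, of s h] show ?thesis by (simp add: lb_ra_def lb_la_def mult.assoc)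
    qed
  qed
  have p: "pure_tensor ?T (src X l) 1 \<in> carrier ?T" by (rule pure_tensor_closed) simp_all
  have "cop X (h * src X l) = tensor_mult ?T (*) (cop X h) (pure_tensor ?T (src X l) 1)"
    using cop_mult[of h "src X l"] cop_unit[of l 1] by (simp add: tgt_one lb_tensor_def)
  then have "ev K F (cop X (h * src X l)) =
      ev K (\<lambda>x y. ev K (\<lambda>a h'. F (x * a) (y * h')) (pure_tensor ?T (src X l) 1)) (cop X h)"
    using tensor_mult_ev(3)[OF tensorable_additive reg.rho_closed tensorable_additive p tensorable_additive _ assms, of h "(*)"]
    by simp
  also have "\<dots> = ev K ?G (pure_tensor ?T (src X l) 1)"
    by (rule ev_swap[OF tensorable_additive reg.rho_closed tensorable_additive p K])
       (use balanced_additiveD[OF assms] in simp_all)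
  also have "\<dots> = ?G (src X l) 1" by (rule ev_pure[OF G]) simp_all
  finally show ?thesis by simp
qed

end

context is_hopf_algebroid
begin

abbreviation "\<Delta>\<^sub>L \<equiv> cop (lb \<H>)"
abbreviation "\<Delta>\<^sub>R \<equiv> cop (rb \<H>)"
abbreviation "\<epsilon>\<^sub>L \<equiv> cou (lb \<H>)"
abbreviation "\<epsilon>\<^sub>R \<equiv> cou (rb \<H>)"
abbreviation "s\<^sub>L \<equiv> src (lb \<H>)"
abbreviation "s\<^sub>R \<equiv> src (rb \<H>)"
abbreviation "t\<^sub>L \<equiv> tgt (lb \<H>)"
abbreviation "t\<^sub>R \<equiv> tgt (rb \<H>)"
abbreviation "S \<equiv> antipode \<H>"
abbreviation "laR \<equiv> rb_la (rb \<H>)"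
abbreviation "raR \<equiv> rb_ra (rb \<H>)"
abbreviation "laL \<equiv> lb_la (lb \<H>)"
abbreviation "raL \<equiv> lb_ra (lb \<H>)"

lemma S_one: "S 1 = 1"
proof -
  let ?T = "tensor UNIV additive_group raR additive_group laR"
  have b: "balanced UNIV additive_group raR additive_group laR additive_group (\<lambda>h' h''. h' * S h'')"
  proof (rule balanced_additiveI)
    show "raR m s * S n = m * S (laR s n)" for m s n
      using S_twist[of 0 n s] S_twist[of 1 n s]
      by (simp add: rb_ra_def rb_la_def left.tgt_one left.src_one mult.assoc)
  qed (simp_all add: algebra_simps S_add)
  have "1 * S 1 = tensor_eval additive_group (\<lambda>(h', h''). h' * S h'') (\<Delta>\<^sub>R 1)"
    using ev_pure[OF b, of 1 1] by (simp add: right.cop_one rb_tensor_def)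
  also have "\<dots> = s\<^sub>L (\<epsilon>\<^sub>L 1)" by (rule S_right)
  also have "\<epsilon>\<^sub>L 1 = 1"
    using left.cou_one[of 1] by (simp add: left.src_one)
  finally show ?thesis by (simp add: left.src_one)
qed

text \<open>The coproducts are linear over the other base, since \<open>t\<^sub>R\<close> takes values in the image of \<open>s\<^sub>L\<close> and conversely.\<close>

lemma ev_DeltaL_laR:
  assumes "left.lbalanced K F"
  shows "ev K F (\<Delta>\<^sub>L (laR r h)) = ev K (\<lambda>x y. F (laR r x) y) (\<Delta>\<^sub>L h)"
  using left.ev_cop_mult_src[OF assms, of h "\<epsilon>\<^sub>L (t\<^sub>R r)"] by (simp add: base_maps rb_la_def)

lemma ev_DeltaR_laL:
  assumes "right.rbalanced K F"
  shows "ev K F (\<Delta>\<^sub>R (laL l h)) = ev K (\<lambda>x y. F (laL l x) y) (\<Delta>\<^sub>R h)"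
  using right.ev_cop_tgt_mult[OF assms, of "\<epsilon>\<^sub>R (s\<^sub>L l)" h] by (simp add: base_maps lb_la_def)

lemma S_tR: "S (h * t\<^sub>R r) = s\<^sub>R r * S h" and S_tL: "S (t\<^sub>L l * h) = S h * s\<^sub>L l"
  using S_twist[of 1 h r] S_twist[of l h 1]
  by (simp_all add: left.tgt_one left.src_one right.tgt_one right.src_one)

end

section \<open>Comodules, comodule algebras and relative Hopf modules\<close>

lemma (in right_comodule) balanced_counit: "balanced UNIV M ac additive_group la M (\<lambda>m x. ac m (\<epsilon> x))"
  by (rule balancedI[OF tensorable_M comm_group_M])
     (simp_all add: ac_closed ac_mult ac_add \<epsilon>_add eps_la ac_ac)

lemma (in right_comodule) hom_act: "(\<lambda>m. ac m r) \<in> hom M M"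
  by (rule homI) (simp_all add: ac_closed ac_mult)

context is_comodule
begin

abbreviation "coinvariant m \<equiv> m \<in> carrier M \<and> coactR M m = pure_tensor right.T m 1"

lemma ev_coactR_actL:
  assumes "balanced UNIV M (actR M) additive_group (rb_la (rb \<H>)) K F" "m \<in> carrier M"
  shows "ev K F (coactR M (actL M m l)) = ev K (\<lambda>m' h. F m' (lb_ra (lb \<H>) h l)) (coactR M m)"
  unfolding coactR_L_linear[OF assms(2)]
  using tensor_map2_ev(3)[OF right.tensorable_M right.rho_closed[OF assms(2)] right.tensorable_M _ _ assms(1), of id "\<lambda>h. lb_ra (lb \<H>) h l"]
  by (simp add: rb_tensor_def)

lemma ev_coactL_actR:
  assumes "balanced UNIV M (actL M) additive_group (lb_la (lb \<H>)) K F" "m \<in> carrier M"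
  shows "ev K F (coactL M (actR M m r)) = ev K (\<lambda>m' h. F m' (rb_ra (rb \<H>) h r)) (coactL M m)"
  unfolding coactL_R_linear[OF assms(2)]
  using tensor_map2_ev(3)[OF left.tensorable_M left.rho_closed[OF assms(2)] left.tensorable_M _ _ assms(1), of id "\<lambda>h. rb_ra (rb \<H>) h r"]
  by (simp add: lb_tensor_def)

lemma ev_mixed_RL:
  assumes "balanced3 M (actR M) additive_group (rb_la (rb \<H>)) (lb_ra (lb \<H>)) additive_group (lb_la (lb \<H>)) K F"
    and "m \<in> carrier M"
  shows "ev K (\<lambda>q p. ev K (\<lambda>m n. F m n p) (coactR M q)) (coactL M m) =
    ev K (\<lambda>m q. ev K (\<lambda>n p. F m n p) (cop (lb \<H>) q)) (coactR M m)"
  by (rule split_eqD[OF mixed_coassoc_RL[OF assms(2), unfolded tensor_RL_def, symmetric] left.tensorable_M left.rho_closed[OF assms(2)]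
        right.tensorable_M right.rho_closed right.tensorable_M right.rho_closed[OF assms(2)] tensorable_additive left.Delta_closed assms(1)])

lemma ev_mixed_LR:
  assumes "balanced3 M (actL M) additive_group (lb_la (lb \<H>)) (rb_ra (rb \<H>)) additive_group (rb_la (rb \<H>)) K F"
    and "m \<in> carrier M"
  shows "ev K (\<lambda>q p. ev K (\<lambda>m n. F m n p) (coactL M q)) (coactR M m) =
    ev K (\<lambda>m q. ev K (\<lambda>n p. F m n p) (cop (rb \<H>) q)) (coactL M m)"
  by (rule split_eqD[OF mixed_coassoc_LR[OF assms(2), unfolded tensor_LR_def, symmetric] right.tensorable_M right.rho_closed[OF assms(2)]
        left.tensorable_M left.rho_closed left.tensorable_M left.rho_closed[OF assms(2)] tensorable_additive right.Delta_closed assms(1)])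

end

locale hopf_comodule = is_hopf_algebroid \<H> + M: is_comodule \<H> M
  for \<H> :: "('k::{comm_ring,comm_monoid_mult}, 'l::{ring,monoid_mult}, 'r::{ring,monoid_mult},
             'h::{ring,monoid_mult}) hopf_algebroid"
    and M :: "('m, 'l, 'r, 'h, 'x) comod_scheme"
begin

text \<open>
  A coinvariant \<open>n\<close> of the \<open>R\<close>-coaction satisfies
  \<open>n\<^sub>0 \<otimes>\<^sub>L n\<^sub>1\<^sup>(\<^sup>1\<^sup>) \<otimes>\<^sub>R n\<^sub>1\<^sup>(\<^sup>2\<^sup>) = n\<^sub>0 \<otimes>\<^sub>L n\<^sub>1 \<otimes>\<^sub>R 1\<close> by mixed coassociativity. Applying
  \<open>m \<otimes> h \<otimes> h' \<mapsto> m \<otimes> h S(h')\<close> turns the left side into \<open>n\<^sub>0 \<otimes> s\<^sub>L(\<epsilon>\<^sub>L(n\<^sub>1)) = n \<otimes> 1\<close> and the right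
  side into the \<open>L\<close>-coaction of \<open>n\<close>. This is where the antipode enters.
\<close>

lemma coinvariant_coactL:
  assumes "M.coinvariant n"
  shows "coactL M n = pure_tensor M.left.T n 1"
proof -
  let ?T = "M.left.T"
  let ?F = "\<lambda>m x y. pure_tensor ?T m (x * S y)"
  have n: "n \<in> carrier M" using assms by simp
  note K = M.left.comm_group_T
  note pD = balancedD[OF balanced_pure_tensor[OF M.left.tensorable_M], simplified]
  have b: "balanced3 M (actL M) additive_group laL raR additive_group laR ?T ?F"
  proof (rule balanced3I[OF M.left.tensorable_M tensorable_additive K])
    show "pure_tensor ?T (actL M m s) (n * S p) = pure_tensor ?T m (laL s n * S p)" if "m \<in> carrier M" for m s n p
      using pD(6)[OF that, of s "n * S p"] by (simp add: lb_la_def mult.assoc)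
    show "pure_tensor ?T m (raR n t * S p) = pure_tensor ?T m (n * S (laR t p))" for m n t p
      by (simp add: rb_ra_def rb_la_def S_tR mult.assoc)
  qed (simp_all add: pD S_add distrib_left distrib_right)
  have K': "?F m x y \<in> carrier ?T" if "m \<in> carrier M" for m x y by (simp add: pD that)
  \<comment> \<open>This map is to be evaluated at the representative \<open>(n, 1)\<close> of \<open>n\<^sup>0 \<otimes> n\<^sup>1\<close>.\<close>
  have bal: "balanced UNIV M (actR M) additive_group laR ?T (\<lambda>m' y. ev ?T (\<lambda>m x. ?F m x y) (coactL M m'))"
  proof (rule balancedI[OF M.right.tensorable_M K])
    fix m m' y y' r assume m: "m \<in> carrier M" "m' \<in> carrier M"
    show "ev ?T (\<lambda>m x. ?F m x y) (coactL M m) \<in> carrier ?T"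
      by (rule M.left.ev_rho_closed[OF K]) (use m K' in simp_all)
    have b1: "balanced UNIV M (actL M) additive_group laL ?T (\<lambda>m x. ?F m x y)" for y
    proof (rule balancedI[OF M.left.tensorable_M K])
      show "pure_tensor ?T (actL M m s) (n * S y) = pure_tensor ?T m (laL s n * S y)" if "m \<in> carrier M" for m s n
        using pD(6)[OF that, of s "n * S y"] by (simp add: lb_la_def mult.assoc)
    qed (simp_all add: pD distrib_right)
    show "ev ?T (\<lambda>m x. ?F m x y) (coactL M (m \<otimes>\<^bsub>M\<^esub> m')) =
      ev ?T (\<lambda>m x. ?F m x y) (coactL M m) \<otimes>\<^bsub>?T\<^esub> ev ?T (\<lambda>m x. ?F m x y) (coactL M m')"
      by (rule M.left.ev_rho_mult[OF b1 m])
    show "ev ?T (\<lambda>m x. ?F m x (y \<otimes>\<^bsub>additive_group\<^esub> y')) (coactL M m) =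
      ev ?T (\<lambda>m x. ?F m x y) (coactL M m) \<otimes>\<^bsub>?T\<^esub> ev ?T (\<lambda>m x. ?F m x y') (coactL M m)"
      by (rule M.left.ev_rho_additive[OF m(1) K]) (simp_all add: pD S_add distrib_left)
    show "ev ?T (\<lambda>m x. ?F m x y) (coactL M (actR M m r)) = ev ?T (\<lambda>m x. ?F m x (laR r y)) (coactL M m)"
      using M.ev_coactL_actR[OF b1 m(1), of y r] by (simp add: rb_la_def rb_ra_def S_tR mult.assoc)
  qed
  have "coactL M n = ev ?T (\<lambda>m x. ?F m x 1) (coactL M n)"
    using M.left.ev_rho_self[OF n] by (simp add: S_one)
  also have "\<dots> = ev ?T (\<lambda>m' y. ev ?T (\<lambda>m x. ?F m x y) (coactL M m')) (coactR M n)"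
    using ev_pure[OF bal n, of 1] assms by simp
  also have "\<dots> = ev ?T (\<lambda>m h. ev ?T (\<lambda>x y. ?F m x y) (\<Delta>\<^sub>R h)) (coactL M n)"
    by (rule M.ev_mixed_LR[OF b n])
  also have "\<dots> = ev ?T (\<lambda>m h. pure_tensor ?T (actL M m (\<epsilon>\<^sub>L h)) 1) (coactL M n)"
  proof (rule M.left.ev_rho_cong[OF K n])
    fix m h assume m: "m \<in> carrier M"
    show "ev ?T (\<lambda>x y. ?F m x y) (\<Delta>\<^sub>R h) \<in> carrier ?T"
      by (rule right.reg.ev_rho_closed[OF K]) (use m K' in simp_all)
    have h: "pure_tensor ?T m \<in> hom additive_group ?T" by (rule homI) (use m in \<open>simp_all add: pD\<close>)
    have "ev ?T (\<lambda>x y. ?F m x y) (\<Delta>\<^sub>R h) = pure_tensor ?T m (s\<^sub>L (\<epsilon>\<^sub>L h))"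
      using right.reg.hom_ev_rho[OF comm_group_additive K _ h, of h "\<lambda>x y. x * S y"] S_right[of h] by simp
    then show "ev ?T (\<lambda>x y. ?F m x y) (\<Delta>\<^sub>R h) = pure_tensor ?T (actL M m (\<epsilon>\<^sub>L h)) 1"
      using pD(6)[OF m, of "\<epsilon>\<^sub>L h" 1] by (simp add: lb_la_def)
  qed
  also have "\<dots> = pure_tensor ?T (ev M (\<lambda>m h. actL M m (\<epsilon>\<^sub>L h)) (coactL M n)) 1"
    by (rule M.left.hom_ev_rho[OF M.left.comm_group_M K n, symmetric])
       (simp_all add: homI pD M.left.ac_closed)
  also have "ev M (\<lambda>m h. actL M m (\<epsilon>\<^sub>L h)) (coactL M n) = n"
    by (rule M.left.\<rho>_counit[OF n])
  finally show ?thesis .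
qed

end

lemma alg_comod_simps [simp]:
  "carrier (alg_comod A) = UNIV" "x \<otimes>\<^bsub>alg_comod A\<^esub> y = x + y" "\<one>\<^bsub>alg_comod A\<^esub> = 0"
  "actR (alg_comod A) = (\<lambda>a r. a * etaR A r)" "actL (alg_comod A) = actLA A"
  "coactR (alg_comod A) = rhoR A" "coactL (alg_comod A) = rhoL A"
  by (simp_all add: alg_comod_def)

context is_comod_algebra
begin

lemma etaR_simps: "etaR A (x + y) = etaR A x + etaR A y" "etaR A (x * y) = etaR A x * etaR A y" "etaR A 1 = 1"
  using algebra_mapD[OF etaR] by simp_all

lemma comm_group_alg: "comm_group (alg_comod A)" by (rule right.comm_group_M)

lemma ev_alg:
  assumes "tensorable Z N ra P la" "X \<in> carrier (tensor Z N ra P la)"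
  shows "ev (alg_comod A) F X = ev additive_group F X"
  using hom_ev[OF assms(1) comm_group_alg comm_group_additive assms(2), of id F]
  by (simp add: hom_def)

text \<open>
  By the counit, \<open>a l = (a l)\<^sup>0 \<epsilon>\<^sub>R((a l)\<^sup>1) = a\<^sup>0 \<epsilon>\<^sub>R(t\<^sub>L(l) a\<^sup>1)\<close>, and \<open>t\<^sub>L(l)\<close> lies in the image of
  \<open>s\<^sub>R\<close>; so the right \<open>L\<close>-action is the left \<open>R\<close>-action of \<open>\<epsilon>\<^sub>R(t\<^sub>L(l))\<close>.
\<close>

lemma actLA_eq: "actLA A a l = etaR A (\<epsilon>\<^sub>R (t\<^sub>L l)) * a"
proof -
  have "actLA A a l = ev (alg_comod A) (\<lambda>m' x. m' * etaR A (\<epsilon>\<^sub>R x)) (rhoR A (actLA A a l))"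
    using right.\<rho>_counit[of "actLA A a l"] by simp
  also have "\<dots> = ev (alg_comod A) (\<lambda>m' x. m' * etaR A (\<epsilon>\<^sub>R (t\<^sub>L l * x))) (rhoR A a)"
    using ev_coactR_actL[OF right.balanced_counit, of a l] by (simp add: lb_ra_def)
  also have "\<dots> = ev additive_group (\<lambda>m' x. m' * etaR A (\<epsilon>\<^sub>R (t\<^sub>L l * x))) (rhoR A a)"
    by (rule ev_alg[OF right.tensorable_M]) (use right.rho_closed in simp)
  also have "\<dots> = etaR A (\<epsilon>\<^sub>R (t\<^sub>L l)) * a"
    unfolding left_action by (simp add: base_maps)
  finally show ?thesis .
qed

text \<open>
  The left \<open>R\<close>-action on \<open>A\<close> is itself defined by the coaction, so coassociativity moves the Takeuchi
  condition of the coaction into the second tensor factor, where it is that of \<open>\<Delta>\<^sub>R\<close> followed by the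
  counit.
\<close>

lemma ev_rhoR_takeuchi:
  assumes F: "balanced UNIV (alg_comod A) (\<lambda>a r. a * etaR A r) additive_group laR K F"
  shows "ev K (\<lambda>a' h. F (etaR A r * a') h) (rhoR A a) = ev K (\<lambda>a' h. F a' (t\<^sub>R r * h)) (rhoR A a)"
proof -
  note K = balancedD(2)[OF F]
  note FD = balancedD[OF F, simplified]
  note eR = right.reg.hom_ev_rho
  let ?e = "\<lambda>a k. a * etaR A (\<epsilon>\<^sub>R (s\<^sub>R r * k))"
  have eps_la: "\<epsilon>\<^sub>R (s\<^sub>R r * laR s x) = s * \<epsilon>\<^sub>R (s\<^sub>R r * x)" for s x
    using right.eps_la[of s "s\<^sub>R r * x"] by (simp add: rb_la_def mult.assoc)
  have eps_ra: "\<epsilon>\<^sub>R (s\<^sub>R r * raR x s) = \<epsilon>\<^sub>R (s\<^sub>R r * x) * s" for s x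
    using right.eps_ra[of "s\<^sub>R r * x" s] by (simp add: rb_ra_def mult.assoc)
  have tR_mult: "t\<^sub>R (x * y) = t\<^sub>R y * t\<^sub>R x" and tR_add: "t\<^sub>R (x + y) = t\<^sub>R x + t\<^sub>R y" for x y
    using algebra_antimapD[OF right.tgt] by simp_all
  have 1: "F (etaR A r * a') h = ev K (\<lambda>a'' k. F (?e a'' k) h) (rhoR A a')" for a' h
    unfolding left_action
    by (rule right.hom_ev_rho[OF comm_group_additive K, simplified]) (simp add: hom_def FD)
  have b3: "balanced3 (alg_comod A) (\<lambda>a r. a * etaR A r) additive_group laR raR additive_group laR K
      (\<lambda>a x y. F (?e a x) y)"
    by (rule balanced3I[OF FD(1) tensorable_additive K])
       (simp_all add: FD right.\<epsilon>_add eps_la eps_ra etaR_simps distrib_left distrib_right mult.assoc flip: FD(6))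
  have 2: "ev K (\<lambda>x y. F (?e a x) y) (\<Delta>\<^sub>R k) = F a (t\<^sub>R r * k)" for a k
  proof -
    have b2: "right.rbalanced K (\<lambda>x y. F a (y * t\<^sub>R (\<epsilon>\<^sub>R x)))"
      by (rule balanced_additiveI[OF K])
         (simp_all add: FD right.\<epsilon>_add distrib_left distrib_right mult.assoc right.eps_ra tR_add, simp add: rb_la_def tR_mult mult.assoc)
    have "ev K (\<lambda>x y. F (?e a x) y) (\<Delta>\<^sub>R k) = ev K (\<lambda>x y. F a (y * t\<^sub>R (\<epsilon>\<^sub>R (s\<^sub>R r * x)))) (\<Delta>\<^sub>R k)"
      by (simp add: FD(6) rb_la_def)
    also have "\<dots> = ev K (\<lambda>x y. F a (t\<^sub>R r * y * t\<^sub>R (\<epsilon>\<^sub>R x))) (\<Delta>\<^sub>R k)"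
      by (rule right.ev_takeuchi[OF b2])
    also have "\<dots> = F a (t\<^sub>R r * ev additive_group (\<lambda>x y. laR (\<epsilon>\<^sub>R x) y) (\<Delta>\<^sub>R k))"
      using eR[OF comm_group_additive K, of k "\<lambda>z. F a (t\<^sub>R r * z)" "\<lambda>x y. laR (\<epsilon>\<^sub>R x) y"]
      by (simp add: rb_la_def mult.assoc hom_def FD distrib_left)
    finally show ?thesis by (simp add: right.counit_left)
  qed
  have "ev K (\<lambda>a' h. F (etaR A r * a') h) (rhoR A a) = ev K (\<lambda>a' h. ev K (\<lambda>a'' k. F (?e a'' k) h) (rhoR A a')) (rhoR A a)"
    by (simp add: 1)
  also have "\<dots> = ev K (\<lambda>a'' k. ev K (\<lambda>x y. F (?e a'' x) y) (\<Delta>\<^sub>R k)) (rhoR A a)"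
    using right.ev_rho_coassoc[of K "\<lambda>a x y. F (?e a x) y" a] b3 by simp
  finally show ?thesis by (simp add: 2)
qed

end

text \<open>
  The action of \<open>A\<close> is a separate parameter instead of a record field, so that \<open>A\<close> acting on itself
  by multiplication is an instance. The compatibility of the action with the coactions is left to a
  second locale: for \<open>W \<otimes>\<^sub>B A\<close> its proof uses the diagonal action on \<open>M \<otimes> H\<close> that is constructed here.
\<close>

locale comodule_with_action = is_comod_algebra \<H> A + M: is_comodule \<H> M
  for \<H> :: "('k::{comm_ring,comm_monoid_mult}, 'l::{ring,monoid_mult}, 'r::{ring,monoid_mult},
             'h::{ring,monoid_mult}) hopf_algebroid"
    and A :: "('k, 'l, 'r, 'h, 'a::{ring,monoid_mult}) comod_algebra"
    and M :: "('m, 'l, 'r, 'h, 'x) comod_scheme" +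
  fixes da :: "'m \<Rightarrow> 'a \<Rightarrow> 'm" (infixl \<open>\<cdot>\<close> 72)
  assumes da: "right_module UNIV M (\<cdot>)"
    and da_balanced: "m \<in> carrier M \<Longrightarrow> actR M m r \<cdot> a = m \<cdot> (etaR A r * a)"
    and da_R_linear: "m \<in> carrier M \<Longrightarrow> actR M (m \<cdot> a) r = m \<cdot> (a * etaR A r)"
    and da_L_linear: "m \<in> carrier M \<Longrightarrow> actL M (m \<cdot> a) l = actL M m l \<cdot> a"
begin

lemma da_simps:
  "m \<in> carrier M \<Longrightarrow> m \<cdot> a \<in> carrier M"
  "m \<in> carrier M \<Longrightarrow> m' \<in> carrier M \<Longrightarrow> (m \<otimes>\<^bsub>M\<^esub> m') \<cdot> a = (m \<cdot> a) \<otimes>\<^bsub>M\<^esub> (m' \<cdot> a)"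
  "m \<in> carrier M \<Longrightarrow> m \<cdot> (a + a') = (m \<cdot> a) \<otimes>\<^bsub>M\<^esub> (m \<cdot> a')"
  "m \<in> carrier M \<Longrightarrow> m \<cdot> (a * a') = m \<cdot> a \<cdot> a'"
  "m \<in> carrier M \<Longrightarrow> m \<cdot> 1 = m"
  using da by (simp_all add: right_module_def)

lemma da_etaR: "m \<in> carrier M \<Longrightarrow> m \<cdot> etaR A r = actR M m r"
  using da_R_linear[of m 1 r] by (simp add: da_simps)

lemma da_hom: "(\<lambda>m. m \<cdot> a) \<in> hom M M"
  by (rule homI) (simp_all add: da_simps)

abbreviation "Rbalanced K F \<equiv> balanced UNIV M (actR M) additive_group laR K F"
abbreviation "Lbalanced K F \<equiv> balanced UNIV M (actL M) additive_group laL K F"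

text \<open>
  The diagonal action \<open>(m \<otimes> h) a = m a\<^sub>0 \<otimes> h a\<^sub>1\<close> is defined on \<open>M \<otimes> H\<close>. The two coactions of \<open>A\<close> differ only in
  the reason for the balancing condition: over \<open>R\<close> it is the Takeuchi condition of the coaction, over
  \<open>L\<close> it holds because \<open>(m a) l = (m l) a\<close>.
\<close>

lemma balanced_da:
  fixes la :: "'b::{ring,monoid_mult} \<Rightarrow> 'h \<Rightarrow> 'h"
  assumes comod: "right_comodule la ra D e (alg_comod A) ac \<rho>"
    and tM: "tensorable UNIV M acM additive_group la" and F: "balanced UNIV M acM additive_group la K F"
    and slide: "\<And>m h r. m \<in> carrier M \<Longrightarrow>
      ev K (\<lambda>a' k. F (acM m r \<cdot> a') (h * k)) (\<rho> a) = ev K (\<lambda>a' k. F (m \<cdot> a') (la r h * k)) (\<rho> a)"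
  shows "balanced UNIV M acM additive_group la K (\<lambda>m h. ev K (\<lambda>a' k. F (m \<cdot> a') (h * k)) (\<rho> a))"
proof (rule balancedI[OF tM])
  interpret A: right_comodule la ra D e "alg_comod A" ac \<rho> by (rule comod)
  note FD = balancedD[OF F, simplified] and closed = A.ev_rho_closed[of _ a, simplified] and additive = A.ev_rho_additive[of a, simplified]
  show K: "comm_group K" by (rule FD)
  fix m m' h h' r assume m: "m \<in> carrier M" "m' \<in> carrier M"
  show "ev K (\<lambda>a' k. F (m \<cdot> a') (h * k)) (\<rho> a) \<in> carrier K"
    by (rule closed[OF K]) (use m in \<open>simp add: FD da_simps\<close>)
  show "ev K (\<lambda>a' k. F ((m \<otimes>\<^bsub>M\<^esub> m') \<cdot> a') (h * k)) (\<rho> a) =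
    ev K (\<lambda>a' k. F (m \<cdot> a') (h * k)) (\<rho> a) \<otimes>\<^bsub>K\<^esub> ev K (\<lambda>a' k. F (m' \<cdot> a') (h * k)) (\<rho> a)"
    by (rule additive[OF K]) (use m in \<open>simp_all add: FD da_simps\<close>)
  show "ev K (\<lambda>a' k. F (m \<cdot> a') ((h \<otimes>\<^bsub>additive_group\<^esub> h') * k)) (\<rho> a) =
    ev K (\<lambda>a' k. F (m \<cdot> a') (h * k)) (\<rho> a) \<otimes>\<^bsub>K\<^esub> ev K (\<lambda>a' k. F (m \<cdot> a') (h' * k)) (\<rho> a)"
    by (rule additive[OF K]) (use m in \<open>simp_all add: FD da_simps distrib_right\<close>)
qed (rule slide)

lemma Rbalanced_da:
  assumes F: "Rbalanced K F"
  shows "Rbalanced K (\<lambda>m h. ev K (\<lambda>a' k. F (m \<cdot> a') (h * k)) (rhoR A a))"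
proof (rule balanced_da[OF right.right_comodule_axioms[simplified] M.right.tensorable_M F])
  note FD = balancedD[OF F, simplified]
  fix m h r assume m: "m \<in> carrier M"
  have b: "balanced UNIV (alg_comod A) (\<lambda>a r. a * etaR A r) additive_group laR K (\<lambda>a' k. F (m \<cdot> a') (h * k))"
  proof (rule balancedI[OF _ FD(2)])
    show "tensorable UNIV (alg_comod A) (\<lambda>a r. a * etaR A r) additive_group laR"
      using right.tensorable_M by simp
    show "F (m \<cdot> (a' * etaR A s)) (h * n) = F (m \<cdot> a') (h * laR s n)" for a' s n
      using FD(6)[of "m \<cdot> a'" s "h * n"] m by (simp add: da_etaR da_simps rb_la_def mult.assoc)
  qed (use m in \<open>simp_all add: FD da_simps distrib_left\<close>)
  show "ev K (\<lambda>a' k. F (actR M m r \<cdot> a') (h * k)) (rhoR A a) = ev K (\<lambda>a' k. F (m \<cdot> a') (laR r h * k)) (rhoR A a)"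
    using ev_rhoR_takeuchi[OF b, of r a] m by (simp add: da_balanced rb_la_def mult.assoc)
qed

lemma Lbalanced_da:
  assumes F: "Lbalanced K F"
  shows "Lbalanced K (\<lambda>m h. ev K (\<lambda>a' k. F (m \<cdot> a') (h * k)) (rhoL A a))"
proof (rule balanced_da[OF left.right_comodule_axioms[simplified] M.left.tensorable_M F])
  fix m h l assume m: "m \<in> carrier M"
  show "ev K (\<lambda>a' k. F (actL M m l \<cdot> a') (h * k)) (rhoL A a) = ev K (\<lambda>a' k. F (m \<cdot> a') (laL l h * k)) (rhoL A a)"
    using m by (simp add: da_L_linear[symmetric] balancedD[OF F, simplified] da_simps lb_la_def mult.assoc)
qed

end

locale relative_hopf_module = comodule_with_action \<H> A M da
  for \<H> :: "('k::{comm_ring,comm_monoid_mult}, 'l::{ring,monoid_mult}, 'r::{ring,monoid_mult},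
             'h::{ring,monoid_mult}) hopf_algebroid"
    and A :: "('k, 'l, 'r, 'h, 'a::{ring,monoid_mult}) comod_algebra"
    and M :: "('m, 'l, 'r, 'h, 'x) comod_scheme" and da (infixl \<open>\<cdot>\<close> 72) +
  assumes da_coactR: "m \<in> carrier M \<Longrightarrow> coactR M (m \<cdot> a) =
          tensor_mult (rb_tensor (rb \<H>) M (actR M)) (\<cdot>) (coactR M m) (rhoR A a)"
    and da_coactL: "m \<in> carrier M \<Longrightarrow> coactL M (m \<cdot> a) =
          tensor_mult (lb_tensor (lb \<H>) M (actL M)) (\<cdot>) (coactL M m) (rhoL A a)"
begin

lemma ev_coactR_da:
  assumes F: "Rbalanced K F" and "m \<in> carrier M"
  shows "ev K F (coactR M (m \<cdot> a)) = ev K (\<lambda>m' h. ev K (\<lambda>a' h'. F (m' \<cdot> a') (h * h')) (rhoR A a)) (coactR M m)"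
  unfolding da_coactR[OF assms(2)] rb_tensor_def
  by (rule tensor_mult_ev(3)[OF M.right.tensorable_M M.right.rho_closed[OF assms(2)] right.tensorable_M _ M.right.tensorable_M _ F])
     (use right.rho_closed da_simps in simp_all)

lemma ev_coactL_da:
  assumes F: "Lbalanced K F" and "m \<in> carrier M"
  shows "ev K F (coactL M (m \<cdot> a)) = ev K (\<lambda>m' h. ev K (\<lambda>a' h'. F (m' \<cdot> a') (h * h')) (rhoL A a)) (coactL M m)"
  unfolding da_coactL[OF assms(2)] lb_tensor_def
  by (rule tensor_mult_ev(3)[OF M.left.tensorable_M M.left.rho_closed[OF assms(2)] left.tensorable_M _ M.left.tensorable_M _ F])
     (use left.rho_closed da_simps in simp_all)

lemma ev_coactR_coinvariant_da:
  assumes F: "Rbalanced K F" and n: "M.coinvariant n"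
  shows "ev K F (coactR M (n \<cdot> a)) = ev K (\<lambda>a' h. F (n \<cdot> a') h) (rhoR A a)"
  using ev_coactR_da[OF F, of n a] n ev_pure[OF Rbalanced_da[OF F], of n 1 a] by simp

lemma ev_coactL_coinvariant_da:
  assumes F: "Lbalanced K F" and n: "M.coinvariant n"
  shows "ev K F (coactL M (n \<cdot> a)) = ev K (\<lambda>a' h. F (n \<cdot> a') h) (rhoL A a)"
proof -
  interpret hopf_comodule \<H> M by unfold_locales
  show ?thesis
    using ev_coactL_da[OF F, of n a] n ev_pure[OF Lbalanced_da[OF F], of n 1 a] coinvariant_coactL[OF n] by simp
qed

end

lemma (in is_comod_algebra) regular_relative_hopf_module: "relative_hopf_module \<H> A (alg_comod A) (*)"
proof unfold_locales
  show "right_module UNIV (alg_comod A) (*)"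
    using comm_group_alg by (simp add: right_module_def algebra_simps)
qed (simp_all add: mult.assoc actLA_eq rhoR_mult[simplified] rhoL_mult[simplified])

lemma (in is_hopf_module) relative_hopf_module: "relative_hopf_module \<H> A M (actA M)"
  by unfold_locales
     (simp_all add: actA actA_balanced actA_R_linear actA_L_linear actA_coactR actA_coactL)

section \<open>Cleft extensions\<close>

locale cleft_comod_algebra = is_comod_algebra \<H> A
  for \<H> :: "('k::{comm_ring,comm_monoid_mult}, 'l::{ring,monoid_mult}, 'r::{ring,monoid_mult},
             'h::{ring,monoid_mult}) hopf_algebroid"
    and A :: "('k, 'l, 'r, 'h, 'a::{ring,monoid_mult}) comod_algebra" +
  fixes B :: "'a set" and etaL :: "'l \<Rightarrow> 'a" and j j' :: "'h \<Rightarrow> 'a"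
  assumes B: "B = coinvariants \<H> A"
    and etaL: "algebra_map (scL \<H>) (scA A) etaL"
    and subring: "unital_subring B" and etaL_B: "range etaL \<subseteq> B"
    and j: "j \<in> comod_hom \<H> (regular_comod \<H>) (alg_comod A)"
    and j': "j' \<in> hom additive_group additive_group"
    and j_sL: "j (s\<^sub>L l * h) = etaL l * j h"
    and j'_lin: "j' (t\<^sub>L l * h * t\<^sub>R r) = etaR A r * j' h * etaL l"
    and j_j': "ev additive_group (\<lambda>x y. j x * j' y) (\<Delta>\<^sub>R h) = etaL (\<epsilon>\<^sub>L h)"
    and j'_j: "ev additive_group (\<lambda>x y. j' x * j y) (\<Delta>\<^sub>L h) = etaR A (\<epsilon>\<^sub>R h)"
begin

lemma j_add: "j (x + y) = j x + j y" and j_sR: "j (raR h r) = j h * etaR A r"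
  and coact_j: "rhoR A (j h) = tensor_map2 right.T j id (\<Delta>\<^sub>R h)"
  using j by (auto simp: comod_hom_def regular_comod_def hom_def rb_tensor_def)

lemma j'_add: "j' (x + y) = j' x + j' y"
  using j' by (simp add: hom_def)

lemma j'_tL: "j' (t\<^sub>L l * h) = j' h * etaL l" and j'_tR: "j' (h * t\<^sub>R r) = etaR A r * j' h"
  using j'_lin[of l h 1] j'_lin[of 1 h r] algebra_mapD(3)[OF etaL]
  by (simp_all add: left.tgt_one right.tgt_one etaR_simps)

lemma B_iff: "b \<in> B \<longleftrightarrow> rhoR A b = pure_tensor right.T b 1"
  by (simp add: B coinvariants_def rb_tensor_def)

lemma B_closed: "1 \<in> B" "x \<in> B \<Longrightarrow> y \<in> B \<Longrightarrow> x * y \<in> B" "etaL l \<in> B"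
  using subring etaL_B by (auto simp: unital_subring_def)

lemma ev_rhoR_j:
  assumes F: "balanced UNIV (alg_comod A) (\<lambda>a r. a * etaR A r) additive_group laR K F"
  shows "ev K F (rhoR A (j h)) = ev K (\<lambda>x y. F (j x) y) (\<Delta>\<^sub>R h)"
  unfolding coact_j
  using F by (subst tensor_map2_ev(3)[OF tensorable_additive right.reg.rho_closed right.tensorable_M]) simp_all

lemma eps_one: "\<epsilon>\<^sub>R 1 = 1" "\<epsilon>\<^sub>L 1 = 1"
  using right.cou_one[of 1] left.cou_one[of 1] by (simp_all add: left.src_one right.src_one)

text \<open>
  \<open>1\<close> is grouplike, so the convolution inverse of \<open>j\<close> gives an inverse of \<open>j(1)\<close>. Multiplication by \<open>j(1) \<in> B\<close>
  corrects \<open>m \<mapsto> m\<^sup>0 j'(m\<^sup>1)\<close> to a projection onto the coinvariants.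
\<close>

lemma j'_one_j_one: "j' 1 * j 1 = 1"
proof -
  have b: "left.lbalanced additive_group (\<lambda>x y. j' x * j y)"
    by (rule balanced_additiveI)
       (simp_all add: j_add j'_add algebra_simps lb_ra_def lb_la_def j_sL j'_tL)
  show ?thesis
    using j'_j[of 1] ev_pure[OF b, of 1 1] by (simp add: left.cop_one lb_tensor_def eps_one etaR_simps)
qed

lemma j_one_B: "j 1 \<in> B"
proof -
  note pD = balancedD[OF balanced_pure_tensor[OF right.tensorable_M], simplified]
  have b: "right.rbalanced right.T (\<lambda>x y. pure_tensor right.T (j x) y)"
    by (rule balanced_additiveI) (use pD in \<open>simp_all add: j_add j_sR\<close>)
  have "rhoR A (j 1) = ev right.T (pure_tensor right.T) (rhoR A (j 1))"
    using right.ev_rho_self[of "j 1"] by simp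
  also have "\<dots> = ev right.T (\<lambda>x y. pure_tensor right.T (j x) y) (\<Delta>\<^sub>R 1)"
    using ev_rhoR_j balanced_pure_tensor[OF right.tensorable_M] by simp
  also have "\<dots> = pure_tensor right.T (j 1) 1"
    using ev_pure[OF b, of 1 1] by (simp add: right.cop_one rb_tensor_def)
  finally show ?thesis by (simp add: B_iff)
qed

text \<open>
  The map \<open>\<pi>\<close> of \<open>A\<close> as a module over itself.
\<close>

definition alg_pi :: "'a \<Rightarrow> 'a" where
  "alg_pi a = ev additive_group (\<lambda>a' h. a' * j' h) (rhoR A a)"

end

locale cleft_hopf_module = cleft_comod_algebra \<H> A B etaL j j' + relative_hopf_module \<H> A M da
  for \<H> :: "('k::{comm_ring,comm_monoid_mult}, 'l::{ring,monoid_mult}, 'r::{ring,monoid_mult},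
             'h::{ring,monoid_mult}) hopf_algebroid"
    and A :: "('k, 'l, 'r, 'h, 'a::{ring,monoid_mult}) comod_algebra"
    and B etaL j j'
    and M :: "('m, 'l, 'r, 'h, 'x) comod_scheme" and da (infixl \<open>\<cdot>\<close> 72)
begin

text \<open>
  \<open>\<pi>(m) = m\<^sup>0 j'(m\<^sup>1)\<close>. For \<open>A = H\<close> over a Hopf algebra with \<open>j = id\<close> and \<open>j' = S\<close> this is the projection in the
  fundamental theorem of Hopf modules.
\<close>

definition cleft_pi :: "'m \<Rightarrow> 'm" where
  "cleft_pi m = ev M (\<lambda>m' h. m' \<cdot> j' h) (coactR M m)"

lemmas comm_group_M = M.right.comm_group_M

lemma Rbalanced_j': "Rbalanced M (\<lambda>m' h. m' \<cdot> j' h)"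
  by (rule balancedI[OF M.right.tensorable_M comm_group_M])
     (simp_all add: da_simps j'_add da_balanced rb_la_def j'_tR)

lemma cleft_pi_closed: "m \<in> carrier M \<Longrightarrow> cleft_pi m \<in> carrier M"
  unfolding cleft_pi_def by (rule M.right.ev_rho_closed[OF comm_group_M]) (simp_all add: da_simps)

lemma cleft_pi_mult: "m \<in> carrier M \<Longrightarrow> m' \<in> carrier M \<Longrightarrow> cleft_pi (m \<otimes>\<^bsub>M\<^esub> m') = cleft_pi m \<otimes>\<^bsub>M\<^esub> cleft_pi m'"
  unfolding cleft_pi_def by (rule M.right.ev_rho_mult[OF Rbalanced_j'])

lemma cleft_pi_hom: "cleft_pi \<in> hom M M"
  by (rule homI) (simp_all add: cleft_pi_closed cleft_pi_mult)

lemma cleft_pi_actL: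
  assumes m: "m \<in> carrier M"
  shows "cleft_pi (actL M m l) = cleft_pi m \<cdot> etaL l"
proof -
  have "cleft_pi (actL M m l) = ev M (\<lambda>m' h. m' \<cdot> j' h \<cdot> etaL l) (coactR M m)"
    unfolding cleft_pi_def using M.ev_coactR_actL[OF Rbalanced_j' m, of l]
    by (simp add: lb_ra_def j'_tL)
       (rule M.right.ev_rho_cong[OF comm_group_M m], simp_all add: da_simps)
  also have "\<dots> = cleft_pi m \<cdot> etaL l"
    unfolding cleft_pi_def
    by (rule M.right.hom_ev_rho[OF comm_group_M comm_group_M m da_hom, symmetric]) (simp add: da_simps)
  finally show ?thesis .
qed

text \<open>
  \<open>\<pi>(m\<^sub>0) j(m\<^sub>1) = m\<^sup>0 j'(m\<^sup>1\<^sub>(\<^sub>1\<^sub>)) j(m\<^sup>1\<^sub>(\<^sub>2\<^sub>)) = m\<^sup>0 \<epsilon>\<^sub>R(m\<^sup>1) = m\<close>, by mixed coassociativity and since \<open>j'\<close> is a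
  left convolution inverse of \<open>j\<close>.
\<close>

lemma cleft_pi_reconstruct:
  assumes m: "m \<in> carrier M"
  shows "ev M (\<lambda>n h. cleft_pi n \<cdot> j h) (coactL M m) = m"
proof -
  let ?F = "\<lambda>m' x y. m' \<cdot> (j' x * j y)"
  have b: "balanced3 M (actR M) additive_group laR raL additive_group laL M ?F"
  proof (rule balanced3I[OF M.right.tensorable_M tensorable_additive comm_group_M])
    show "actR M m s \<cdot> (j' n * j p) = m \<cdot> (j' (laR s n) * j p)" if "m \<in> carrier M" for m s n p
      using da_balanced[OF that, of s "j' n * j p"] by (simp add: rb_la_def j'_tR mult.assoc)
    show "m \<cdot> (j' (raL n t) * j p) = m \<cdot> (j' n * j (laL t p))" for m n t p
      by (simp add: lb_ra_def lb_la_def j'_tL j_sL mult.assoc)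
  qed (simp_all add: da_simps j_add j'_add distrib_left distrib_right)
  have "ev M (\<lambda>n h. cleft_pi n \<cdot> j h) (coactL M m) =
      ev M (\<lambda>n h. ev M (\<lambda>m' k. ?F m' k h) (coactR M n)) (coactL M m)"
  proof (rule M.left.ev_rho_cong[OF comm_group_M m])
    fix n h assume n: "n \<in> carrier M"
    then show "cleft_pi n \<cdot> j h \<in> carrier M" by (simp add: da_simps cleft_pi_closed)
    have "cleft_pi n \<cdot> j h = ev M (\<lambda>m' k. m' \<cdot> j' k \<cdot> j h) (coactR M n)"
      unfolding cleft_pi_def
      by (rule M.right.hom_ev_rho[OF comm_group_M comm_group_M n da_hom]) (simp add: da_simps)
    also have "\<dots> = ev M (\<lambda>m' k. ?F m' k h) (coactR M n)"
      by (rule M.right.ev_rho_cong[OF comm_group_M n]) (simp_all add: da_simps)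
    finally show "cleft_pi n \<cdot> j h = ev M (\<lambda>m' k. ?F m' k h) (coactR M n)" .
  qed
  also have "\<dots> = ev M (\<lambda>m' k. ev M (\<lambda>x y. ?F m' x y) (\<Delta>\<^sub>L k)) (coactR M m)"
    by (rule M.ev_mixed_RL[OF b m])
  also have "\<dots> = ev M (\<lambda>m' k. actR M m' (\<epsilon>\<^sub>R k)) (coactR M m)"
  proof (rule M.right.ev_rho_cong[OF comm_group_M m])
    fix m' k assume m': "m' \<in> carrier M"
    show "ev M (\<lambda>x y. ?F m' x y) (\<Delta>\<^sub>L k) \<in> carrier M"
      by (rule left.reg.ev_rho_closed[OF comm_group_M]) (use m' in \<open>simp_all add: da_simps\<close>)
    have "(\<lambda>a. m' \<cdot> a) \<in> hom additive_group M" by (rule homI) (use m' in \<open>simp_all add: da_simps\<close>)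
    from left.reg.hom_ev_rho[OF comm_group_additive comm_group_M _ this, of k "\<lambda>x y. j' x * j y"]
    show "ev M (\<lambda>x y. ?F m' x y) (\<Delta>\<^sub>L k) = actR M m' (\<epsilon>\<^sub>R k)"
      using m' by (simp add: j'_j da_etaR)
  qed
  also have "\<dots> = m" by (rule M.right.\<rho>_counit[OF m])
  finally show ?thesis .
qed

abbreviation "TM \<equiv> M.right.T"

lemma comm_group_TM: "comm_group TM" by (rule M.right.comm_group_T)

lemmas pureD = balancedD[OF balanced_pure_tensor[OF M.right.tensorable_M], simplified]

lemma alg_balanced_pure:
  assumes "n \<in> carrier M"
  shows "balanced UNIV (alg_comod A) (\<lambda>a r. a * etaR A r) additive_group laR TM (\<lambda>a' k. pure_tensor TM (n \<cdot> a') k)"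
proof (rule balancedI[OF _ comm_group_TM])
  show "tensorable UNIV (alg_comod A) (\<lambda>a r. a * etaR A r) additive_group laR"
    using right.tensorable_M by simp
  show "pure_tensor TM (n \<cdot> (m * etaR A s)) na = pure_tensor TM (n \<cdot> m) (laR s na)" for m s na
    using pureD(6)[of "n \<cdot> m" s na] assms by (simp add: da_simps da_etaR)
qed (use assms in \<open>simp_all add: pureD da_simps\<close>)

text \<open>The action of \<open>a\<close> on \<open>n \<otimes> 1\<close> in the right \<open>A\<close>-module \<open>M \<otimes>\<^sub>R H\<close>.\<close>

definition twisted :: "'m \<Rightarrow> 'a \<Rightarrow> ('m \<times> 'h \<Rightarrow>\<^sub>0 int) set" where
  "twisted n a = ev TM (\<lambda>a' k. pure_tensor TM (n \<cdot> a') k) (rhoR A a)"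

lemmas ev_rhoR_closed = right.ev_rho_closed[of _ a for a, simplified]
lemmas ev_rhoR_additive = right.ev_rho_additive[of a for a, simplified]

lemma twisted_closed: "n \<in> carrier M \<Longrightarrow> twisted n a \<in> carrier TM"
  unfolding twisted_def by (rule ev_rhoR_closed[OF comm_group_TM]) (simp add: pureD da_simps)

lemma twisted_add: "n \<in> carrier M \<Longrightarrow> twisted n (a + a') = twisted n a \<otimes>\<^bsub>TM\<^esub> twisted n a'"
  unfolding twisted_def using right.ev_rho_mult[of TM _ a a'] alg_balanced_pure[of n] by simp

lemma twisted_mult: "n \<in> carrier M \<Longrightarrow> n' \<in> carrier M \<Longrightarrow> twisted (n \<otimes>\<^bsub>M\<^esub> n') a = twisted n a \<otimes>\<^bsub>TM\<^esub> twisted n' a"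
  unfolding twisted_def by (rule ev_rhoR_additive[OF comm_group_TM]) (simp_all add: pureD da_simps)

lemma twisted_B:
  assumes n: "n \<in> carrier M" and b: "b \<in> B"
  shows "twisted n b = pure_tensor TM (n \<cdot> b) 1"
  unfolding twisted_def using ev_pure[OF alg_balanced_pure[OF n], of b 1] b by (simp add: B_iff)

lemma ev_rhoR_B_mult:
  assumes F: "balanced UNIV (alg_comod A) (\<lambda>a r. a * etaR A r) additive_group laR K F" and b: "b \<in> B"
  shows "ev K F (rhoR A (b * a)) = ev K (\<lambda>a' h. F (b * a') h) (rhoR A a)"
proof -
  interpret reg: relative_hopf_module \<H> A "alg_comod A" "(*)" by (rule regular_relative_hopf_module)
  show ?thesis using reg.ev_coactR_coinvariant_da[of K F b a] F b by (simp add: B_iff)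
qed

lemma twisted_B_mult:
  assumes n: "n \<in> carrier M" and b: "b \<in> B"
  shows "twisted n (b * a) = twisted (n \<cdot> b) a"
proof -
  have "twisted n (b * a) = ev TM (\<lambda>a' h. pure_tensor TM (n \<cdot> (b * a')) h) (rhoR A a)"
    unfolding twisted_def by (rule ev_rhoR_B_mult[OF alg_balanced_pure[OF n] b])
  then show ?thesis by (simp add: twisted_def da_simps n)
qed

lemma twisted_j:
  assumes n: "n \<in> carrier M"
  shows "twisted n (j h) = ev TM (\<lambda>x y. pure_tensor TM (n \<cdot> j x) y) (\<Delta>\<^sub>R h)"
  unfolding twisted_def by (rule ev_rhoR_j[OF alg_balanced_pure[OF n]])

text \<open>
  The coaction applied to \<open>m = \<pi>(m\<^sub>0) j(m\<^sub>1)\<close>, computed as if \<open>\<pi>(m\<^sub>0)\<close> were already known to be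
  coinvariant. It is correct for a different reason: \<open>j\<close> is a comodule map, and
  \<open>\<pi>(m\<^sub>0) j(m\<^sub>1\<^sup>(\<^sup>1\<^sup>)) \<otimes> m\<^sub>1\<^sup>(\<^sup>2\<^sup>) = m\<^sup>0 \<otimes> m\<^sup>1\<close> by mixed coassociativity.
\<close>

lemma coactR_reconstruct:
  assumes m: "m \<in> carrier M"
  shows "coactR M m = ev TM (\<lambda>n h. twisted (cleft_pi n) (j h)) (coactL M m)"
proof -
  let ?F = "\<lambda>n x y. pure_tensor TM (cleft_pi n \<cdot> j x) y"
  have b: "balanced3 M (actL M) additive_group laL raR additive_group laR TM ?F"
  proof (rule balanced3I[OF M.left.tensorable_M tensorable_additive comm_group_TM])
    show "?F (actL M m s) n p = ?F m (laL s n) p" if "m \<in> carrier M" for m s n p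
      using that by (simp add: cleft_pi_actL lb_la_def j_sL da_simps cleft_pi_closed)
    show "?F m (raR n t) p = ?F m n (laR t p)" if "m \<in> carrier M" for m n t p
      using that pureD(6)[of "cleft_pi m \<cdot> j n" t p] by (simp add: j_sR da_simps cleft_pi_closed da_etaR)
  qed (simp_all add: pureD da_simps cleft_pi_closed cleft_pi_mult j_add)
  have "ev TM (\<lambda>n h. twisted (cleft_pi n) (j h)) (coactL M m) =
      ev TM (\<lambda>n h. ev TM (\<lambda>x y. ?F n x y) (\<Delta>\<^sub>R h)) (coactL M m)"
    using twisted_closed[OF cleft_pi_closed] twisted_j[OF cleft_pi_closed]
    by (intro M.left.ev_rho_cong[OF comm_group_TM m])
  also have "\<dots> = ev TM (\<lambda>m' y. ev TM (\<lambda>n x. ?F n x y) (coactL M m')) (coactR M m)"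
    by (rule M.ev_mixed_LR[OF b m, symmetric])
  also have "\<dots> = ev TM (\<lambda>m' y. pure_tensor TM m' y) (coactR M m)"
  proof (rule M.right.ev_rho_cong[OF comm_group_TM m])
    fix m' y assume m': "m' \<in> carrier M"
    show "ev TM (\<lambda>n x. ?F n x y) (coactL M m') \<in> carrier TM"
      by (rule M.left.ev_rho_closed[OF comm_group_TM m']) (simp add: pureD da_simps cleft_pi_closed)
    have "(\<lambda>m. pure_tensor TM m y) \<in> hom M TM" by (rule homI) (simp_all add: pureD)
    from M.left.hom_ev_rho[OF comm_group_M comm_group_TM m' this, of "\<lambda>n x. cleft_pi n \<cdot> j x"]
    show "ev TM (\<lambda>n x. ?F n x y) (coactL M m') = pure_tensor TM m' y"
      by (simp add: cleft_pi_reconstruct[OF m'] da_simps cleft_pi_closed)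
  qed
  also have "\<dots> = coactR M m" by (rule M.right.ev_rho_self[OF m])
  finally show ?thesis by simp
qed

text \<open>
  The diagonal action on \<open>M \<otimes>\<^sub>R H\<close> is associative because the coaction of \<open>A\<close> is multiplicative.
\<close>

lemma ev_twisted_act:
  assumes n: "n \<in> carrier M"
  shows "ev TM (\<lambda>m h. ev TM (\<lambda>a' h'. pure_tensor TM (m \<cdot> a') (h * h')) (rhoR A a')) (twisted n a) = twisted n (a * a')"
    (is "ev TM ?G _ = _")
proof -
  have G: "Rbalanced TM ?G" by (rule Rbalanced_da[OF balanced_pure_tensor[OF M.right.tensorable_M]])
  have "ev TM ?G (twisted n a) = ev TM (\<lambda>x k. ev TM ?G (pure_tensor TM (n \<cdot> x) k)) (rhoR A a)"
    unfolding twisted_def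
    using right.hom_ev_rho[OF comm_group_TM comm_group_TM _ ev_hom[OF G], of a "\<lambda>a' k. pure_tensor TM (n \<cdot> a') k"] n
    by (simp add: pureD da_simps)
  also have "\<dots> = ev TM (\<lambda>x k. ev TM (\<lambda>x' k'. pure_tensor TM (n \<cdot> (x * x')) (k * k')) (rhoR A a')) (rhoR A a)"
    using n by (simp add: ev_pure[OF G] da_simps)
  also have "\<dots> = ev TM (\<lambda>a' k. pure_tensor TM (n \<cdot> a') k) (rhoR A (a * a'))"
  proof -
    have "rhoR A (a * a') = tensor_mult right.T (*) (rhoR A a) (rhoR A a')"
      using rhoR_mult[of a a'] by (simp add: rb_tensor_def)
    then show ?thesis
      using tensor_mult_ev(3)[OF right.tensorable_M _ right.tensorable_M _ right.tensorable_M _, of "rhoR A a" "rhoR A a'" "(*)" TM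
          "\<lambda>a' k. pure_tensor TM (n \<cdot> a') k"] alg_balanced_pure[OF n] right.rho_closed by simp
  qed
  finally show ?thesis by (simp add: twisted_def)
qed

text \<open>
  The key point. Since the coaction is \<open>A\<close>-linear, \<open>\<rho>(\<pi>(m)) = \<rho>(m\<^sup>0) j'(m\<^sup>1)\<close>, with the diagonal action of \<open>A\<close> on
  \<open>M \<otimes>\<^sub>R H\<close>. Inserting \<open>\<rho>(m\<^sup>0) = (\<pi>(m\<^sup>0\<^sub>0) \<otimes> 1) j(m\<^sup>0\<^sub>1)\<close> and using mixed coassociativity gives
  \<open>(\<pi>(m\<^sub>0) \<otimes> 1) j(m\<^sub>1\<^sup>(\<^sup>1\<^sup>)) j'(m\<^sub>1\<^sup>(\<^sup>2\<^sup>)) = (\<pi>(m\<^sub>0) \<otimes> 1) \<eta>\<^sub>L(\<epsilon>\<^sub>L(m\<^sub>1))\<close>. As \<open>\<eta>\<^sub>L\<close> takes values in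
  coinvariants, this is \<open>\<pi>(m\<^sub>0) \<eta>\<^sub>L(\<epsilon>\<^sub>L(m\<^sub>1)) \<otimes> 1 = \<pi>(m\<^sub>0 \<epsilon>\<^sub>L(m\<^sub>1)) \<otimes> 1 = \<pi>(m) \<otimes> 1\<close>.
\<close>

lemma cleft_pi_coinvariant:
  assumes m: "m \<in> carrier M"
  shows "M.coinvariant (cleft_pi m)"
proof
  show "cleft_pi m \<in> carrier M" by (rule cleft_pi_closed[OF m])
  let ?G = "\<lambda>a m h. ev TM (\<lambda>a' h'. pure_tensor TM (m \<cdot> a') (h * h')) (rhoR A a)"
  let ?F = "\<lambda>n x y. twisted (cleft_pi n) (j x * j' y)"
  have G: "Rbalanced TM (?G a)" for a by (rule Rbalanced_da[OF balanced_pure_tensor[OF M.right.tensorable_M]])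
  have b: "balanced3 M (actL M) additive_group laL raR additive_group laR TM ?F"
  proof (rule balanced3I[OF M.left.tensorable_M tensorable_additive comm_group_TM])
    show "?F (actL M m s) n p = ?F m (laL s n) p" if "m \<in> carrier M" for m s n p
      using that twisted_B_mult[of "cleft_pi m" "etaL s" "j n * j' p"]
      by (simp add: cleft_pi_actL lb_la_def j_sL cleft_pi_closed B_closed mult.assoc)
    show "?F m (raR n t) p = ?F m n (laR t p)" for m n t p
      by (simp add: j_sR rb_la_def j'_tR mult.assoc)
  qed (simp_all add: twisted_closed twisted_mult twisted_add cleft_pi_closed cleft_pi_mult j_add j'_add distrib_left distrib_right)
  have "coactR M (cleft_pi m) = ev TM (\<lambda>m' h. coactR M (m' \<cdot> j' h)) (coactR M m)"
    unfolding cleft_pi_def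
    using M.right.\<rho>_hom by (intro M.right.hom_ev_rho[OF comm_group_M comm_group_TM m]) (simp_all add: da_simps)
  also have "\<dots> = ev TM (\<lambda>m' h. ev TM (\<lambda>n x. ?F n x h) (coactL M m')) (coactR M m)"
  proof (rule M.right.ev_rho_cong[OF comm_group_TM m])
    fix m' h assume m': "m' \<in> carrier M"
    show "coactR M (m' \<cdot> j' h) \<in> carrier TM" by (rule M.right.rho_closed) (simp add: m' da_simps)
    have "coactR M (m' \<cdot> j' h) = ev TM (pure_tensor TM) (coactR M (m' \<cdot> j' h))"
      by (rule M.right.ev_rho_self[symmetric]) (simp add: m' da_simps)
    also have "\<dots> = ev TM (?G (j' h)) (coactR M m')"
      by (rule ev_coactR_da[OF balanced_pure_tensor[OF M.right.tensorable_M] m'])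
    also have "\<dots> = ev TM (?G (j' h)) (ev TM (\<lambda>n h. twisted (cleft_pi n) (j h)) (coactL M m'))"
      by (subst coactR_reconstruct[OF m']) simp
    also have "\<dots> = ev TM (\<lambda>n x. ev TM (?G (j' h)) (twisted (cleft_pi n) (j x))) (coactL M m')"
      by (rule M.left.hom_ev_rho[OF comm_group_TM comm_group_TM m' ev_hom[OF G]]) (simp add: twisted_closed cleft_pi_closed)
    also have "\<dots> = ev TM (\<lambda>n x. ?F n x h) (coactL M m')"
      by (rule M.left.ev_rho_cong[OF comm_group_TM m']) (simp_all add: ev_twisted_act twisted_closed cleft_pi_closed)
    finally show "coactR M (m' \<cdot> j' h) = ev TM (\<lambda>n x. ?F n x h) (coactL M m')" .
  qed
  also have "\<dots> = ev TM (\<lambda>n h. ev TM (\<lambda>x y. ?F n x y) (\<Delta>\<^sub>R h)) (coactL M m)"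
    by (rule M.ev_mixed_LR[OF b m])
  also have "\<dots> = ev TM (\<lambda>n h. pure_tensor TM (cleft_pi (actL M n (\<epsilon>\<^sub>L h))) 1) (coactL M m)"
  proof (rule M.left.ev_rho_cong[OF comm_group_TM m])
    fix n h assume n: "n \<in> carrier M"
    show "ev TM (\<lambda>x y. ?F n x y) (\<Delta>\<^sub>R h) \<in> carrier TM"
      by (rule right.reg.ev_rho_closed[OF comm_group_TM]) (use n in \<open>simp_all add: twisted_closed cleft_pi_closed\<close>)
    have "twisted (cleft_pi n) \<in> hom additive_group TM"
      by (rule homI) (use n in \<open>simp_all add: twisted_closed twisted_add cleft_pi_closed\<close>)
    from right.reg.hom_ev_rho[OF comm_group_additive comm_group_TM _ this, of h "\<lambda>x y. j x * j' y"]
    have "ev TM (\<lambda>x y. ?F n x y) (\<Delta>\<^sub>R h) = twisted (cleft_pi n) (etaL (\<epsilon>\<^sub>L h))" by (simp add: j_j')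
    then show "ev TM (\<lambda>x y. ?F n x y) (\<Delta>\<^sub>R h) = pure_tensor TM (cleft_pi (actL M n (\<epsilon>\<^sub>L h))) 1"
      using n by (simp add: twisted_B cleft_pi_closed B_closed cleft_pi_actL)
  qed
  also have "\<dots> = pure_tensor TM (cleft_pi (ev M (\<lambda>n h. actL M n (\<epsilon>\<^sub>L h)) (coactL M m))) 1"
  proof (rule M.left.hom_ev_rho[OF comm_group_M comm_group_TM m, symmetric])
    show "(\<lambda>n. pure_tensor TM (cleft_pi n) 1) \<in> hom M TM"
      by (rule homI) (simp_all add: pureD cleft_pi_closed cleft_pi_mult)
  qed (simp add: M.left.ac_closed)
  also have "ev M (\<lambda>n h. actL M n (\<epsilon>\<^sub>L h)) (coactL M m) = m" by (rule M.left.\<rho>_counit[OF m])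
  finally show "coactR M (cleft_pi m) = pure_tensor TM (cleft_pi m) 1" .
qed

lemma coinvariant_da_B:
  assumes n: "M.coinvariant n" and b: "b \<in> B"
  shows "M.coinvariant (n \<cdot> b)"
proof
  show c: "n \<cdot> b \<in> carrier M" using n by (simp add: da_simps)
  have "coactR M (n \<cdot> b) = ev TM (\<lambda>a' h. pure_tensor TM (n \<cdot> a') h) (rhoR A b)"
    using M.right.ev_rho_self[OF c] ev_coactR_coinvariant_da[OF balanced_pure_tensor[OF M.right.tensorable_M] n, of b] by simp
  then show "coactR M (n \<cdot> b) = pure_tensor TM (n \<cdot> b) 1"
    using twisted_B[of n b] n b by (simp add: twisted_def)
qed

lemma cleft_pi_coinvariant_da:
  assumes n: "M.coinvariant n"
  shows "cleft_pi (n \<cdot> a) = n \<cdot> alg_pi a"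
proof -
  have nM: "n \<in> carrier M" using n by simp
  have "(\<lambda>a. n \<cdot> a) \<in> hom additive_group M" by (rule homI) (use nM in \<open>simp_all add: da_simps\<close>)
  from right.hom_ev_rho[OF comm_group_additive comm_group_M _ this, of a "\<lambda>a' h. a' * j' h"]
  show ?thesis
    unfolding cleft_pi_def alg_pi_def ev_coactR_coinvariant_da[OF Rbalanced_j' n] using nM by (simp add: da_simps)
qed

lemma cleft_pi_coinvariant_eq:
  assumes n: "M.coinvariant n"
  shows "cleft_pi n = n \<cdot> j' 1"
  unfolding cleft_pi_def using ev_pure[OF Rbalanced_j', of n 1] n by simp

end

lemma (in cleft_comod_algebra) regular_cleft_hopf_module: "cleft_hopf_module \<H> A B etaL j j' (alg_comod A) (*)"
  by (rule cleft_hopf_module.intro[OF cleft_comod_algebra_axioms regular_relative_hopf_module])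

context cleft_comod_algebra
begin

lemma alg_pi_facts:
  shows alg_pi_B: "alg_pi a \<in> B"
    and alg_pi_add: "alg_pi (a + a') = alg_pi a + alg_pi a'"
    and alg_pi_B_mult: "b \<in> B \<Longrightarrow> alg_pi (b * a) = b * alg_pi a"
    and alg_pi_reconstruct: "ev additive_group (\<lambda>n h. alg_pi n * j h) (rhoL A a) = a"
proof -
  interpret reg: cleft_hopf_module \<H> A B etaL j j' "alg_comod A" "(*)" by (rule regular_cleft_hopf_module)
  have eq: "reg.cleft_pi a = alg_pi a" for a
    unfolding reg.cleft_pi_def alg_pi_def using ev_alg[OF right.tensorable_M right.rho_closed[of a]] by simp
  show "alg_pi a \<in> B" using reg.cleft_pi_coinvariant[of a] by (simp add: B_iff eq)
  show "alg_pi (a + a') = alg_pi a + alg_pi a'" using reg.cleft_pi_mult[of a a'] by (simp add: eq)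
  show "alg_pi (b * a) = b * alg_pi a" if "b \<in> B"
    using reg.cleft_pi_coinvariant_da[of b a] that by (simp add: B_iff eq)
  show "ev additive_group (\<lambda>n h. alg_pi n * j h) (rhoL A a) = a"
    using reg.cleft_pi_reconstruct[of a] ev_alg[OF left.tensorable_M left.rho_closed[of a]] by (simp add: eq)
qed

end

section \<open>The module \<open>W \<otimes>\<^sub>B A\<close>\<close>

text \<open>
  A tensor product depends on the module only through its carrier and operation. This identifies the tensor
  products over the group \<open>W \<otimes>\<^sub>B A\<close> with those over records that extend it.
\<close>

lemma tensor_cong_group:
  assumes "carrier M = carrier M'" "monoid.mult M = monoid.mult M'"
  shows "tensor Z M ra N la = tensor Z M' ra N la"
  using assms by (simp add: tensor_def)

lemma hom_comp: "f \<in> hom X Y \<Longrightarrow> g \<in> hom Y Z \<Longrightarrow> (\<lambda>x. g (f x)) \<in> hom X Z"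
  by (auto simp: hom_def Pi_iff)

lemma hom_cong: "f \<in> hom X Y \<Longrightarrow> (\<And>x. x \<in> carrier X \<Longrightarrow> f' x = f x) \<Longrightarrow> group X \<Longrightarrow> f' \<in> hom X Y"
  unfolding hom_def by (simp add: Pi_iff group_def monoid.m_closed)

lemma hom_mult_fun:
  assumes "comm_group K" "group X" "f \<in> hom X K" "g \<in> hom X K"
  shows "(\<lambda>x. f x \<otimes>\<^bsub>K\<^esub> g x) \<in> hom X K"
proof -
  interpret K: comm_group K by fact
  show ?thesis using assms(3,4) by (intro homI) (simp_all add: hom_closedD hom_mult K.m_ac)
qed

text \<open>
  \<open>G\<close> is \<open>W \<otimes>\<^sub>B A\<close> inside the universe \<open>'u\<close>; it may carry further structure, as in the relative Hopf
  module below.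
\<close>

locale tensor_transport =
  fixes code :: "('u \<times> 'a::{ring,monoid_mult} \<Rightarrow>\<^sub>0 int) \<Rightarrow> 'u"
    and B :: "'a set" and W :: "('u, 'a) rmod" and G :: "('u, 'z) monoid_scheme"
  assumes code: "inj code" and W: "right_module B W (act W)"
    and carrier_G: "carrier G = carrier (tensor_group code B W)"
    and mult_G: "monoid.mult G = monoid.mult (tensor_group code B W)"
    and one_G: "one G = one (tensor_group code B W)"
begin

abbreviation "TW \<equiv> tensor_over B W"
abbreviation "dec \<equiv> decode code TW"
abbreviation "Bbalanced K F \<equiv> balanced B W (act W) additive_group (\<lambda>b a. b * a) K F"

text \<open>
  The encoded pure tensor \<open>w \<otimes> a\<close>. With \<open>lift\<close>, the map induced by a balanced map, and \<open>G_ext\<close> it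
  gives the universal property of \<open>G\<close>, after which the encoding no longer matters.
\<close>

definition pt :: "'u \<Rightarrow> 'a \<Rightarrow> 'u" where
  "pt w a = encode code (pure_tensor TW w a)"

lemma comm_group_W: "comm_group W"
  and act_closed: "w \<in> carrier W \<Longrightarrow> b \<in> B \<Longrightarrow> act W w b \<in> carrier W"
  using W by (simp_all add: right_module_def)

lemma tensorable_W: "tensorable B W (act W) additive_group (\<lambda>b a. b * a)"
  using comm_group_W act_closed by (simp add: tensorable_def)

lemma encode_inj: "inj_on (encode code) (carrier TW)"
proof (rule inj_onI)
  fix X Y assume "X \<in> carrier TW" "Y \<in> carrier TW" "encode code X = encode code Y"
  then show "X = Y"
    using presentation.tensor_rep(3)[OF presentation_tensor[OF tensorable_W], folded tensor_over_def] code
    by (metis encode_def injD)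
qed

lemma carrier_G_encode: "carrier G = encode code ` carrier TW"
  by (simp add: carrier_G tensor_group_def Let_def)

lemma dec_encode: "X \<in> carrier TW \<Longrightarrow> dec (encode code X) = X"
  using encode_inj by (simp add: decode_def)

lemma dec_closed: "u \<in> carrier G \<Longrightarrow> dec u \<in> carrier TW"
  by (auto simp: carrier_G_encode dec_encode)

lemma encode_dec: "u \<in> carrier G \<Longrightarrow> encode code (dec u) = u"
  by (auto simp: carrier_G_encode dec_encode)

lemma encode_closed: "X \<in> carrier TW \<Longrightarrow> encode code X \<in> carrier G"
  by (simp add: carrier_G_encode)

lemma mult_G_eq: "u \<otimes>\<^bsub>G\<^esub> v = encode code (dec u \<otimes>\<^bsub>TW\<^esub> dec v)"
  by (simp add: mult_G tensor_group_def Let_def)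

lemma comm_group_TW: "comm_group TW"
  unfolding tensor_over_def by (rule comm_group_tensor[OF tensorable_W])

lemma comm_group_G: "comm_group G"
proof -
  interpret T: comm_group TW by (rule comm_group_TW)
  show ?thesis
  proof (rule comm_groupI)
    show "\<one>\<^bsub>G\<^esub> \<in> carrier G" by (simp add: one_G tensor_group_def Let_def carrier_G_encode)
    fix u assume u: "u \<in> carrier G"
    show "\<exists>v\<in>carrier G. v \<otimes>\<^bsub>G\<^esub> u = \<one>\<^bsub>G\<^esub>"
      using u by (intro bexI[of _ "encode code (inv\<^bsub>TW\<^esub> dec u)"])
        (simp_all add: mult_G_eq dec_encode dec_closed encode_closed, simp add: one_G tensor_group_def Let_def)
    show "\<one>\<^bsub>G\<^esub> \<otimes>\<^bsub>G\<^esub> u = u"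
      using u by (simp add: mult_G_eq one_G) (simp add: tensor_group_def Let_def dec_encode dec_closed encode_dec)
  qed (simp_all add: mult_G_eq dec_encode dec_closed encode_closed T.m_ac)
qed

lemma encode_hom: "encode code \<in> hom TW G"
  by (rule homI) (simp_all add: encode_closed mult_G_eq dec_encode)

lemma dec_hom: "dec \<in> hom G TW"
proof -
  interpret T: comm_group TW by (rule comm_group_TW)
  show ?thesis by (rule homI) (simp_all add: dec_closed mult_G_eq dec_encode)
qed

lemma Bbalanced_hom:
  assumes F: "Bbalanced K F" and "comm_group K'" "h \<in> hom K K'"
  shows "Bbalanced K' (\<lambda>w a. h (F w a))"
  using assms(2,3) balancedD[OF F, simplified]
  by (intro balancedI) (simp_all add: hom_mult hom_closedD tensorable_W)

lemma Bbalanced_pt: "Bbalanced G pt"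
  unfolding pt_def
  using Bbalanced_hom[OF balanced_pure_tensor[OF tensorable_W] comm_group_G encode_hom[unfolded tensor_over_def]]
  by (simp add: tensor_over_def)

lemmas ptD = balancedD(3-)[OF Bbalanced_pt, simplified]

definition lift :: "('g, 'y) monoid_scheme \<Rightarrow> ('u \<Rightarrow> 'a \<Rightarrow> 'g) \<Rightarrow> 'u \<Rightarrow> 'g" where
  "lift K F u = ev K F (dec u)"

lemma lift_pt: "Bbalanced K F \<Longrightarrow> w \<in> carrier W \<Longrightarrow> lift K F (pt w a) = F w a"
  using pure_tensor_closed[OF tensorable_W, of w a] ev_pure[of B W "act W" additive_group "\<lambda>b a. b * a" K F w a]
  by (simp add: lift_def pt_def tensor_over_def dec_encode[unfolded tensor_over_def])

lemma lift_hom: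
  assumes "Bbalanced K F"
  shows "lift K F \<in> hom G K"
  using hom_comp[OF dec_hom, unfolded tensor_over_def, OF ev_hom[OF assms]]
  by (simp add: lift_def[abs_def] tensor_over_def)

lemma lift_self: "u \<in> carrier G \<Longrightarrow> lift G pt u = u"
proof -
  assume u: "u \<in> carrier G"
  have "encode code (ev TW (pure_tensor TW) (dec u)) = lift G pt u"
    unfolding lift_def pt_def
    using hom_ev[OF tensorable_W comm_group_TW comm_group_G dec_closed[OF u, unfolded tensor_over_def] encode_hom, of "pure_tensor TW"]
      pure_tensor_closed[OF tensorable_W] by (simp add: tensor_over_def)
  then show ?thesis
    using ev_self[OF tensorable_W dec_closed[OF u, unfolded tensor_over_def]] encode_dec[OF u] by (simp add: tensor_over_def)
qed

lemma G_ext: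
  assumes "comm_group K" "h \<in> hom G K" "h' \<in> hom G K"
    and "\<And>w a. w \<in> carrier W \<Longrightarrow> h (pt w a) = h' (pt w a)" "u \<in> carrier G"
  shows "h u = h' u"
proof -
  have eq: "g u = ev K (\<lambda>w a. g (pt w a)) (dec u)" if g: "g \<in> hom G K" for g
    using hom_ev[OF tensorable_W comm_group_G assms(1) dec_closed[OF assms(5), unfolded tensor_over_def] g, of pt]
      lift_self[OF assms(5)] by (simp add: lift_def ptD tensor_over_def)
  show ?thesis
    unfolding eq[OF assms(2)] eq[OF assms(3)] tensor_over_def
    by (rule ev_cong[OF tensorable_W assms(1) dec_closed[OF assms(5), unfolded tensor_over_def]])
       (use assms(4) hom_closedD[OF assms(2)] hom_closedD[OF assms(3)] ptD(1) in simp_all)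
qed

definition B_linear :: "('a \<Rightarrow> 'a) \<Rightarrow> bool" where
  "B_linear f \<longleftrightarrow> (\<forall>x y. f (x + y) = f x + f y) \<and> (\<forall>b\<in>B. \<forall>x. f (b * x) = b * f x)"

lemma Bbalanced_pt_comp: "B_linear f \<Longrightarrow> Bbalanced G (\<lambda>w a. pt w (f a))"
  by (rule balancedI[OF tensorable_W comm_group_G]) (simp_all add: ptD B_linear_def)

lemma tensor_act_lift:
  assumes "B_linear f" "u \<in> carrier G"
  shows "tensor_act code B W f u = lift G (\<lambda>w a. pt w (f a)) u"
proof -
  have "tensor_map2 TW id f (dec u) = ev TW (\<lambda>w a. pure_tensor TW w (f a)) (dec u)"
    using tensor_map2_ev(2)[OF tensorable_W dec_closed[OF assms(2), unfolded tensor_over_def] tensorable_W, of id f]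
    by (simp add: tensor_over_def)
  then show ?thesis
    unfolding tensor_act_def lift_def pt_def Let_def
    using hom_ev[OF tensorable_W comm_group_TW comm_group_G dec_closed[OF assms(2), unfolded tensor_over_def] encode_hom, of "\<lambda>w a. pure_tensor TW w (f a)"]
      pure_tensor_closed[OF tensorable_W] by (simp add: tensor_over_def)
qed

lemma group_G: "group G"
  using comm_group_G by (simp add: comm_group_def)

lemma tensor_act_hom: "B_linear f \<Longrightarrow> tensor_act code B W f \<in> hom G G"
  by (rule hom_cong[OF lift_hom[OF Bbalanced_pt_comp] tensor_act_lift group_G])

lemma tensor_act_pt: "B_linear f \<Longrightarrow> w \<in> carrier W \<Longrightarrow> tensor_act code B W f (pt w a) = pt w (f a)"
  by (simp add: tensor_act_lift ptD lift_pt[OF Bbalanced_pt_comp])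

lemma tensor_act_closed: "B_linear f \<Longrightarrow> u \<in> carrier G \<Longrightarrow> tensor_act code B W f u \<in> carrier G"
  by (rule hom_closedD[OF tensor_act_hom])

lemma tensor_act_comp:
  assumes "B_linear f" "B_linear g" "B_linear (\<lambda>a. f (g a))" "u \<in> carrier G"
  shows "tensor_act code B W f (tensor_act code B W g u) = tensor_act code B W (\<lambda>a. f (g a)) u"
  by (rule G_ext[OF comm_group_G hom_comp[OF tensor_act_hom tensor_act_hom] tensor_act_hom])
     (use assms in \<open>simp_all add: tensor_act_pt\<close>)

lemma tensor_act_add:
  assumes "B_linear f" "B_linear g" "B_linear (\<lambda>a. f a + g a)" "u \<in> carrier G"
  shows "tensor_act code B W (\<lambda>a. f a + g a) u = tensor_act code B W f u \<otimes>\<^bsub>G\<^esub> tensor_act code B W g u"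
  by (rule G_ext[OF comm_group_G tensor_act_hom hom_mult_fun[OF comm_group_G group_G tensor_act_hom tensor_act_hom]])
     (use assms in \<open>simp_all add: tensor_act_pt ptD\<close>)

lemma tensor_act_id:
  assumes "u \<in> carrier G"
  shows "tensor_act code B W (\<lambda>a. a) u = u"
  using tensor_act_lift[of "\<lambda>a. a", OF _ assms] lift_self[OF assms] by (simp add: B_linear_def)

lemma right_module_G:
  fixes f :: "'s::{ring,monoid_mult} \<Rightarrow> 'a \<Rightarrow> 'a"
  assumes "\<And>s. B_linear (f s)" "\<And>s s' a. f (s + s') a = f s a + f s' a" "\<And>s s' a. f (s * s') a = f s' (f s a)" "\<And>a. f 1 a = a"
  shows "right_module UNIV G (\<lambda>u s. tensor_act code B W (f s) u)"
proof -
  have 1: "f (s + s') = (\<lambda>a. f s a + f s' a)" "f (s * s') = (\<lambda>a. f s' (f s a))" "f 1 = (\<lambda>a. a)" for s s'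
    using assms by auto
  have 2: "B_linear (\<lambda>a. f s a + f s' a)" "B_linear (\<lambda>a. f s' (f s a))" for s s'
    using assms(1)[of "s + s'"] assms(1)[of "s * s'"] by (simp_all add: 1)
  show ?thesis
    unfolding right_module_def 1
    using assms(1) 2
    by (simp add: comm_group_G tensor_act_closed hom_mult[OF tensor_act_hom] tensor_act_add tensor_act_comp tensor_act_id)
qed

end

text \<open>A coaction on \<open>A\<close> that is left \<open>B\<close>-linear induces one on \<open>W \<otimes>\<^sub>B A\<close>.\<close>

locale coact_transport = tensor_transport code B W G
  for code :: "('u \<times> 'a::{ring,monoid_mult} \<Rightarrow>\<^sub>0 int) \<Rightarrow> 'u"
    and B :: "'a set" and W :: "('u, 'a) rmod" and G :: "('u, 'z) monoid_scheme" +
  fixes la :: "'b::{ring,monoid_mult} \<Rightarrow> 'h::{ring,monoid_mult} \<Rightarrow> 'h"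
    and AA :: "('a, 'x) monoid_scheme" and acA :: "'a \<Rightarrow> 'b \<Rightarrow> 'a"
    and \<rho>A :: "'a \<Rightarrow> ('a \<times> 'h \<Rightarrow>\<^sub>0 int) set"
  assumes AA: "comm_group AA" "carrier AA = UNIV" "\<And>x y. x \<otimes>\<^bsub>AA\<^esub> y = x + y"
    and acA: "B_linear (\<lambda>a. acA a r)"
    and \<rho>A_hom: "\<rho>A \<in> hom AA (tensor UNIV AA acA additive_group la)"
    and \<rho>A_B: "b \<in> B \<Longrightarrow> \<rho>A (b * a) = tensor_map2 (tensor UNIV AA acA additive_group la) (\<lambda>a. b * a) id (\<rho>A a)"
begin

abbreviation "acG \<equiv> \<lambda>u r. tensor_act code B W (\<lambda>a. acA a r) u"
abbreviation "TA \<equiv> tensor UNIV AA acA additive_group la"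
abbreviation "TG \<equiv> tensor UNIV G acG additive_group la"
abbreviation "coact \<equiv> tensor_coact code B W (tensor UNIV (tensor_group code B W) acG additive_group la) \<rho>A"

lemma TG_eq: "tensor UNIV (tensor_group code B W) acG additive_group la = TG"
  by (rule tensor_cong_group) (simp_all add: carrier_G mult_G)

lemma tensorable_AA: "tensorable UNIV AA acA additive_group la"
  using AA by (simp add: tensorable_def)

lemma tensorable_G: "tensorable UNIV G acG additive_group la"
  using comm_group_G tensor_act_closed[OF acA] by (simp add: tensorable_def)

lemma \<rho>A_closed: "\<rho>A a \<in> carrier TA"
  using hom_closedD[OF \<rho>A_hom] AA by simp

lemma comm_group_TG: "comm_group TG" by (rule comm_group_tensor[OF tensorable_G])

lemmas pureG = balancedD(3-)[OF balanced_pure_tensor[OF tensorable_G], simplified]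

lemma balanced_AA:
  assumes F: "balanced UNIV G acG additive_group la K F" and w: "w \<in> carrier W"
  shows "balanced UNIV AA acA additive_group la K (\<lambda>a h. F (pt w a) h)"
proof (rule balancedI[OF tensorable_AA balancedD(2)[OF F]])
  note FD = balancedD(3-)[OF F, simplified]
  fix m m' n n' s
  show "F (pt w m) n \<in> carrier K" using w by (simp add: FD ptD)
  show "F (pt w (m \<otimes>\<^bsub>AA\<^esub> m')) n = F (pt w m) n \<otimes>\<^bsub>K\<^esub> F (pt w m') n" using w by (simp add: FD ptD AA)
  show "F (pt w m) (n \<otimes>\<^bsub>additive_group\<^esub> n') = F (pt w m) n \<otimes>\<^bsub>K\<^esub> F (pt w m) n'" using w by (simp add: FD ptD)
  show "F (pt w (acA m s)) n = F (pt w m) (la s n)"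
    using FD(4)[of "pt w m" s n] tensor_act_pt[OF acA w] w by (simp add: ptD)
qed

abbreviation "coact_gen K F \<equiv> \<lambda>w a. ev K (\<lambda>a' h. F (pt w a') h) (\<rho>A a)"

lemma Bbalanced_coact:
  assumes F: "balanced UNIV G acG additive_group la K F"
  shows "Bbalanced K (coact_gen K F)"
proof (rule balancedI[OF tensorable_W balancedD(2)[OF F]])
  note FD = balancedD(3-)[OF F, simplified]
  note K = balancedD(2)[OF F]
  fix w w' a a' b assume w: "w \<in> carrier W"
  show "coact_gen K F w a \<in> carrier K"
    by (rule ev_closed[OF tensorable_AA K \<rho>A_closed]) (simp add: FD ptD w)
  show "coact_gen K F w (a \<otimes>\<^bsub>additive_group\<^esub> a') = coact_gen K F w a \<otimes>\<^bsub>K\<^esub> coact_gen K F w a'"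
    using hom_mult[OF \<rho>A_hom, of a a'] hom_mult[OF ev_hom[OF balanced_AA[OF F w]] \<rho>A_closed \<rho>A_closed] by (simp add: AA)
  show "coact_gen K F (act W w b) a = coact_gen K F w (b * a)" if b: "b \<in> B"
  proof -
    have "coact_gen K F w (b * a) = ev K (\<lambda>a' h. F (pt w (b * a')) (id h)) (\<rho>A a)"
      unfolding \<rho>A_B[OF b]
      by (rule tensor_map2_ev(3)[OF tensorable_AA \<rho>A_closed tensorable_AA _ _ balanced_AA[OF F w]]) (simp_all add: AA)
    then show ?thesis using w b by (simp add: ptD)
  qed
  show "coact_gen K F (w \<otimes>\<^bsub>W\<^esub> w') a = coact_gen K F w a \<otimes>\<^bsub>K\<^esub> coact_gen K F w' a" if w': "w' \<in> carrier W"
  proof -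
    have "ev K (\<lambda>x h. F (pt (w \<otimes>\<^bsub>W\<^esub> w') x) h) (\<rho>A a) = ev K (\<lambda>x h. F (pt w x) h \<otimes>\<^bsub>K\<^esub> F (pt w' x) h) (\<rho>A a)"
      using w w' by (intro ev_cong[OF tensorable_AA K \<rho>A_closed]) (simp_all add: FD ptD comm_group_m_closed[OF comm_group_W] comm_group_m_closed[OF K])
    also have "\<dots> = coact_gen K F w a \<otimes>\<^bsub>K\<^esub> coact_gen K F w' a"
      by (rule ev_mult_fun[OF tensorable_AA K \<rho>A_closed]) (simp_all add: FD ptD w w')
    finally show ?thesis .
  qed
qed

lemma coact_lift:
  assumes u: "u \<in> carrier G"
  shows "coact u = lift TG (coact_gen TG (pure_tensor TG)) u"
proof -
  let ?\<iota> = "\<lambda>p r. (pt (fst p) (fst r), snd r)"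
  have eq: "coact u = tensor_map TG (\<lambda>p. frag_extend (\<lambda>r. frag_of (?\<iota> p r)) (tensor_rep (\<rho>A (snd p)))) (dec u)"
    unfolding tensor_coact_def Let_def TG_eq pt_def by (simp add: case_prod_unfold)
  have \<iota>: "\<forall>p\<in>carrier W \<times> carrier additive_group. \<forall>r\<in>carrier AA \<times> carrier additive_group. ?\<iota> p r \<in> carrier G \<times> carrier additive_group"
    by (auto simp: ptD)
  note flat = tensor_map_flatten[where \<iota> = ?\<iota> and D = "\<lambda>p. \<rho>A (snd p)", OF presentation_tensor[OF tensorable_W] dec_closed[OF u, unfolded tensor_over_def]
      presentation_tensor[OF tensorable_AA] ballI[OF \<rho>A_closed] presentation_tensor[OF tensorable_G] \<iota>, folded tensor_over_def, folded eq]
  have "coact u = ev TG (pure_tensor TG) (coact u)"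
    by (rule ev_self[OF tensorable_G flat(1), symmetric])
  also have "\<dots> = lift TG (coact_gen TG (pure_tensor TG)) u"
    using flat(2)[OF balanced_kills_rel[OF balanced_pure_tensor[OF tensorable_G]]] by (simp add: lift_def case_prod_unfold)
  finally show ?thesis .
qed

lemma coact_hom: "coact \<in> hom G TG"
  by (rule hom_cong[OF lift_hom[OF Bbalanced_coact[OF balanced_pure_tensor[OF tensorable_G]]] coact_lift group_G])

lemma coact_closed: "u \<in> carrier G \<Longrightarrow> coact u \<in> carrier TG"
  by (rule hom_closedD[OF coact_hom])

lemma coact_pt: "w \<in> carrier W \<Longrightarrow> coact (pt w a) = coact_gen TG (pure_tensor TG) w a"
  using lift_pt[OF Bbalanced_coact[OF balanced_pure_tensor[OF tensorable_G]], of w a] coact_lift[of "pt w a"]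
  by (simp add: ptD)

lemma ev_coact_pt:
  assumes F: "balanced UNIV G acG additive_group la K F" and w: "w \<in> carrier W"
  shows "ev K F (coact (pt w a)) = coact_gen K F w a"
  unfolding coact_pt[OF w]
  using hom_ev[OF tensorable_AA comm_group_TG balancedD(2)[OF F] \<rho>A_closed ev_hom[OF F], of "\<lambda>a' h. pure_tensor TG (pt w a') h"]
  by (simp add: pureG ptD w ev_pure[OF F])

lemma tensor_map2_hom:
  assumes g: "\<And>x y. g (x + y) = g x + g y" "\<And>r x. g (la r x) = la r (g x)"
  shows "tensor_map2 TG id g \<in> hom TG TG" "balanced UNIV G acG additive_group la TG (\<lambda>u h. pure_tensor TG u (g h))"
proof -
  show b: "balanced UNIV G acG additive_group la TG (\<lambda>u h. pure_tensor TG u (g h))"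
    by (rule balancedI[OF tensorable_G comm_group_TG]) (simp_all add: pureG g)
  show "tensor_map2 TG id g \<in> hom TG TG"
    by (rule hom_cong[OF ev_hom[OF b]])
       (use tensor_map2_ev(2)[OF tensorable_G _ tensorable_G, of _ id g] comm_group_TG in \<open>simp_all add: comm_group_def\<close>)
qed

lemma coact_linear:
  assumes f: "B_linear f" and g: "\<And>x y. g (x + y) = g x + g y" "\<And>r x. g (la r x) = la r (g x)"
    and fg: "\<And>a. \<rho>A (f a) = tensor_map2 TA id g (\<rho>A a)" and u: "u \<in> carrier G"
  shows "coact (tensor_act code B W f u) = tensor_map2 TG id g (coact u)"
proof (rule G_ext[OF comm_group_TG hom_comp[OF tensor_act_hom[OF f] coact_hom] hom_comp[OF coact_hom tensor_map2_hom(1)[OF g]] _ u])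
  fix w a assume w: "w \<in> carrier W"
  have "coact (tensor_act code B W f (pt w a)) = ev TG (\<lambda>a' h. pure_tensor TG (pt w a') h) (tensor_map2 TA id g (\<rho>A a))"
    using w by (simp add: tensor_act_pt f coact_pt fg)
  also have "\<dots> = ev TG (\<lambda>a' h. pure_tensor TG (pt w (id a')) (g h)) (\<rho>A a)"
    by (rule tensor_map2_ev(3)[OF tensorable_AA \<rho>A_closed tensorable_AA _ _ balanced_AA[OF balanced_pure_tensor[OF tensorable_G] w]])
       (simp_all add: AA)
  also have "\<dots> = ev TG (\<lambda>u h. pure_tensor TG u (g h)) (coact (pt w a))"
    by (simp add: ev_coact_pt[OF tensor_map2_hom(2)[OF g] w])
  also have "\<dots> = tensor_map2 TG id g (coact (pt w a))"
    using tensor_map2_ev(2)[OF tensorable_G coact_closed[OF ptD(1)[OF w]] tensorable_G, of id g a] by simp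
  finally show "coact (tensor_act code B W f (pt w a)) = tensor_map2 TG id g (coact (pt w a))" .
qed

text \<open>
  Pure tensors generate. The action of the functor on morphisms and the counit of the equivalence are
  compatible with both coactions by this criterion.
\<close>

lemma coact_morphism:
  assumes t: "tensorable UNIV N acN additive_group la" "\<rho>N \<in> hom N (tensor UNIV N acN additive_group la)"
    and \<phi>: "\<phi> \<in> hom G N" "\<And>v r. v \<in> carrier G \<Longrightarrow> \<phi> (acG v r) = acN (\<phi> v) r"
    and pt: "\<And>w a. w \<in> carrier W \<Longrightarrow> \<rho>N (\<phi> (pt w a)) =
      ev (tensor UNIV N acN additive_group la) (\<lambda>a' h. pure_tensor (tensor UNIV N acN additive_group la) (\<phi> (pt w a')) h) (\<rho>A a)"
    and u: "u \<in> carrier G"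
  shows "\<rho>N (\<phi> u) = tensor_map2 (tensor UNIV N acN additive_group la) \<phi> id (coact u)"
proof -
  let ?T = "tensor UNIV N acN additive_group la"
  note p = balancedD(3-)[OF balanced_pure_tensor[OF t(1)], simplified]
  have b: "balanced UNIV G acG additive_group la ?T (\<lambda>v h. pure_tensor ?T (\<phi> v) h)"
    by (rule balancedI[OF tensorable_G comm_group_tensor[OF t(1)]])
       (simp_all add: p \<phi>(2) hom_closedD[OF \<phi>(1)] hom_mult[OF \<phi>(1)])
  have "\<rho>N (\<phi> u) = ev ?T (\<lambda>v h. pure_tensor ?T (\<phi> v) h) (coact u)"
    by (rule G_ext[OF comm_group_tensor[OF t(1)] hom_comp[OF \<phi>(1) t(2)] hom_comp[OF coact_hom ev_hom[OF b]] _ u])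
       (simp add: pt ev_coact_pt[OF b])
  then show ?thesis
    using tensor_map2_ev(2)[OF tensorable_G coact_closed[OF u] t(1) hom_closedD[OF \<phi>(1)], of id] by simp
qed

lemma coact_actA:
  fixes f :: "'a \<Rightarrow> 'u \<Rightarrow> 'u"
  assumes f: "\<And>c. f c = tensor_act code B W (\<lambda>a. a * c)" "\<And>c. B_linear (\<lambda>a. a * c)"
    and b: "balanced UNIV G acG additive_group la TG (\<lambda>v h. ev TG (\<lambda>c k. pure_tensor TG (f c v) (h * k)) (\<rho>A x))"
    and \<rho>A_mult: "\<And>a. \<rho>A (a * x) = tensor_mult TA (*) (\<rho>A a) (\<rho>A x)"
    and u: "u \<in> carrier G"
  shows "coact (f x u) = tensor_mult TG (\<lambda>v c. f c v) (coact u) (\<rho>A x)"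
proof -
  have fG: "f c \<in> hom G G" and f_pt: "w \<in> carrier W \<Longrightarrow> f c (pt w a) = pt w (a * c)" for c w a
    using tensor_act_hom[OF f(2)] tensor_act_pt[OF f(2)] by (simp_all add: f(1))
  have "coact (f x u) = ev TG (\<lambda>v h. ev TG (\<lambda>c k. pure_tensor TG (f c v) (h * k)) (\<rho>A x)) (coact u)"
  proof (rule G_ext[OF comm_group_TG hom_comp[OF fG coact_hom] hom_comp[OF coact_hom ev_hom[OF b]] _ u])
    fix w a assume w: "w \<in> carrier W"
    have "coact (f x (pt w a)) = ev TG (\<lambda>a' h. pure_tensor TG (pt w a') h) (tensor_mult TA (*) (\<rho>A a) (\<rho>A x))"
      by (simp add: f_pt[OF w] coact_pt[OF w] \<rho>A_mult)
    also have "\<dots> = ev TG (\<lambda>a' h. ev TG (\<lambda>c k. pure_tensor TG (pt w (a' * c)) (h * k)) (\<rho>A x)) (\<rho>A a)"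
      by (rule tensor_mult_ev(3)[OF tensorable_AA \<rho>A_closed tensorable_AA \<rho>A_closed tensorable_AA _
            balanced_AA[OF balanced_pure_tensor[OF tensorable_G] w]]) (simp add: AA)
    also have "\<dots> = ev TG (\<lambda>v h. ev TG (\<lambda>c k. pure_tensor TG (f c v) (h * k)) (\<rho>A x)) (coact (pt w a))"
      unfolding ev_coact_pt[OF b w] f_pt[OF w] ..
    finally show "coact (f x (pt w a)) = ev TG (\<lambda>v h. ev TG (\<lambda>c k. pure_tensor TG (f c v) (h * k)) (\<rho>A x)) (coact (pt w a))" .
  qed
  also have "\<dots> = tensor_mult TG (\<lambda>v c. f c v) (coact u) (\<rho>A x)"
    by (rule tensor_mult_ev(2)[OF tensorable_G coact_closed[OF u] tensorable_AA \<rho>A_closed tensorable_G, symmetric])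
       (rule hom_closedD[OF fG])
  finally show ?thesis .
qed

lemma coact_counit:
  assumes eps: "\<And>x y. \<epsilon> (x + y) = \<epsilon> x + \<epsilon> y" "\<And>r x. \<epsilon> (la r x) = r * \<epsilon> x"
    and acA': "\<And>a r r'. acA a (r + r') = acA a r + acA a r'" "\<And>a r r'. acA a (r * r') = acA (acA a r) r'"
    and counit: "\<And>a. ev AA (\<lambda>a' h. acA a' (\<epsilon> h)) (\<rho>A a) = a" and u: "u \<in> carrier G"
  shows "ev G (\<lambda>u h. acG u (\<epsilon> h)) (coact u) = u"
proof -
  have 1: "acG u (r + r') = acG u r \<otimes>\<^bsub>G\<^esub> acG u r'" "acG u (r * r') = acG (acG u r) r'" if "u \<in> carrier G" for u r r'
  proof -
    have "(\<lambda>a. acA a (r + r')) = (\<lambda>a. acA a r + acA a r')" "(\<lambda>a. acA a (r * r')) = (\<lambda>a. acA (acA a r) r')"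
      by (simp_all add: acA')
    then show "acG u (r + r') = acG u r \<otimes>\<^bsub>G\<^esub> acG u r'" "acG u (r * r') = acG (acG u r) r'"
      using tensor_act_add[OF acA acA _ that, of r r'] tensor_act_comp[OF acA acA _ that, of r r'] acA[of "r + r'"] acA[of "r * r'"]
      by simp_all
  qed
  have b: "balanced UNIV G acG additive_group la G (\<lambda>u h. acG u (\<epsilon> h))"
    by (rule balancedI[OF tensorable_G comm_group_G])
       (simp_all add: eps 1 tensor_act_closed[OF acA] hom_mult[OF tensor_act_hom[OF acA]])
  show ?thesis
  proof (rule G_ext[OF comm_group_G hom_comp[OF coact_hom ev_hom[OF b]] _ _ u])
    show "(\<lambda>u. u) \<in> hom G G" by (rule homI) simp_all
    fix w a assume w: "w \<in> carrier W"
    have "ev G (\<lambda>u h. acG u (\<epsilon> h)) (coact (pt w a)) = ev G (\<lambda>a' h. pt w (acA a' (\<epsilon> h))) (\<rho>A a)"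
      by (simp add: ev_coact_pt[OF b w] tensor_act_pt[OF acA w])
    also have "\<dots> = pt w (ev AA (\<lambda>a' h. acA a' (\<epsilon> h)) (\<rho>A a))"
      by (rule hom_ev[OF tensorable_AA AA(1) comm_group_G \<rho>A_closed, symmetric]) (simp_all add: AA hom_def ptD w)
    finally show "ev G (\<lambda>u h. acG u (\<epsilon> h)) (coact (pt w a)) = pt w a" by (simp add: counit)
  qed
qed

end

text \<open>
  Coassociativity and both mixed coassociativity conditions pass from \<open>A\<close> to \<open>W \<otimes>\<^sub>B A\<close> for one
  and the same reason: both sides are additive, and on \<open>w \<otimes> a\<close> they are obtained from \<open>a\<close> by
  applying \<open>w \<otimes> -\<close> to the first tensor factor.
\<close>

lemma coact_split:
  fixes \<rho>A \<rho>A' :: "'a::{ring,monoid_mult} \<Rightarrow> ('a \<times> 'h::{ring,monoid_mult} \<Rightarrow>\<^sub>0 int) set"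
    and ra' :: "'h \<Rightarrow> 't::{ring,monoid_mult} \<Rightarrow> 'h" and la' :: "'t \<Rightarrow> 'h \<Rightarrow> 'h" and la :: "'b::{ring,monoid_mult} \<Rightarrow> 'h \<Rightarrow> 'h"
  assumes "coact_transport code B W G la AA acA \<rho>A" and "coact_transport code B W G la' AA acA' \<rho>A'"
  assumes ra': "\<And>x y t. ra' (x + y) t = ra' x t + ra' y t" "\<And>r x t. ra' (la r x) t = la r (ra' x t)"
    and \<rho>_ac': "\<And>a t. \<rho>A (acA' a t) = tensor_map2 (tensor UNIV AA acA additive_group la) id (\<lambda>h. ra' h t) (\<rho>A a)"
    and d: "d \<in> hom additive_group (tensor UNIV additive_group ra' additive_group la')"
    and d_la: "\<And>r x. d (la r x) = tensor_map2 (tensor UNIV additive_group ra' additive_group la') (la r) id (d x)"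
    and la_ra: "\<And>r x y. la r (x + y) = la r x + la r y"
    and eq: "\<And>a. split_left (tensor3 AA acA additive_group la ra' additive_group la') \<rho>A (\<rho>A' a) =
      split_right (tensor3 AA acA additive_group la ra' additive_group la') d (\<rho>A a)"
  defines "acG \<equiv> \<lambda>u r. tensor_act code B W (\<lambda>a. acA a r) u"
    and "acG' \<equiv> \<lambda>u r. tensor_act code B W (\<lambda>a. acA' a r) u"
  assumes u: "u \<in> carrier G"
  shows "split_left (tensor3 G acG additive_group la ra' additive_group la')
      (tensor_coact code B W (tensor UNIV (tensor_group code B W) acG additive_group la) \<rho>A)
      (tensor_coact code B W (tensor UNIV (tensor_group code B W) acG' additive_group la') \<rho>A' u) =
    split_right (tensor3 G acG additive_group la ra' additive_group la') d
      (tensor_coact code B W (tensor UNIV (tensor_group code B W) acG additive_group la) \<rho>A u)"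
proof -
  interpret X: coact_transport code B W G la AA acA \<rho>A by fact
  interpret Y: coact_transport code B W G la' AA acA' \<rho>A' by fact
  let ?H = "additive_group :: 'h monoid"
  let ?T = "tensor3 G X.acG ?H la ra' ?H la'"
  let ?p = "pure_tensor3 ?T"
  note K = comm_group_tensor3[OF X.tensorable_G tensorable_additive[of UNIV ra' la']]
  note p3 = balanced3D(4-)[OF balanced3_pure_tensor3[OF X.tensorable_G tensorable_additive[of UNIV ra' la']], simplified]
  have d_closed: "d x \<in> carrier (tensor UNIV additive_group ra' additive_group la')" for x
    using hom_closedD[OF d] by simp
  have L: "split_left ?T X.coact (Y.coact u) = ev ?T (\<lambda>q h. ev ?T (\<lambda>m n. ?p m n h) (X.coact q)) (Y.coact u)" if "u \<in> carrier G" for u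
    by (rule split_left_ev(2)[OF Y.tensorable_G Y.coact_closed[OF that] X.tensorable_G X.coact_closed X.tensorable_G tensorable_additive])
  have R: "split_right ?T d (X.coact u) = ev ?T (\<lambda>m q. ev ?T (\<lambda>n h. ?p m n h) (d q)) (X.coact u)" if "u \<in> carrier G" for u
    by (rule split_right_ev(2)[OF X.tensorable_G X.coact_closed[OF that] tensorable_additive d_closed X.tensorable_G tensorable_additive])
  have b1: "balanced UNIV G X.acG ?H la ?T (\<lambda>m n. ?p m n h)" for h
    by (rule balancedI[OF X.tensorable_G K]) (simp_all add: p3)
  \<comment> \<open>Both sides are additive in \<open>u\<close>, being sums of these balanced maps over the coactions.\<close>
  have bL: "balanced UNIV G Y.acG ?H la' ?T (\<lambda>q h. ev ?T (\<lambda>m n. ?p m n h) (X.coact q))"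
  proof (rule balancedI[OF Y.tensorable_G K])
    fix q q' h h' t assume q: "q \<in> carrier G" "q' \<in> carrier G"
    show "ev ?T (\<lambda>m n. ?p m n h) (X.coact q) \<in> carrier ?T"
      by (rule ev_closed[OF X.tensorable_G K X.coact_closed[OF q(1)]]) (simp add: p3)
    show "ev ?T (\<lambda>m n. ?p m n h) (X.coact (q \<otimes>\<^bsub>G\<^esub> q')) =
      ev ?T (\<lambda>m n. ?p m n h) (X.coact q) \<otimes>\<^bsub>?T\<^esub> ev ?T (\<lambda>m n. ?p m n h) (X.coact q')"
      using hom_mult[OF X.coact_hom q] hom_mult[OF ev_hom[OF b1] X.coact_closed X.coact_closed] q by simp
    have "ev ?T (\<lambda>m n. ?p m n (h \<otimes>\<^bsub>?H\<^esub> h')) (X.coact q) = ev ?T (\<lambda>m n. ?p m n h \<otimes>\<^bsub>?T\<^esub> ?p m n h') (X.coact q)"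
      by (rule ev_cong[OF X.tensorable_G K X.coact_closed[OF q(1)]]) (simp_all add: p3 comm_group_m_closed[OF K])
    also have "\<dots> = ev ?T (\<lambda>m n. ?p m n h) (X.coact q) \<otimes>\<^bsub>?T\<^esub> ev ?T (\<lambda>m n. ?p m n h') (X.coact q)"
      by (rule ev_mult_fun[OF X.tensorable_G K X.coact_closed[OF q(1)]]) (simp_all add: p3)
    finally show "ev ?T (\<lambda>m n. ?p m n (h \<otimes>\<^bsub>?H\<^esub> h')) (X.coact q) =
      ev ?T (\<lambda>m n. ?p m n h) (X.coact q) \<otimes>\<^bsub>?T\<^esub> ev ?T (\<lambda>m n. ?p m n h') (X.coact q)" .
    have "ev ?T (\<lambda>m n. ?p m n h) (X.coact (Y.acG q t)) = ev ?T (\<lambda>m n. ?p m n h) (tensor_map2 X.TG id (\<lambda>h. ra' h t) (X.coact q))"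
      by (simp add: X.coact_linear[OF Y.acA ra' \<rho>_ac' q(1)])
    also have "\<dots> = ev ?T (\<lambda>m n. ?p (id m) (ra' n t) h) (X.coact q)"
      by (rule tensor_map2_ev(3)[OF X.tensorable_G X.coact_closed[OF q(1)] X.tensorable_G _ _ b1]) simp_all
    also have "\<dots> = ev ?T (\<lambda>m n. ?p m n (la' t h)) (X.coact q)"
      by (rule ev_cong[OF X.tensorable_G K X.coact_closed[OF q(1)]]) (simp_all add: p3)
    finally show "ev ?T (\<lambda>m n. ?p m n h) (X.coact (Y.acG q t)) = ev ?T (\<lambda>m n. ?p m n (la' t h)) (X.coact q)" .
  qed
  have b2: "balanced UNIV ?H ra' ?H la' ?T (\<lambda>n h. ?p m n h)" if "m \<in> carrier G" for m
    by (rule balanced_additiveI[OF K]) (use that in \<open>simp_all add: p3\<close>)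
  have bR: "balanced UNIV G X.acG ?H la ?T (\<lambda>m q. ev ?T (\<lambda>n h. ?p m n h) (d q))"
  proof (rule balancedI[OF X.tensorable_G K])
    fix m m' q q' r assume m: "m \<in> carrier G" "m' \<in> carrier G"
    show "ev ?T (\<lambda>n h. ?p m n h) (d q) \<in> carrier ?T"
      by (rule ev_closed[OF tensorable_additive K d_closed]) (simp add: p3 m)
    have "ev ?T (\<lambda>n h. ?p (m \<otimes>\<^bsub>G\<^esub> m') n h) (d q) = ev ?T (\<lambda>n h. ?p m n h \<otimes>\<^bsub>?T\<^esub> ?p m' n h) (d q)"
      by (rule ev_cong[OF tensorable_additive K d_closed])
         (use m in \<open>simp_all add: p3 comm_group_m_closed[OF X.comm_group_G] comm_group_m_closed[OF K]\<close>)
    also have "\<dots> = ev ?T (\<lambda>n h. ?p m n h) (d q) \<otimes>\<^bsub>?T\<^esub> ev ?T (\<lambda>n h. ?p m' n h) (d q)"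
      by (rule ev_mult_fun[OF tensorable_additive K d_closed]) (simp_all add: p3 m)
    finally show "ev ?T (\<lambda>n h. ?p (m \<otimes>\<^bsub>G\<^esub> m') n h) (d q) = ev ?T (\<lambda>n h. ?p m n h) (d q) \<otimes>\<^bsub>?T\<^esub> ev ?T (\<lambda>n h. ?p m' n h) (d q)" .
    show "ev ?T (\<lambda>n h. ?p m n h) (d (q \<otimes>\<^bsub>?H\<^esub> q')) = ev ?T (\<lambda>n h. ?p m n h) (d q) \<otimes>\<^bsub>?T\<^esub> ev ?T (\<lambda>n h. ?p m n h) (d q')"
      using hom_mult[OF d, of q q'] hom_mult[OF ev_hom[OF b2[OF m(1)]] d_closed d_closed] by simp
    have "ev ?T (\<lambda>n h. ?p m n h) (d (la r q)) = ev ?T (\<lambda>n h. ?p m (la r n) (id h)) (d q)"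
      unfolding d_la by (rule tensor_map2_ev(3)[OF tensorable_additive d_closed tensorable_additive _ _ b2[OF m(1)]]) simp_all
    also have "\<dots> = ev ?T (\<lambda>n h. ?p (X.acG m r) n h) (d q)"
      by (rule ev_cong[OF tensorable_additive K d_closed]) (simp_all add: p3 m)
    finally show "ev ?T (\<lambda>n h. ?p (X.acG m r) n h) (d q) = ev ?T (\<lambda>n h. ?p m n h) (d (la r q))" by simp
  qed
  have bT: "balanced3 AA acA ?H la ra' ?H la' ?T (\<lambda>x y z. ?p (X.pt w x) y z)" if w: "w \<in> carrier W" for w
    by (rule balanced3I[OF X.tensorable_AA tensorable_additive K])
       (use w in \<open>simp_all add: p3 X.ptD X.AA flip: X.tensor_act_pt[OF X.acA]\<close>)
  have "split_left ?T X.coact (Y.coact u) = split_right ?T d (X.coact u)"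
    unfolding L[OF u] R[OF u]
  proof (rule X.G_ext[OF K hom_comp[OF Y.coact_hom ev_hom[OF bL]] hom_comp[OF X.coact_hom ev_hom[OF bR]] _ u])
    fix w a assume w: "w \<in> carrier W"
    have "ev ?T (\<lambda>q h. ev ?T (\<lambda>m n. ?p m n h) (X.coact q)) (Y.coact (X.pt w a)) =
      ev ?T (\<lambda>a' h. ev ?T (\<lambda>m n. ?p m n h) (X.coact (X.pt w a'))) (\<rho>A' a)"
      by (rule Y.ev_coact_pt[OF bL w])
    also have "\<dots> = ev ?T (\<lambda>a' h. ev ?T (\<lambda>m n. ?p (X.pt w m) n h) (\<rho>A a')) (\<rho>A' a)"
      by (simp add: X.ev_coact_pt[OF b1 w])
    also have "\<dots> = ev ?T (\<lambda>m q. ev ?T (\<lambda>n h. ?p (X.pt w m) n h) (d q)) (\<rho>A a)"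
      by (rule split_eqD[OF eq Y.tensorable_AA Y.\<rho>A_closed X.tensorable_AA X.\<rho>A_closed X.tensorable_AA X.\<rho>A_closed
            tensorable_additive d_closed bT[OF w]])
    also have "\<dots> = ev ?T (\<lambda>m q. ev ?T (\<lambda>n h. ?p m n h) (d q)) (X.coact (X.pt w a))"
      by (rule X.ev_coact_pt[OF bR w, symmetric])
    finally show "ev ?T (\<lambda>q h. ev ?T (\<lambda>m n. ?p m n h) (X.coact q)) (Y.coact (X.pt w a)) =
      ev ?T (\<lambda>m q. ev ?T (\<lambda>n h. ?p m n h) (d q)) (X.coact (X.pt w a))" .
  qed
  then show ?thesis by (simp add: acG_def acG'_def)
qed

section \<open>\<open>W \<otimes>\<^sub>B A\<close> is a relative Hopf module\<close>

context is_comod_algebra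
begin

lemma coinvariants_iff: "b \<in> coinvariants \<H> A \<longleftrightarrow> rhoR A b = pure_tensor right.T b 1"
  by (simp add: coinvariants_def rb_tensor_def)

text \<open>
  Left \<open>B\<close>-linearity of the coactions, without which they would not descend to \<open>W \<otimes>\<^sub>B A\<close>. For the
  \<open>L\<close>-coaction it rests on the elements of \<open>B\<close> being coinvariant for that coaction as well.
\<close>

lemma coact_coinvariant_mult:
  assumes b: "b \<in> coinvariants \<H> A"
  shows "rhoR A (b * a) = tensor_map2 right.T (\<lambda>a. b * a) id (rhoR A a)"
    and "rhoL A (b * a) = tensor_map2 left.T (\<lambda>a. b * a) id (rhoL A a)"
proof -
  interpret reg: relative_hopf_module \<H> A "alg_comod A" "(*)" by (rule regular_relative_hopf_module)
  have b': "coinvariant b" using b by (simp add: coinvariants_iff)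
  show "rhoR A (b * a) = tensor_map2 right.T (\<lambda>a. b * a) id (rhoR A a)"
    using reg.ev_coactR_coinvariant_da[OF balanced_pure_tensor[OF right.tensorable_M] b', of a]
      right.ev_rho_self[of "b * a"] tensor_map2_ev(2)[OF right.tensorable_M right.rho_closed[of a] right.tensorable_M, of "\<lambda>a. b * a" id]
    by simp
  show "rhoL A (b * a) = tensor_map2 left.T (\<lambda>a. b * a) id (rhoL A a)"
    using reg.ev_coactL_coinvariant_da[OF balanced_pure_tensor[OF left.tensorable_M] b', of a]
      left.ev_rho_self[of "b * a"] tensor_map2_ev(2)[OF left.tensorable_M left.rho_closed[of a] left.tensorable_M, of "\<lambda>a. b * a" id]
    by simp
qed

text \<open>
  The right \<open>L\<close>-action on \<open>A\<close> is left multiplication by elements of \<open>\<eta>\<^sub>R(R)\<close>; that it descends to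
  \<open>W \<otimes>\<^sub>B A\<close> means that these commute with \<open>B\<close>.
\<close>

lemma coinvariant_commutes_etaR:
  assumes b: "b \<in> coinvariants \<H> A"
  shows "etaR A r * b = b * etaR A r"
proof -
  have eps_la: "\<epsilon>\<^sub>R (s\<^sub>R r * laR s x) = s * \<epsilon>\<^sub>R (s\<^sub>R r * x)" for s x
    using right.eps_la[of s "s\<^sub>R r * x"] by (simp add: rb_la_def mult.assoc)
  have bal: "balanced UNIV (alg_comod A) (\<lambda>a r. a * etaR A r) additive_group laR additive_group (\<lambda>a' h. a' * etaR A (\<epsilon>\<^sub>R (s\<^sub>R r * h)))"
    by (rule balancedI)
       (use right.tensorable_M in \<open>simp_all add: distrib_left distrib_right right.\<epsilon>_add etaR_simps eps_la mult.assoc\<close>)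
  have "etaR A r * b = b * etaR A (\<epsilon>\<^sub>R (s\<^sub>R r * 1))"
    unfolding left_action using ev_pure[OF bal, of b 1] b by (simp add: coinvariants_iff)
  then show ?thesis using right.cou_one[of r] by simp
qed

end

lemma tensor_obj_simps [simp]:
  "carrier (tensor_obj \<H> A B code W) = carrier (tensor_group code B W)"
  "monoid.mult (tensor_obj \<H> A B code W) = monoid.mult (tensor_group code B W)"
  "one (tensor_obj \<H> A B code W) = one (tensor_group code B W)"
  "actR (tensor_obj \<H> A B code W) = (\<lambda>u r. tensor_act code B W (\<lambda>a. a * etaR A r) u)"
  "actL (tensor_obj \<H> A B code W) = (\<lambda>u l. tensor_act code B W (\<lambda>a. actLA A a l) u)"
  "actA (tensor_obj \<H> A B code W) = (\<lambda>u a'. tensor_act code B W (\<lambda>a. a * a') u)"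
  "coactR (tensor_obj \<H> A B code W) = tensor_coact code B W
     (tensor UNIV (tensor_group code B W) (\<lambda>u r. tensor_act code B W (\<lambda>a. a * etaR A r) u) additive_group (rb_la (rb \<H>))) (rhoR A)"
  "coactL (tensor_obj \<H> A B code W) = tensor_coact code B W
     (tensor UNIV (tensor_group code B W) (\<lambda>u l. tensor_act code B W (\<lambda>a. actLA A a l) u) additive_group (lb_la (lb \<H>))) (rhoL A)"
  by (simp_all add: tensor_obj_def Let_def rb_tensor_def lb_tensor_def)

locale extension_module = is_comod_algebra \<H> A
  for \<H> :: "('k::{comm_ring,comm_monoid_mult}, 'l::{ring,monoid_mult}, 'r::{ring,monoid_mult},
             'h::{ring,monoid_mult}) hopf_algebroid"
    and A :: "('k, 'l, 'r, 'h, 'a::{ring,monoid_mult}) comod_algebra" +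
  fixes B :: "'a set" and code :: "('u \<times> 'a \<Rightarrow>\<^sub>0 int) \<Rightarrow> 'u" and W :: "('u, 'a) rmod"
  assumes B_coinvariants: "B = coinvariants \<H> A" and inj_code: "inj code" and W_module: "right_module B W (act W)"
begin

abbreviation "G \<equiv> tensor_obj \<H> A B code W"

sublocale tt: tensor_transport code B W G
  by (rule tensor_transport.intro) (simp_all add: inj_code W_module)

lemma B_linear_mult: "tt.B_linear (\<lambda>a. a * x)"
  by (simp add: tt.B_linear_def distrib_right mult.assoc)

lemma B_linear_actLA: "tt.B_linear (\<lambda>a. actLA A a l)"
proof -
  have "etaR A r * (b * x) = b * (etaR A r * x)" if "b \<in> B" for b r x
    using coinvariant_commutes_etaR[of b r] that by (simp add: B_coinvariants flip: mult.assoc)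
  then show ?thesis by (simp add: tt.B_linear_def actLA_eq distrib_left)
qed

sublocale R: coact_transport code B W G laR "alg_comod A" "\<lambda>a r. a * etaR A r" "rhoR A"
proof (rule coact_transport.intro[OF tt.tensor_transport_axioms], rule coact_transport_axioms.intro)
  show "tt.B_linear (\<lambda>a. a * etaR A r)" for r by (rule B_linear_mult)
  show "rhoR A \<in> hom (alg_comod A) (tensor UNIV (alg_comod A) (\<lambda>a r. a * etaR A r) additive_group laR)"
    using right.\<rho>_hom by simp
  show "rhoR A (b * a) = tensor_map2 (tensor UNIV (alg_comod A) (\<lambda>a r. a * etaR A r) additive_group laR) (\<lambda>a. b * a) id (rhoR A a)"
    if "b \<in> B" for b a
    using coact_coinvariant_mult(1)[of b a] that by (simp add: B_coinvariants)
qed (simp_all add: comm_group_alg)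

sublocale L: coact_transport code B W G laL "alg_comod A" "actLA A" "rhoL A"
proof (rule coact_transport.intro[OF tt.tensor_transport_axioms], rule coact_transport_axioms.intro)
  show "tt.B_linear (\<lambda>a. actLA A a l)" for l by (rule B_linear_actLA)
  show "rhoL A \<in> hom (alg_comod A) (tensor UNIV (alg_comod A) (actLA A) additive_group laL)"
    using left.\<rho>_hom by simp
  show "rhoL A (b * a) = tensor_map2 (tensor UNIV (alg_comod A) (actLA A) additive_group laL) (\<lambda>a. b * a) id (rhoL A a)"
    if "b \<in> B" for b a
    using coact_coinvariant_mult(2)[of b a] that by (simp add: B_coinvariants)
qed (simp_all add: comm_group_alg)

lemma actLA_simps: "actLA A a (l + l') = actLA A a l + actLA A a l'" "actLA A a (l * l') = actLA A (actLA A a l) l'" "actLA A a 1 = a"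
  using left.ac_add[of a l l'] left.ac_ac[of a l l'] left.ac_one[of a] by simp_all

text \<open>
  The form of left linearity that \<open>coact_split\<close> asks of a coproduct.
\<close>

lemma Delta_la:
  "\<Delta>\<^sub>R (laR r x) = tensor_map2 (tensor UNIV additive_group raR additive_group laR) (laR r) id (\<Delta>\<^sub>R x)"
  "\<Delta>\<^sub>L (laL l x) = tensor_map2 (tensor UNIV additive_group raL additive_group laL) (laL l) id (\<Delta>\<^sub>L x)"
  "\<Delta>\<^sub>L (laR r x) = tensor_map2 (tensor UNIV additive_group raL additive_group laL) (laR r) id (\<Delta>\<^sub>L x)"
  "\<Delta>\<^sub>R (laL l x) = tensor_map2 (tensor UNIV additive_group raR additive_group laR) (laL l) id (\<Delta>\<^sub>R x)"
proof -
  let ?TR = "tensor UNIV additive_group raR additive_group laR" and ?TL = "tensor UNIV additive_group raL additive_group laL"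
  have R: "\<Delta>\<^sub>R y = tensor_map2 ?TR f id (\<Delta>\<^sub>R x)"
    if "ev ?TR (pure_tensor ?TR) (\<Delta>\<^sub>R y) = ev ?TR (\<lambda>x y. pure_tensor ?TR (f x) y) (\<Delta>\<^sub>R x)" for f x y
    using that right.reg.ev_rho_self[of y]
      tensor_map2_ev(2)[OF tensorable_additive right.reg.rho_closed[of x] tensorable_additive[of UNIV raR laR], of f id] by simp
  have L: "\<Delta>\<^sub>L y = tensor_map2 ?TL f id (\<Delta>\<^sub>L x)"
    if "ev ?TL (pure_tensor ?TL) (\<Delta>\<^sub>L y) = ev ?TL (\<lambda>x y. pure_tensor ?TL (f x) y) (\<Delta>\<^sub>L x)" for f x y
    using that left.reg.ev_rho_self[of y]
      tensor_map2_ev(2)[OF tensorable_additive left.reg.rho_closed[of x] tensorable_additive[of UNIV raL laL], of f id] by simp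
  show "\<Delta>\<^sub>R (laR r x) = tensor_map2 ?TR (laR r) id (\<Delta>\<^sub>R x)"
    by (rule R) (rule right.ev_Delta_la[OF balanced_pure_tensor[OF tensorable_additive]])
  show "\<Delta>\<^sub>L (laL l x) = tensor_map2 ?TL (laL l) id (\<Delta>\<^sub>L x)"
    by (rule L) (rule left.ev_Delta_la[OF balanced_pure_tensor[OF tensorable_additive]])
  show "\<Delta>\<^sub>L (laR r x) = tensor_map2 ?TL (laR r) id (\<Delta>\<^sub>L x)"
    by (rule L) (rule ev_DeltaL_laR[OF balanced_pure_tensor[OF tensorable_additive]])
  show "\<Delta>\<^sub>R (laL l x) = tensor_map2 ?TR (laL l) id (\<Delta>\<^sub>R x)"
    by (rule R) (rule ev_DeltaR_laL[OF balanced_pure_tensor[OF tensorable_additive]])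
qed

lemma la_ra_simps:
  "raR (x + y) r = raR x r + raR y r" "raL (x + y) l = raL x l + raL y l"
  "laR r (x + y) = laR r x + laR r y" "laL l (x + y) = laL l x + laL l y"
  "raR (laR r' x) r = laR r' (raR x r)" "raL (laL l' x) l = laL l' (raL x l)"
  "raL (laR r x) l = laR r (raL x l)" "raR (laL l x) r = laL l (raR x r)"
  using right.la_ra left.la_ra right.ra_add left.ra_add right.la_add left.la_add
  by (simp_all add: rb_ra_def rb_la_def lb_ra_def lb_la_def mult.assoc)

lemma right_comodule_G: "right_comodule laR raR \<Delta>\<^sub>R \<epsilon>\<^sub>R G (actR G) (coactR G)"
proof unfold_locales
  show "right_module UNIV G (actR G)"
    using tt.right_module_G[OF B_linear_mult, of "etaR A"]
    by (simp add: etaR_simps distrib_left mult.assoc)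
  show "coactR G \<in> hom G (tensor UNIV G (actR G) additive_group laR)"
    using R.coact_hom by simp
  fix u assume u: "u \<in> carrier G"
  show "coactR G (actR G u r) = tensor_map2 (tensor UNIV G (actR G) additive_group laR) id (\<lambda>x. raR x r) (coactR G u)" for r
    using R.coact_linear[OF B_linear_mult, of "\<lambda>x. raR x r" "etaR A r" u] right.\<rho>_linear[of _ r] u by (simp add: la_ra_simps)
  show "split_left (tensor3 G (actR G) additive_group laR raR additive_group laR) (coactR G) (coactR G u) =
      split_right (tensor3 G (actR G) additive_group laR raR additive_group laR) \<Delta>\<^sub>R (coactR G u)"
    using coact_split[OF R.coact_transport_axioms R.coact_transport_axioms, of raR \<Delta>\<^sub>R u]
      right.\<rho>_linear right.\<rho>_coassoc right.\<Delta>_hom Delta_la u by (simp add: la_ra_simps)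
  show "ev G (\<lambda>m' x. actR G m' (\<epsilon>\<^sub>R x)) (coactR G u) = u"
    using R.coact_counit[of \<epsilon>\<^sub>R u] right.\<rho>_counit u
    by (simp add: right.\<epsilon>_add right.eps_la etaR_simps distrib_left mult.assoc)
qed

lemma left_comodule_G: "right_comodule laL raL \<Delta>\<^sub>L \<epsilon>\<^sub>L G (actL G) (coactL G)"
proof unfold_locales
  show "right_module UNIV G (actL G)"
    using tt.right_module_G[of "\<lambda>l a. actLA A a l"] B_linear_actLA
    by (simp add: actLA_simps)
  show "coactL G \<in> hom G (tensor UNIV G (actL G) additive_group laL)"
    using L.coact_hom by simp
  fix u assume u: "u \<in> carrier G"
  show "coactL G (actL G u r) = tensor_map2 (tensor UNIV G (actL G) additive_group laL) id (\<lambda>x. raL x r) (coactL G u)" for r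
    using L.coact_linear[OF B_linear_actLA, of "\<lambda>x. raL x r" r u] left.\<rho>_linear[of _ r] u by (simp add: la_ra_simps)
  show "split_left (tensor3 G (actL G) additive_group laL raL additive_group laL) (coactL G) (coactL G u) =
      split_right (tensor3 G (actL G) additive_group laL raL additive_group laL) \<Delta>\<^sub>L (coactL G u)"
    using coact_split[OF L.coact_transport_axioms L.coact_transport_axioms, of raL \<Delta>\<^sub>L u]
      left.\<rho>_linear left.\<rho>_coassoc left.\<Delta>_hom Delta_la u by (simp add: la_ra_simps)
  show "ev G (\<lambda>m' x. actL G m' (\<epsilon>\<^sub>L x)) (coactL G u) = u"
    using L.coact_counit[of \<epsilon>\<^sub>L u] left.\<rho>_counit u
    by (simp add: left.\<epsilon>_add left.eps_la actLA_simps)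
qed

lemma comodule_G: "is_comodule \<H> G"
proof (rule is_comodule.intro[OF right_comodule_G left_comodule_G], rule is_comodule_axioms.intro)
  fix u c r l assume u: "u \<in> carrier G"
  have "(\<lambda>a. a * etaR A (scR \<H> c 1)) = (\<lambda>a. actLA A a (scL \<H> c 1))"
    using act_scale[of _ c] by simp
  then show "actR G u (scR \<H> c 1) = actL G u (scL \<H> c 1)" by simp
  show "coactR G (actL G u l) = tensor_map2 (rb_tensor (rb \<H>) G (actR G)) id (\<lambda>h. raL h l) (coactR G u)"
    using R.coact_linear[OF B_linear_actLA, of "\<lambda>x. raL x l" l u] coactR_L_linear[of _ l] u
    by (simp add: la_ra_simps rb_tensor_def)
  show "coactL G (actR G u r) = tensor_map2 (lb_tensor (lb \<H>) G (actL G)) id (\<lambda>h. raR h r) (coactL G u)"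
    using L.coact_linear[OF B_linear_mult, of "\<lambda>x. raR x r" "etaR A r" u] coactL_R_linear[of _ r] u
    by (simp add: la_ra_simps lb_tensor_def)
  show "split_right (tensor_RL \<H> G (actR G)) \<Delta>\<^sub>L (coactR G u) = split_left (tensor_RL \<H> G (actR G)) (coactR G) (coactL G u)"
    using coact_split[OF R.coact_transport_axioms L.coact_transport_axioms, of raL \<Delta>\<^sub>L u]
      coactR_L_linear mixed_coassoc_RL left.\<Delta>_hom Delta_la u
    by (simp add: la_ra_simps tensor_RL_def rb_tensor_def)
  show "split_right (tensor_LR \<H> G (actL G)) \<Delta>\<^sub>R (coactL G u) = split_left (tensor_LR \<H> G (actL G)) (coactL G) (coactR G u)"
    using coact_split[OF L.coact_transport_axioms R.coact_transport_axioms, of raR \<Delta>\<^sub>R u]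
      coactL_R_linear mixed_coassoc_LR right.\<Delta>_hom Delta_la u
    by (simp add: la_ra_simps tensor_LR_def lb_tensor_def)
qed

lemma tensor_act_actA_comp:
  "u \<in> carrier G \<Longrightarrow> actA G (actR G u r) a = actA G u (etaR A r * a)"
  "u \<in> carrier G \<Longrightarrow> actR G (actA G u a) r = actA G u (a * etaR A r)"
  "u \<in> carrier G \<Longrightarrow> actL G (actA G u a) l = actA G (actL G u l) a"
  using tt.tensor_act_comp[OF B_linear_mult B_linear_mult, of a "etaR A r" u]
    tt.tensor_act_comp[OF B_linear_mult B_linear_mult, of "etaR A r" a u]
    tt.tensor_act_comp[OF B_linear_actLA[of l] B_linear_mult[of a], of u]
    tt.tensor_act_comp[OF B_linear_mult[of a] B_linear_actLA[of l], of u]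
    B_linear_mult[of "etaR A r * a"] B_linear_mult[of "a * etaR A r"] B_linear_actLA[of l] B_linear_mult[of a]
  by (simp_all add: mult.assoc actLA_eq tt.B_linear_def)

lemma comodule_with_action_G: "comodule_with_action \<H> A G (actA G)"
proof (rule comodule_with_action.intro[OF is_comod_algebra_axioms comodule_G], rule comodule_with_action_axioms.intro)
  show "right_module UNIV G (actA G)"
    using tt.right_module_G[OF B_linear_mult, of "\<lambda>a. a"] by (simp add: distrib_left mult.assoc)
qed (fact tensor_act_actA_comp)+

lemma hopf_module_G: "is_hopf_module \<H> A G"
proof -
  interpret c: comodule_with_action \<H> A G "actA G" by (rule comodule_with_action_G)
  show ?thesis
  proof (rule is_hopf_module.intro[OF is_comod_algebra_axioms comodule_G], rule is_hopf_module_axioms.intro)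
    fix u a assume u: "u \<in> carrier G"
    show "coactR G (actA G u a) = tensor_mult (rb_tensor (rb \<H>) G (actR G)) (actA G) (coactR G u) (rhoR A a)"
      using R.coact_actA[OF refl B_linear_mult, of a u] c.Rbalanced_da[OF balanced_pure_tensor[OF c.M.right.tensorable_M], of a]
        rhoR_mult u by (simp add: rb_tensor_def)
    show "coactL G (actA G u a) = tensor_mult (lb_tensor (lb \<H>) G (actL G)) (actA G) (coactL G u) (rhoL A a)"
      using L.coact_actA[OF refl B_linear_mult, of a u] c.Lbalanced_da[OF balanced_pure_tensor[OF c.M.left.tensorable_M], of a]
        rhoL_mult u by (simp add: lb_tensor_def)
  qed (use c.da tensor_act_actA_comp in simp_all)
qed

end

section \<open>The categories\<close>

lemma tensor_map2_cong:
  assumes "tensorable Z M ra N la" "X \<in> carrier (tensor Z M ra N la)" "tensorable Z' M' ra' N la'"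
    and "\<And>m. m \<in> carrier M \<Longrightarrow> f m \<in> carrier M'" "\<And>m. m \<in> carrier M \<Longrightarrow> f' m = f m"
  shows "tensor_map2 (tensor Z' M' ra' N la') f' id X = tensor_map2 (tensor Z' M' ra' N la') f id X"
proof -
  let ?T = "tensor Z' M' ra' N la'"
  have "tensor_map2 ?T f id X = ev ?T (\<lambda>m n. pure_tensor ?T (f m) (id n)) X"
    by (rule tensor_map2_ev(2)[OF assms(1-3)]) (simp_all add: assms(4))
  moreover have "tensor_map2 ?T f' id X = ev ?T (\<lambda>m n. pure_tensor ?T (f' m) (id n)) X"
    by (rule tensor_map2_ev(2)[OF assms(1-3)]) (simp_all add: assms(4,5))
  moreover have "ev ?T (\<lambda>m n. pure_tensor ?T (f m) (id n)) X = ev ?T (\<lambda>m n. pure_tensor ?T (f' m) (id n)) X"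
    by (rule ev_cong[OF assms(1) comm_group_tensor[OF assms(3)] assms(2)])
       (simp_all add: assms(4,5) pure_tensor_closed[OF assms(3)])
  ultimately show ?thesis by simp
qed

lemma tensor_map2_ident:
  assumes "tensorable Z M ra N la" "X \<in> carrier (tensor Z M ra N la)" "\<And>m. m \<in> carrier M \<Longrightarrow> f m = m"
  shows "tensor_map2 (tensor Z M ra N la) f id X = X"
proof -
  have "tensor_map2 (tensor Z M ra N la) f id X = tensor_map2 (tensor Z M ra N la) id id X"
    by (rule tensor_map2_cong[OF assms(1,2,1)]) (simp_all add: assms(3))
  also have "\<dots> = X"
    using tensor_map2_ev(2)[OF assms(1,2,1), of id id] ev_self[OF assms(1,2)] by simp
  finally show ?thesis .
qed

lemma balanced_pure_hom:
  assumes M: "tensorable UNIV M ra N la" and P: "tensorable UNIV P ra' N la"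
    and f: "f \<in> hom M P" "\<And>m s. m \<in> carrier M \<Longrightarrow> f (ra m s) = ra' (f m) s"
  shows "balanced UNIV M ra N la (tensor UNIV P ra' N la) (\<lambda>m n. pure_tensor (tensor UNIV P ra' N la) (f m) n)"
proof -
  note pD = balancedD(3-)[OF balanced_pure_tensor[OF P]]
  show ?thesis
    by (rule balancedI[OF M comm_group_tensor[OF P]]) (simp_all add: pD hom_closedD[OF f(1)] hom_mult[OF f(1)] f(2))
qed

lemma tensor_map2_comp:
  assumes X: "tensorable Z M ra N la" "X \<in> carrier (tensor Z M ra N la)"
    and Q: "tensorable UNIV Q raQ N laQ" and P: "tensorable UNIV P raP N laQ"
    and f: "\<And>m. m \<in> carrier M \<Longrightarrow> f m \<in> carrier Q"
    and g: "g \<in> hom Q P" "\<And>m s. m \<in> carrier Q \<Longrightarrow> g (raQ m s) = raP (g m) s"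
  shows "tensor_map2 (tensor UNIV P raP N laQ) g id (tensor_map2 (tensor UNIV Q raQ N laQ) f id X) =
    tensor_map2 (tensor UNIV P raP N laQ) (\<lambda>m. g (f m)) id X"
proof -
  let ?T = "tensor UNIV P raP N laQ"
  have Y: "tensor_map2 (tensor UNIV Q raQ N laQ) f id X \<in> carrier (tensor UNIV Q raQ N laQ)"
    by (rule tensor_map2_ev(1)[OF X Q]) (simp_all add: f)
  have "balanced UNIV Q raQ N laQ ?T (\<lambda>m n. pure_tensor ?T (g m) n)"
    by (rule balanced_pure_hom[OF Q P g(1)]) (rule g(2))
  then have bal: "balanced UNIV Q raQ N laQ ?T (\<lambda>m n. pure_tensor ?T (g m) (id n))" by simp
  have "tensor_map2 ?T g id (tensor_map2 (tensor UNIV Q raQ N laQ) f id X) =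
    ev ?T (\<lambda>m n. pure_tensor ?T (g m) (id n)) (tensor_map2 (tensor UNIV Q raQ N laQ) f id X)"
    by (rule tensor_map2_ev(2)[OF Q Y P]) (simp_all add: hom_closedD[OF g(1)])
  also have "\<dots> = ev ?T (\<lambda>m n. pure_tensor ?T (g (f m)) (id (id n))) X"
    by (rule tensor_map2_ev(3)[OF X Q _ _ bal]) (simp_all add: f)
  also have "\<dots> = ev ?T (\<lambda>m n. pure_tensor ?T (g (f m)) (id n)) X" by simp
  also have "\<dots> = tensor_map2 ?T (\<lambda>m. g (f m)) id X"
    by (rule tensor_map2_ev(2)[OF X P, symmetric]) (simp_all add: f hom_closedD[OF g(1)])
  finally show ?thesis .
qed

lemma hom_inv_into:
  assumes "group M" "f \<in> hom M N" "bij_betw f (carrier M) (carrier N)"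
  shows "inv_into (carrier M) f \<in> hom N M"
  using assms group.iso_set_sym[of M f N] by (simp add: iso_def)

text \<open>
  A morphism of \<open>\<H>\<close>-comodules is a comodule map for each of its two coactions; both halves are treated alike.
\<close>

definition coaction_map where
  "coaction_map la M acM \<rho>M N acN \<rho>N f \<longleftrightarrow> f \<in> hom M N \<and> (\<forall>m\<in>carrier M. (\<forall>r. f (acM m r) = acN (f m) r) \<and>
     \<rho>N (f m) = tensor_map2 (tensor UNIV N acN additive_group la) f id (\<rho>M m))"

lemma coaction_mapD:
  assumes "coaction_map la M acM \<rho>M N acN \<rho>N f"
  shows "f \<in> hom M N" "m \<in> carrier M \<Longrightarrow> f (acM m r) = acN (f m) r"
    "m \<in> carrier M \<Longrightarrow> \<rho>N (f m) = tensor_map2 (tensor UNIV N acN additive_group la) f id (\<rho>M m)"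
  using assms by (simp_all add: coaction_map_def)

lemma comod_hom_iff:
  "f \<in> comod_hom \<H> M N \<longleftrightarrow>
     coaction_map (rb_la (rb \<H>)) M (actR M) (coactR M) N (actR N) (coactR N) f \<and>
     coaction_map (lb_la (lb \<H>)) M (actL M) (coactL M) N (actL N) (coactL N) f"
  by (auto simp: comod_hom_def coaction_map_def rb_tensor_def lb_tensor_def)

lemma comod_hom_hom: "f \<in> comod_hom \<H> M N \<Longrightarrow> f \<in> hom M N"
  by (simp add: comod_hom_def)

lemma coaction_map_cong:
  assumes M: "right_comodule la ra D e M acM \<rho>M" and N: "right_comodule la ra D e N acN \<rho>N"
    and f: "coaction_map la M acM \<rho>M N acN \<rho>N f" and eq: "\<And>m. m \<in> carrier M \<Longrightarrow> f' m = f m"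
  shows "coaction_map la M acM \<rho>M N acN \<rho>N f'"
proof -
  interpret M: right_comodule la ra D e M acM \<rho>M by fact
  interpret N: right_comodule la ra D e N acN \<rho>N by fact
  note fD = coaction_mapD[OF f]
  have "f' \<in> hom M N" using M.comm_group_M by (intro hom_cong[OF fD(1) eq]) (simp_all add: comm_group_def)
  moreover have "tensor_map2 N.T f' id (\<rho>M m) = tensor_map2 N.T f id (\<rho>M m)" if "m \<in> carrier M" for m
    by (rule tensor_map2_cong[OF M.tensorable_M M.rho_closed[OF that] N.tensorable_M hom_closedD[OF fD(1)] eq])
  ultimately show ?thesis using fD eq M.ac_closed by (simp add: coaction_map_def)
qed

lemma coaction_map_id:
  assumes M: "right_comodule la ra D e M acM \<rho>M"
  shows "coaction_map la M acM \<rho>M M acM \<rho>M (\<lambda>m. m)"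
proof -
  interpret M: right_comodule la ra D e M acM \<rho>M by fact
  show ?thesis
    using tensor_map2_ident[OF M.tensorable_M M.rho_closed, of _ "\<lambda>m. m"] by (simp add: coaction_map_def homI)
qed

lemma coaction_map_comp:
  assumes M: "right_comodule la ra D e M acM \<rho>M" and N: "right_comodule la ra D e N acN \<rho>N"
    and P: "right_comodule la ra D e P acP \<rho>P"
    and f: "coaction_map la M acM \<rho>M N acN \<rho>N f" and g: "coaction_map la N acN \<rho>N P acP \<rho>P g"
  shows "coaction_map la M acM \<rho>M P acP \<rho>P (\<lambda>m. g (f m))"
proof -
  interpret M: right_comodule la ra D e M acM \<rho>M by fact
  interpret N: right_comodule la ra D e N acN \<rho>N by fact
  interpret P: right_comodule la ra D e P acP \<rho>P by fact
  note fD = coaction_mapD[OF f] and gD = coaction_mapD[OF g]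
  have "tensor_map2 P.T g id (tensor_map2 N.T f id (\<rho>M m)) = tensor_map2 P.T (\<lambda>m. g (f m)) id (\<rho>M m)"
    if "m \<in> carrier M" for m
    by (rule tensor_map2_comp[OF M.tensorable_M M.rho_closed[OF that] N.tensorable_M P.tensorable_M hom_closedD[OF fD(1)] gD(1)])
       (simp_all add: gD(2))
  then show ?thesis
    using fD gD hom_closedD[OF fD(1)] hom_comp[OF fD(1) gD(1)] by (simp add: coaction_map_def)
qed

text \<open>
  Apply \<open>g \<otimes> id\<close>, where \<open>g\<close> is the inverse, to \<open>\<rho>(f(m)) = (f \<otimes> id) \<rho>(m)\<close>.
\<close>

lemma coaction_map_inv:
  assumes M: "right_comodule la ra D e M acM \<rho>M" and N: "right_comodule la ra D e N acN \<rho>N"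
    and f: "coaction_map la M acM \<rho>M N acN \<rho>N f" and b: "bij_betw f (carrier M) (carrier N)"
  shows "coaction_map la N acN \<rho>N M acM \<rho>M (inv_into (carrier M) f)"
proof -
  interpret M: right_comodule la ra D e M acM \<rho>M by fact
  interpret N: right_comodule la ra D e N acN \<rho>N by fact
  let ?g = "inv_into (carrier M) f"
  note fD = coaction_mapD[OF f]
  have gh: "?g \<in> hom N M"
    using M.comm_group_M by (intro hom_inv_into[OF _ fD(1) b]) (simp add: comm_group_def)
  have gf: "?g (f m) = m" if "m \<in> carrier M" for m using b that by (simp add: bij_betw_def)
  have fg: "\<exists>m\<in>carrier M. n = f m" if "n \<in> carrier N" for n using b that by (auto simp: bij_betw_def)
  have act: "?g (acN n r) = acM (?g n) r" if n: "n \<in> carrier N" for n r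
  proof -
    obtain m where m: "m \<in> carrier M" "n = f m" using fg[OF n] by blast
    have "acN n r = f (acM m r)" using fD(2) m by simp
    then show ?thesis using m by (simp add: gf M.ac_closed)
  qed
  have "\<rho>M (?g n) = tensor_map2 M.T ?g id (\<rho>N n)" if n: "n \<in> carrier N" for n
  proof -
    obtain m where m: "m \<in> carrier M" "n = f m" using fg[OF n] by blast
    have "tensor_map2 M.T ?g id (tensor_map2 N.T f id (\<rho>M m)) = tensor_map2 M.T (\<lambda>m. ?g (f m)) id (\<rho>M m)"
      by (rule tensor_map2_comp[OF M.tensorable_M M.rho_closed[OF m(1)] N.tensorable_M M.tensorable_M hom_closedD[OF fD(1)] gh]) (simp, rule act)
    also have "\<dots> = \<rho>M m"
      by (rule tensor_map2_ident[OF M.tensorable_M M.rho_closed[OF m(1)] gf])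
    finally show ?thesis using fD(3) m by (simp add: gf)
  qed
  then show ?thesis using gh act by (simp add: coaction_map_def)
qed

lemma is_comoduleD:
  assumes "is_comodule \<H> M"
  shows "right_comodule (rb_la (rb \<H>)) (rb_ra (rb \<H>)) (cop (rb \<H>)) (cou (rb \<H>)) M (actR M) (coactR M)"
    and "right_comodule (lb_la (lb \<H>)) (lb_ra (lb \<H>)) (cop (lb \<H>)) (cou (lb \<H>)) M (actL M) (coactL M)"
  using assms by (simp_all add: is_comodule_def)

lemma comod_hom_cong:
  assumes M: "is_comodule \<H> M" and N: "is_comodule \<H> N" and f: "f \<in> comod_hom \<H> M N"
    and eq: "\<And>m. m \<in> carrier M \<Longrightarrow> f' m = f m"
  shows "f' \<in> comod_hom \<H> M N"
  using coaction_map_cong[OF is_comoduleD(1)[OF M] is_comoduleD(1)[OF N] _ eq]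
    coaction_map_cong[OF is_comoduleD(2)[OF M] is_comoduleD(2)[OF N] _ eq] f by (simp add: comod_hom_iff)

lemma comod_hom_id: "is_comodule \<H> M \<Longrightarrow> (\<lambda>m. m) \<in> comod_hom \<H> M M"
  by (simp add: comod_hom_iff coaction_map_id[OF is_comoduleD(1)] coaction_map_id[OF is_comoduleD(2)])

lemma comod_hom_comp:
  assumes "is_comodule \<H> M" "is_comodule \<H> N" "is_comodule \<H> P" "f \<in> comod_hom \<H> M N" "g \<in> comod_hom \<H> N P"
  shows "(\<lambda>m. g (f m)) \<in> comod_hom \<H> M P"
  unfolding comod_hom_iff
  by (intro conjI coaction_map_comp[OF assms(1-3)[THEN is_comoduleD(1)]] coaction_map_comp[OF assms(1-3)[THEN is_comoduleD(2)]])
     (use assms(4,5) in \<open>simp_all add: comod_hom_iff\<close>)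

lemma comod_hom_inv:
  assumes "is_comodule \<H> M" "is_comodule \<H> N" "f \<in> comod_hom \<H> M N" "bij_betw f (carrier M) (carrier N)"
  shows "inv_into (carrier M) f \<in> comod_hom \<H> N M"
  using coaction_map_inv[OF assms(1,2)[THEN is_comoduleD(1)] _ assms(4)] coaction_map_inv[OF assms(1,2)[THEN is_comoduleD(2)] _ assms(4)] assms(3)
  by (simp add: comod_hom_iff)

lemma is_hopf_moduleD:
  assumes "is_hopf_module \<H> A M"
  shows "is_comodule \<H> M" "right_module UNIV M (actA M)"
  using assms by (simp_all add: is_hopf_module_def is_hopf_module_axioms_def)

lemma hopf_module_cat_simps:
  "Obj (hopf_module_cat \<H> A) = {M. is_hopf_module \<H> A M}"
  "Hom (hopf_module_cat \<H> A) M N = {f \<in> comod_hom \<H> M N \<inter> extensional (carrier M). \<forall>m\<in>carrier M. \<forall>a. f (actA M m a) = actA N (f m) a}"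
  "Comp (hopf_module_cat \<H> A) L M N g f = compose (carrier L) g f"
  "Ident (hopf_module_cat \<H> A) M = (\<lambda>m\<in>carrier M. m)"
  by (simp_all add: hopf_module_cat_def)

lemma module_cat_simps:
  "Obj (module_cat B) = {W. right_module B W (act W)}"
  "Hom (module_cat B) V W = {f \<in> hom V W \<inter> extensional (carrier V). \<forall>v\<in>carrier V. \<forall>b\<in>B. f (act V v b) = act W (f v) b}"
  "Comp (module_cat B) U V W g f = compose (carrier U) g f"
  "Ident (module_cat B) W = (\<lambda>w\<in>carrier W. w)"
  by (simp_all add: module_cat_def)

lemma hopf_Hom_hom: "f \<in> Hom (hopf_module_cat \<H> A) M N \<Longrightarrow> f \<in> hom M N"
  by (auto simp: hopf_module_cat_simps dest: comod_hom_hom)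

lemma compose_ext_laws:
  "f \<in> extensional S \<Longrightarrow> compose S f (\<lambda>m\<in>S. m) = f"
  "f \<in> extensional S \<Longrightarrow> (\<And>x. x \<in> S \<Longrightarrow> f x \<in> S') \<Longrightarrow> compose S (\<lambda>m\<in>S'. m) f = f"
  "(\<And>x. x \<in> S \<Longrightarrow> f x \<in> S') \<Longrightarrow> compose S (compose S' h g) f = compose S h (compose S g f)"
  by (auto simp: compose_def extensional_def fun_eq_iff)

lemma right_moduleD:
  assumes "right_module B W ac"
  shows "comm_group W" "group W" "w \<in> carrier W \<Longrightarrow> b \<in> B \<Longrightarrow> ac w b \<in> carrier W"
  using assms by (simp_all add: right_module_def comm_group_def)

lemma module_category: "is_category (module_cat B)"
  unfolding is_category_def
proof (intro conjI ballI, goal_cases)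
  case (1 W)
  then have W: "right_module B W (act W)" by (simp add: module_cat_simps)
  have "(\<lambda>w\<in>carrier W. w) \<in> hom W W"
    by (rule hom_cong[where f = "\<lambda>w. w", OF _ _ right_moduleD(2)[OF W]]) (simp_all add: hom_def)
  then show ?case using right_moduleD(3)[OF W] by (simp add: module_cat_simps)
next
  case (2 X Y Z f g)
  then have X: "right_module B X (act X)" and f: "f \<in> hom X Y" and g: "g \<in> hom Y Z" by (simp_all add: module_cat_simps)
  have "compose (carrier X) g f \<in> hom X Z"
    by (rule hom_cong[OF hom_comp[OF f g] _ right_moduleD(2)[OF X]]) (simp add: compose_def)
  then show ?case using 2 right_moduleD(3)[OF X] hom_closedD[OF f] by (simp add: module_cat_simps compose_def)
next
  case (3 X Y f) then show ?case by (simp add: module_cat_simps compose_ext_laws)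
next
  case (4 X Y f)
  then have "f \<in> hom X Y" by (simp add: module_cat_simps)
  from hom_closedD[OF this] 4 show ?case by (simp add: module_cat_simps compose_ext_laws)
next
  case (5 W X Y Z f g h)
  then have "f \<in> hom W X" by (simp add: module_cat_simps)
  from hom_closedD[OF this] show ?case by (simp add: module_cat_simps compose_ext_laws)
qed

lemma hopf_module_category: "is_category (hopf_module_cat \<H> A)"
  unfolding is_category_def
proof (intro conjI ballI, goal_cases)
  case (1 M)
  then have M: "is_comodule \<H> M" and a: "right_module UNIV M (actA M)"
    using is_hopf_moduleD by (auto simp: hopf_module_cat_simps)
  have "(\<lambda>m\<in>carrier M. m) \<in> comod_hom \<H> M M"
    by (rule comod_hom_cong[OF M M comod_hom_id[OF M]]) simp
  then show ?case using a by (simp add: hopf_module_cat_simps right_module_def)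
next
  case (2 X Y Z f g)
  then have X: "is_comodule \<H> X" and Y: "is_comodule \<H> Y" and Z: "is_comodule \<H> Z"
    and a: "right_module UNIV X (actA X)" and f: "f \<in> comod_hom \<H> X Y" and g: "g \<in> comod_hom \<H> Y Z"
    using is_hopf_moduleD by (auto simp: hopf_module_cat_simps)
  have "compose (carrier X) g f \<in> comod_hom \<H> X Z"
    by (rule comod_hom_cong[OF X Z comod_hom_comp[OF X Y Z f g]]) (simp add: compose_def)
  then show ?case
    using a 2 hom_closedD[OF hopf_Hom_hom[OF 2(4)]] by (simp add: hopf_module_cat_simps right_module_def compose_def)
next
  case (3 X Y f) then show ?case by (simp add: hopf_module_cat_simps compose_ext_laws)
next
  case (4 X Y f) then show ?case
    using hom_closedD[OF hopf_Hom_hom[OF 4(3)]] by (simp add: hopf_module_cat_simps compose_ext_laws)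
next
  case (5 W X Y Z f g h) then show ?case
    using hom_closedD[OF hopf_Hom_hom[OF 5(5)]] by (simp add: hopf_module_cat_simps compose_ext_laws)
qed

lemma bij_is_iso_hopf_module:
  assumes "is_hopf_module \<H> A M" "is_hopf_module \<H> A N" "f \<in> Hom (hopf_module_cat \<H> A) M N"
    and b: "bij_betw f (carrier M) (carrier N)"
  shows "is_iso_in (hopf_module_cat \<H> A) M N f"
proof -
  let ?g = "\<lambda>n\<in>carrier N. inv_into (carrier M) f n"
  note M = is_hopf_moduleD[OF assms(1)] and N = is_hopf_moduleD[OF assms(2)]
  have f: "f \<in> comod_hom \<H> M N" "f \<in> extensional (carrier M)" "\<And>m a. m \<in> carrier M \<Longrightarrow> f (actA M m a) = actA N (f m) a"
    using assms(3) by (simp_all add: hopf_module_cat_simps)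
  have fc: "f m \<in> carrier N" if "m \<in> carrier M" for m using b that by (auto simp: bij_betw_def)
  have gf: "inv_into (carrier M) f (f m) = m" if "m \<in> carrier M" for m using b that by (simp add: bij_betw_def)
  have fg: "f (inv_into (carrier M) f n) = n" "inv_into (carrier M) f n \<in> carrier M" if "n \<in> carrier N" for n
    using b that by (auto simp: bij_betw_def f_inv_into_f inv_into_into)
  have "?g \<in> comod_hom \<H> N M"
    by (rule comod_hom_cong[OF N(1) M(1) comod_hom_inv[OF M(1) N(1) f(1) b]]) simp
  moreover have "inv_into (carrier M) f (actA N n a) = actA M (inv_into (carrier M) f n) a" if n: "n \<in> carrier N" for n a
  proof -
    have "actA M (inv_into (carrier M) f n) a \<in> carrier M" using M(2) fg(2)[OF n] by (simp add: right_module_def)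
    from gf[OF this] show ?thesis using f(3)[OF fg(2)[OF n], of a] fg(1)[OF n] by simp
  qed
  ultimately have "?g \<in> Hom (hopf_module_cat \<H> A) N M"
    using N(2) by (simp add: hopf_module_cat_simps right_module_def)
  then show ?thesis
    unfolding is_iso_in_def using assms(3)
    by (intro conjI bexI[of _ ?g])
       (simp_all add: hopf_module_cat_simps compose_def fc gf fg cong: restrict_cong)
qed

lemma bij_is_iso_module:
  assumes "right_module B V (act V)" "right_module B W (act W)" "f \<in> Hom (module_cat B) V W"
    and b: "bij_betw f (carrier V) (carrier W)"
  shows "is_iso_in (module_cat B) V W f"
proof -
  let ?g = "\<lambda>n\<in>carrier W. inv_into (carrier V) f n"
  have f: "f \<in> hom V W" "\<And>m a. m \<in> carrier V \<Longrightarrow> a \<in> B \<Longrightarrow> f (act V m a) = act W (f m) a"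
    using assms(3) by (simp_all add: module_cat_simps)
  have fc: "f m \<in> carrier W" if "m \<in> carrier V" for m using b that by (auto simp: bij_betw_def)
  have gf: "inv_into (carrier V) f (f m) = m" if "m \<in> carrier V" for m using b that by (simp add: bij_betw_def)
  have fg: "f (inv_into (carrier V) f n) = n" "inv_into (carrier V) f n \<in> carrier V" if "n \<in> carrier W" for n
    using b that by (auto simp: bij_betw_def f_inv_into_f inv_into_into)
  have V: "group V" and W: "group W" using assms(1,2) by (simp_all add: right_module_def comm_group_def)
  have "?g \<in> hom W V"
    by (rule hom_cong[OF hom_inv_into[OF V f(1) b] _ W]) simp
  moreover have "inv_into (carrier V) f (act W n a) = act V (inv_into (carrier V) f n) a" if n: "n \<in> carrier W" "a \<in> B" for n a
  proof -
    have "act V (inv_into (carrier V) f n) a \<in> carrier V" using assms(1) fg(2)[OF n(1)] n by (simp add: right_module_def)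
    from gf[OF this] show ?thesis using f(2)[OF fg(2)[OF n(1)] n(2)] fg(1)[OF n(1)] by simp
  qed
  ultimately have "?g \<in> Hom (module_cat B) W V"
    using assms(2) by (simp add: module_cat_simps right_module_def)
  then show ?thesis
    unfolding is_iso_in_def using assms(3)
    by (intro conjI bexI[of _ ?g])
       (simp_all add: module_cat_simps compose_def fc gf fg cong: restrict_cong)
qed

section \<open>The equivalence\<close>

text \<open>
  The quasi-inverse functor sends a relative Hopf module to its coinvariants for the \<open>R\<close>-coaction.
\<close>

definition coinv_obj ::
    "('k, 'l, 'r, 'h::{ring,monoid_mult}) hopf_algebroid \<Rightarrow> ('m, 'l, 'r, 'h, 'a) hopf_mod \<Rightarrow> ('m, 'a) rmod" where
  "coinv_obj \<H> M = \<lparr>carrier = {m \<in> carrier M. coactR M m = pure_tensor (tensor UNIV M (actR M) additive_group (rb_la (rb \<H>))) m 1},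
     monoid.mult = monoid.mult M, one = one M, act = actA M\<rparr>"

lemma coinv_obj_simps [simp]:
  "m \<in> carrier (coinv_obj \<H> M) \<longleftrightarrow> m \<in> carrier M \<and> coactR M m = pure_tensor (tensor UNIV M (actR M) additive_group (rb_la (rb \<H>))) m 1"
  "monoid.mult (coinv_obj \<H> M) = monoid.mult M" "one (coinv_obj \<H> M) = one M" "act (coinv_obj \<H> M) = actA M"
  by (auto simp: coinv_obj_def)

lemma comod_hom_coinvariant:
  assumes M: "is_comodule \<H> M" and N: "is_comodule \<H> N" and f: "f \<in> comod_hom \<H> M N"
    and n: "n \<in> carrier (coinv_obj \<H> M)"
  shows "f n \<in> carrier (coinv_obj \<H> N)"
proof -
  interpret M: is_comodule \<H> M by fact
  interpret N: is_comodule \<H> N by fact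
  note fh = comod_hom_hom[OF f]
  have b: "balanced UNIV M (actR M) additive_group (rb_la (rb \<H>)) N.right.T (\<lambda>m h. pure_tensor N.right.T (f m) h)"
    by (rule balanced_pure_hom[OF M.right.tensorable_M N.right.tensorable_M fh]) (use f in \<open>simp add: comod_hom_def\<close>)
  have nM: "n \<in> carrier M" and c: "coactR M n = pure_tensor M.right.T n 1" using n by simp_all
  have "coactR N (f n) = tensor_map2 N.right.T f id (coactR M n)"
    using f nM by (simp add: comod_hom_def rb_tensor_def)
  also have "\<dots> = ev N.right.T (\<lambda>m h. pure_tensor N.right.T (f m) (id h)) (coactR M n)"
    by (rule tensor_map2_ev(2)[OF M.right.tensorable_M M.right.rho_closed[OF nM] N.right.tensorable_M]) (simp_all add: hom_closedD[OF fh])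
  also have "\<dots> = pure_tensor N.right.T (f n) 1"
    unfolding c id_apply by (rule ev_pure[OF b nM]) simp
  finally show ?thesis using hom_closedD[OF fh nM] by simp
qed

locale cleft_universe = cleft_comod_algebra \<H> A B etaL j j'
  for \<H> :: "('k::{comm_ring,comm_monoid_mult}, 'l::{ring,monoid_mult}, 'r::{ring,monoid_mult},
             'h::{ring,monoid_mult}) hopf_algebroid"
    and A :: "('k, 'l, 'r, 'h, 'a::{ring,monoid_mult}) comod_algebra"
    and B etaL j j' +
  fixes code :: "('u \<times> 'a \<Rightarrow>\<^sub>0 int) \<Rightarrow> 'u"
  assumes inj_code: "inj code"
begin

abbreviation "MC \<equiv> (module_cat B :: (('u, 'a) rmod, 'u \<Rightarrow> 'u) cat)"
abbreviation "HC \<equiv> (hopf_module_cat \<H> A :: (('u, 'l, 'r, 'h, 'a) hopf_mod, 'u \<Rightarrow> 'u) cat)"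
abbreviation "F \<equiv> tensor_obj \<H> A B code"
abbreviation "Co \<equiv> (coinv_obj \<H> :: ('u, 'l, 'r, 'h, 'a) hopf_mod \<Rightarrow> ('u, 'a) rmod)"
abbreviation "pt \<equiv> tensor_transport.pt code B"

lemma extension_module: "right_module B W (act W) \<Longrightarrow> extension_module \<H> A B code W"
  using B inj_code by unfold_locales auto

lemma cleft_hopf_module: "is_hopf_module \<H> A M \<Longrightarrow> cleft_hopf_module \<H> A B etaL j j' M (actA M)"
  by (intro cleft_hopf_module.intro[OF cleft_comod_algebra_axioms] is_hopf_module.relative_hopf_module)

lemma tensor_mor_facts:
  assumes V: "right_module B V (act V)" and W: "right_module B W (act W)" and f: "f \<in> Hom MC V W"
  shows tensor_mor_hom: "tensor_mor B code V W f \<in> hom (F V) (F W)"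
    and tensor_mor_pt: "\<And>v a. v \<in> carrier V \<Longrightarrow> tensor_mor B code V W f (pt V v a) = pt W (f v) a"
proof -
  interpret V: extension_module \<H> A B code V by (rule extension_module[OF V])
  interpret W: extension_module \<H> A B code W by (rule extension_module[OF W])
  have fh: "f \<in> hom V W" and fB: "\<And>v b. v \<in> carrier V \<Longrightarrow> b \<in> B \<Longrightarrow> f (act V v b) = act W (f v) b"
    using f by (simp_all add: module_cat_simps)
  let ?f = "\<lambda>v a. pt W (f v) a"
  have b: "V.tt.Bbalanced (F W) ?f"
    by (rule balancedI[OF V.tt.tensorable_W W.tt.comm_group_G])
       (simp_all add: W.tt.ptD hom_closedD[OF fh] hom_mult[OF fh] fB del: tensor_obj_simps)
  have eq: "tensor_mor B code V W f u = V.tt.lift (F W) ?f u" if u: "u \<in> carrier (F V)" for u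
  proof -
    note d = V.tt.dec_closed[OF u, unfolded tensor_over_def]
    have "tensor_map2 W.tt.TW f id (V.tt.dec u) = ev W.tt.TW (\<lambda>v a. pure_tensor W.tt.TW (f v) (id a)) (V.tt.dec u)"
      unfolding tensor_over_def
      by (rule tensor_map2_ev(2)[OF V.tt.tensorable_W d W.tt.tensorable_W]) (simp_all add: hom_closedD[OF fh])
    then have "tensor_mor B code V W f u = encode code (ev W.tt.TW (\<lambda>v a. pure_tensor W.tt.TW (f v) a) (V.tt.dec u))"
      using u by (simp add: tensor_mor_def)
    also have "\<dots> = ev (F W) (\<lambda>v a. encode code (pure_tensor W.tt.TW (f v) a)) (V.tt.dec u)"
      unfolding tensor_over_def
      by (rule hom_ev[OF V.tt.tensorable_W _ W.tt.comm_group_G d W.tt.encode_hom[unfolded tensor_over_def]])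
         (simp_all add: comm_group_tensor W.tt.tensorable_W pure_tensor_closed hom_closedD[OF fh])
    finally show ?thesis by (simp add: V.tt.lift_def W.tt.pt_def)
  qed
  show "tensor_mor B code V W f \<in> hom (F V) (F W)"
    by (rule hom_cong[OF V.tt.lift_hom[OF b] eq V.tt.group_G])
  show "tensor_mor B code V W f (pt V v a) = pt W (f v) a" if "v \<in> carrier V" for v a
    using eq[OF V.tt.ptD(1)[OF that]] V.tt.lift_pt[OF b that] by simp
qed

lemma tensor_mor_Hom:
  assumes V: "right_module B V (act V)" and W: "right_module B W (act W)" and f: "f \<in> Hom MC V W"
  shows "tensor_mor B code V W f \<in> Hom HC (F V) (F W)"
proof -
  interpret V: extension_module \<H> A B code V by (rule extension_module[OF V])
  interpret W: extension_module \<H> A B code W by (rule extension_module[OF W])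
  interpret FV: is_comodule \<H> "F V" by (rule V.comodule_G)
  interpret FW: is_comodule \<H> "F W" by (rule W.comodule_G)
  let ?t = "tensor_mor B code V W f"
  note th = tensor_mor_hom[OF V W f] and tpt = tensor_mor_pt[OF V W f]
  have fc: "f v \<in> carrier W" if "v \<in> carrier V" for v
    using f hom_closedD[of f V W v] that by (simp add: module_cat_simps)
  have act: "?t (tensor_act code B V g u) = tensor_act code B W g (?t u)"
    if g: "V.tt.B_linear g" and u: "u \<in> carrier (F V)" for g u
  proof (rule V.tt.G_ext[OF W.tt.comm_group_G hom_comp[OF V.tt.tensor_act_hom[OF g] th] _ _ u])
    have g': "W.tt.B_linear g" using g by (simp add: V.tt.B_linear_def W.tt.B_linear_def)
    show "(\<lambda>u. tensor_act code B W g (?t u)) \<in> hom (F V) (F W)"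
      by (rule hom_comp[OF th W.tt.tensor_act_hom[OF g']])
    show "?t (tensor_act code B V g (V.tt.pt v a)) = tensor_act code B W g (?t (V.tt.pt v a))" if "v \<in> carrier V" for v a
      using that fc by (simp add: V.tt.tensor_act_pt[OF g] W.tt.tensor_act_pt[OF g'] tpt)
  qed
  have aR: "?t (actR (F V) u r) = actR (F W) (?t u) r" and aL: "?t (actL (F V) u l) = actL (F W) (?t u) l"
    and aA: "?t (actA (F V) u a) = actA (F W) (?t u) a" if "u \<in> carrier (F V)" for u r l a
    using act[OF V.B_linear_mult that] act[OF V.B_linear_actLA that] by simp_all
  have cR: "coactR (F W) (?t u) = tensor_map2 FW.right.T ?t id (coactR (F V) u)"
    and cL: "coactL (F W) (?t u) = tensor_map2 FW.left.T ?t id (coactL (F V) u)" if u: "u \<in> carrier (F V)" for u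
    using V.R.coact_morphism[OF FW.right.tensorable_M FW.right.\<rho>_hom th _ _ u] aR W.R.coact_pt[OF fc]
      V.L.coact_morphism[OF FW.left.tensorable_M FW.left.\<rho>_hom th _ _ u] aL W.L.coact_pt[OF fc]
    by (simp_all add: tpt)
  have "?t \<in> comod_hom \<H> (F V) (F W)"
    unfolding comod_hom_iff coaction_map_def by (intro conjI ballI allI th aR aL cR cL)
  moreover have "?t \<in> extensional (carrier (F V))" by (simp add: tensor_mor_def)
  ultimately show ?thesis using aA by (simp add: hopf_module_cat_simps del: tensor_obj_simps)
qed

lemma tensor_functor: "is_functor MC HC F (tensor_mor B code)"
  unfolding is_functor_def
proof (intro conjI ballI, goal_cases)
  case (1 W)
  then have "extension_module \<H> A B code W" by (intro extension_module) (simp add: module_cat_simps)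
  then show ?case using extension_module.hopf_module_G by (simp add: hopf_module_cat_simps)
next
  case (2 V W f)
  then show ?case by (intro tensor_mor_Hom) (simp_all add: module_cat_simps)
next
  case (3 W)
  then have W: "right_module B W (act W)" by (simp add: module_cat_simps)
  have i: "Ident MC W \<in> Hom MC W W" using 3 module_category[of B] unfolding is_category_def by blast
  interpret W: extension_module \<H> A B code W by (rule extension_module[OF W])
  show ?case
  proof (rule extensionalityI)
    show "tensor_mor B code W W (Ident MC W) \<in> extensional (carrier (F W))" by (simp add: tensor_mor_def)
    show "Ident HC (F W) \<in> extensional (carrier (F W))" by (simp add: hopf_module_cat_simps)
    fix u assume u: "u \<in> carrier (F W)"
    have "tensor_mor B code W W (Ident MC W) u = (\<lambda>u. u) u"
    proof (rule W.tt.G_ext[OF W.tt.comm_group_G tensor_mor_hom[OF W W i] _ _ u])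
      show "(\<lambda>u. u) \<in> hom (F W) (F W)" by (rule homI) simp_all
      show "tensor_mor B code W W (Ident MC W) (pt W w a) = pt W w a" if "w \<in> carrier W" for w a
        unfolding tensor_mor_pt[OF W W i that] using that by (simp add: module_cat_simps)
    qed
    then show "tensor_mor B code W W (Ident MC W) u = Ident HC (F W) u" using u by (simp add: hopf_module_cat_simps)
  qed
next
  case (4 U V W f g)
  then have U: "right_module B U (act U)" and V: "right_module B V (act V)" and W: "right_module B W (act W)"
    and f: "f \<in> Hom MC U V" and g: "g \<in> Hom MC V W" by (simp_all add: module_cat_simps)
  have gf: "Comp MC U V W g f \<in> Hom MC U W" using 4 module_category[of B] unfolding is_category_def by blast
  have fc: "f v \<in> carrier V" if "v \<in> carrier U" for v
    using f hom_closedD[of f U V v] that by (simp add: module_cat_simps)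
  interpret U: extension_module \<H> A B code U by (rule extension_module[OF U])
  interpret W: extension_module \<H> A B code W by (rule extension_module[OF W])
  show ?case
  proof (rule extensionalityI)
    show "tensor_mor B code U W (Comp MC U V W g f) \<in> extensional (carrier (F U))" by (simp add: tensor_mor_def)
    show "Comp HC (F U) (F V) (F W) (tensor_mor B code V W g) (tensor_mor B code U V f) \<in> extensional (carrier (F U))"
      by (simp add: hopf_module_cat_simps compose_def)
    fix u assume u: "u \<in> carrier (F U)"
    have "tensor_mor B code U W (Comp MC U V W g f) u = tensor_mor B code V W g (tensor_mor B code U V f u)"
      by (rule U.tt.G_ext[OF W.tt.comm_group_G tensor_mor_hom[OF U W gf] hom_comp[OF tensor_mor_hom[OF U V f] tensor_mor_hom[OF V W g]] _ u])
         (simp add: tensor_mor_pt[OF U V f] tensor_mor_pt[OF V W g] tensor_mor_pt[OF U W gf] fc, simp add: module_cat_simps(3) compose_def)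
    then show "tensor_mor B code U W (Comp MC U V W g f) u =
      Comp HC (F U) (F V) (F W) (tensor_mor B code V W g) (tensor_mor B code U V f) u"
      using u by (simp add: hopf_module_cat_simps compose_def)
  qed
qed

lemma coinv_obj_module:
  assumes M: "is_hopf_module \<H> A M"
  shows "right_module B (Co M) (act (Co M))"
proof -
  interpret M: cleft_hopf_module \<H> A B etaL j j' M "actA M" by (rule cleft_hopf_module[OF M])
  interpret T: comm_group M.TM by (rule M.comm_group_TM)
  interpret cM: comm_group M by (rule M.comm_group_M)
  have rho: "coactR M \<in> hom M M.TM" by (rule M.M.right.\<rho>_hom)
  have pure: "(\<lambda>m. pure_tensor M.TM m 1) \<in> hom M M.TM" by (rule homI) (simp_all add: M.pureD)
  interpret rho: group_hom M M.TM "coactR M" using rho by unfold_locales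
  interpret pure: group_hom M M.TM "\<lambda>m. pure_tensor M.TM m 1" using pure by unfold_locales
  have "comm_group (Co M)"
  proof (rule comm_groupI)
    fix x assume x: "x \<in> carrier (Co M)"
    then have "inv\<^bsub>M\<^esub> x \<in> carrier (Co M)" "inv\<^bsub>M\<^esub> x \<otimes>\<^bsub>M\<^esub> x = \<one>\<^bsub>M\<^esub>"
      using rho.hom_inv[of x] pure.hom_inv[of x] by simp_all
    then show "\<exists>y\<in>carrier (Co M). y \<otimes>\<^bsub>Co M\<^esub> x = \<one>\<^bsub>Co M\<^esub>" by auto
  qed (use rho.hom_one pure.hom_one in \<open>simp_all add: rho.hom_mult pure.hom_mult cM.m_ac\<close>)
  then show ?thesis
    using M.coinvariant_da_B by (simp add: right_module_def M.da_simps)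
qed

text \<open>
  On coinvariants the right \<open>L\<close>-action is given by the right \<open>R\<close>-action, as \<open>n l = n \<epsilon>\<^sub>R(t\<^sub>L(l))\<close>. The counit
  \<open>n \<otimes> a \<mapsto> n a\<close> is \<open>L\<close>-linear because of this.
\<close>

lemma coinvariant_actL:
  assumes M: "is_hopf_module \<H> A M" and n: "n \<in> carrier (Co M)"
  shows "actL M n l = actR M n (\<epsilon>\<^sub>R (t\<^sub>L l))"
proof -
  interpret M: cleft_hopf_module \<H> A B etaL j j' M "actA M" by (rule cleft_hopf_module[OF M])
  have nM: "n \<in> carrier M" using n by simp
  have b: "M.Rbalanced M (\<lambda>m h. actR M m (\<epsilon>\<^sub>R (raL h l)))"
    by (rule balancedI[OF M.M.right.tensorable_M M.comm_group_M])
       (simp_all add: M.M.right.ac_closed M.M.right.ac_mult M.M.right.ac_add distrib_left right.\<epsilon>_add lb_ra_def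
         M.M.right.ac_ac[symmetric] rb_la_def mult.assoc[symmetric],
        simp add: right.eps_la[unfolded rb_la_def])
  have "actL M n l = ev M (\<lambda>m h. actR M m (\<epsilon>\<^sub>R h)) (coactR M (actL M n l))"
    using M.M.right.\<rho>_counit[OF M.M.left.ac_closed[OF nM]] by simp
  also have "\<dots> = ev M (\<lambda>m h. actR M m (\<epsilon>\<^sub>R (raL h l))) (coactR M n)"
    by (rule M.M.ev_coactR_actL[OF M.M.right.balanced_counit nM])
  also have "\<dots> = actR M n (\<epsilon>\<^sub>R (raL 1 l))"
    using ev_pure[OF b nM, of 1] n by simp
  finally show ?thesis by (simp add: lb_ra_def)
qed

definition coinv_mor :: "('u, 'l, 'r, 'h, 'a) hopf_mod \<Rightarrow> ('u, 'l, 'r, 'h, 'a) hopf_mod \<Rightarrow> ('u \<Rightarrow> 'u) \<Rightarrow> 'u \<Rightarrow> 'u" where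
  "coinv_mor M N f = restrict f (carrier (Co M))"

lemma coinv_functor: "is_functor HC MC Co coinv_mor"
  unfolding is_functor_def
proof (intro conjI ballI, goal_cases)
  case (1 M) then show ?case using coinv_obj_module by (simp add: hopf_module_cat_simps module_cat_simps)
next
  case (2 M N f)
  then have M: "is_hopf_module \<H> A M" and N: "is_hopf_module \<H> A N" and f: "f \<in> comod_hom \<H> M N"
    and fA: "\<And>m a. m \<in> carrier M \<Longrightarrow> f (actA M m a) = actA N (f m) a"
    by (simp_all add: hopf_module_cat_simps)
  note Co = comod_hom_coinvariant[OF is_hopf_moduleD(1)[OF M] is_hopf_moduleD(1)[OF N] f]
  note CM = coinv_obj_module[OF M]
  note h = comod_hom_hom[OF f]
  have "f \<in> hom (Co M) (Co N)"
    by (rule homI) (use Co hom_mult[OF h] in simp_all)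
  then have "coinv_mor M N f \<in> hom (Co M) (Co N)"
    by (rule hom_cong[OF _ _ right_moduleD(2)[OF CM]]) (simp add: coinv_mor_def)
  moreover have "coinv_mor M N f (act (Co M) v b) = act (Co N) (coinv_mor M N f v) b" if "v \<in> carrier (Co M)" "b \<in> B" for v b
    using that right_moduleD(3)[OF CM that] fA by (simp add: coinv_mor_def)
  ultimately show ?case by (simp add: module_cat_simps) (simp add: coinv_mor_def)
next
  case (3 M) show ?case by (auto simp: coinv_mor_def hopf_module_cat_simps module_cat_simps fun_eq_iff restrict_def)
next
  case (4 L M N f g)
  then have L: "is_hopf_module \<H> A L" and M: "is_hopf_module \<H> A M" and f: "f \<in> comod_hom \<H> L M"
    by (simp_all add: hopf_module_cat_simps)
  note Co = comod_hom_coinvariant[OF is_hopf_moduleD(1)[OF L] is_hopf_moduleD(1)[OF M] f]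
  show ?case
  proof (rule ext)
    fix x show "coinv_mor L N (Comp HC L M N g f) x = Comp MC (Co L) (Co M) (Co N) (coinv_mor M N g) (coinv_mor L M f) x"
      using Co[of x] by (cases "x \<in> carrier (Co L)") (auto simp: coinv_mor_def hopf_module_cat_simps module_cat_simps compose_def)
  qed
qed

definition unit_map :: "('u, 'a) rmod \<Rightarrow> 'u \<Rightarrow> 'u" where
  "unit_map W = (\<lambda>w\<in>carrier W. pt W w 1)"

lemma alg_pi_one: "alg_pi 1 = j' 1"
proof -
  interpret reg: cleft_hopf_module \<H> A B etaL j j' "alg_comod A" "(*)" by (rule regular_cleft_hopf_module)
  have "coinvariant 1" using B_closed(1) by (simp add: B_iff)
  then have "reg.cleft_pi 1 = j' 1" using reg.cleft_pi_coinvariant_eq[of 1] by simp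
  moreover have "reg.cleft_pi 1 = alg_pi 1"
    unfolding reg.cleft_pi_def alg_pi_def using ev_alg[OF right.tensorable_M right.rho_closed[of 1]] by simp
  ultimately show ?thesis by simp
qed

text \<open>
  The inverse of \<open>w \<mapsto> w \<otimes> 1\<close> is \<open>w \<otimes> a \<mapsto> w \<pi>(a) j(1)\<close>, where \<open>\<pi>(a) j(1) \<in> B\<close>. On the one hand
  \<open>\<pi>(1) j(1) = j'(1) j(1) = 1\<close>. On the other hand \<open>\<pi>(u) j(1) = u\<close> for every coinvariant \<open>u\<close>, and
  \<open>\<pi>(w \<otimes> a) j(1) = w \<otimes> \<pi>(a) j(1) = w \<pi>(a) j(1) \<otimes> 1\<close>.
\<close>

lemma unit_iso:
  assumes W: "right_module B W (act W)"
  shows "is_iso_in MC W (Co (F W)) (unit_map W)"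
proof -
  interpret W: extension_module \<H> A B code W by (rule extension_module[OF W])
  note FW = W.hopf_module_G
  interpret M: cleft_hopf_module \<H> A B etaL j j' "F W" "actA (F W)" by (rule cleft_hopf_module[OF FW])
  note CF = coinv_obj_module[OF FW]
  let ?p = "\<lambda>a. alg_pi a * j 1"
  have pB: "?p a \<in> B" for a by (rule B_closed(2)[OF alg_pi_B j_one_B])
  have unit_co: "pt W w 1 \<in> carrier (Co (F W))" if w: "w \<in> carrier W" for w
  proof -
    have "coactR (F W) (pt W w 1) = ev W.R.TG (\<lambda>a' h. pure_tensor W.R.TG (pt W w a') h) (pure_tensor W.R.TA 1 1)"
      using W.R.coact_pt[OF w, of 1] rhoR_one by (simp add: rb_tensor_def)
    also have "\<dots> = pure_tensor W.R.TG (pt W w 1) 1"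
      by (rule ev_pure[OF W.R.balanced_AA[OF balanced_pure_tensor[OF W.R.tensorable_G] w]]) simp_all
    finally show ?thesis using W.tt.ptD(1)[OF w] by simp
  qed
  have Hom: "unit_map W \<in> Hom MC W (Co (F W))"
  proof -
    have "(\<lambda>w. pt W w 1) \<in> hom W (Co (F W))"
      by (rule homI) (use unit_co W.tt.ptD(2) in \<open>simp_all del: coinv_obj_simps(1) tensor_obj_simps add: W.tt.ptD\<close>)
    then have "unit_map W \<in> hom W (Co (F W))"
      by (rule hom_cong[OF _ _ right_moduleD(2)[OF W]]) (simp add: unit_map_def)
    moreover have "unit_map W (act W w b) = act (Co (F W)) (unit_map W w) b" if "w \<in> carrier W" "b \<in> B" for w b
      using that right_moduleD(3)[OF W that] W.tt.ptD(4)[of w b 1] W.tt.tensor_act_pt[OF W.B_linear_mult, of w b 1]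
      by (simp add: unit_map_def)
    ultimately show ?thesis by (simp add: module_cat_simps) (simp add: unit_map_def)
  qed
  let ?act = "\<lambda>w a. act W w (?p a)"
  have Wa: "act W (w \<otimes>\<^bsub>W\<^esub> w') b = act W w b \<otimes>\<^bsub>W\<^esub> act W w' b"
    "act W w (b + b') = act W w b \<otimes>\<^bsub>W\<^esub> act W w b'" "act W w (b * b') = act W (act W w b) b'" "act W w 1 = w"
    if "w \<in> carrier W" "w' \<in> carrier W" "b \<in> B" "b' \<in> B" for w w' b b'
    using W that by (simp_all add: right_module_def)
  have bal: "W.tt.Bbalanced W ?act"
  proof (rule balancedI[OF W.tt.tensorable_W W.tt.comm_group_W])
    fix w w' a a' b assume w: "w \<in> carrier W" "w' \<in> carrier W"
    show "?act w a \<in> carrier W" by (rule right_moduleD(3)[OF W w(1) pB])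
    show "?act (w \<otimes>\<^bsub>W\<^esub> w') a = ?act w a \<otimes>\<^bsub>W\<^esub> ?act w' a" by (rule Wa(1)[OF w pB pB])
    show "?act w (a \<otimes>\<^bsub>additive_group\<^esub> a') = ?act w a \<otimes>\<^bsub>W\<^esub> ?act w a'"
      using Wa(2)[OF w pB pB, of a a'] by (simp add: alg_pi_add distrib_right)
    show "?act (act W w b) a = ?act w (b * a)" if "b \<in> B"
      using Wa(3)[OF w that pB, of a] that by (simp add: alg_pi_B_mult mult.assoc)
  qed
  let ?v = "W.tt.lift W ?act"
  have v_pt: "?v (pt W w 1) = w" if w: "w \<in> carrier W" for w
    using W.tt.lift_pt[OF bal w, of 1] Wa(4)[OF w w B_closed(1) B_closed(1)] by (simp add: alg_pi_one j'_one_j_one)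
  have pi_pt: "M.cleft_pi (pt W w a) = pt W w (alg_pi a)" if w: "w \<in> carrier W" for w a
  proof -
    have "M.cleft_pi (pt W w a) = ev (F W) (\<lambda>a' h. actA (F W) (pt W w a') (j' h)) (rhoR A a)"
      unfolding M.cleft_pi_def
      using W.R.ev_coact_pt[of "F W" "\<lambda>m' h. actA (F W) m' (j' h)" w a] M.Rbalanced_j' w by simp
    also have "\<dots> = ev (F W) (\<lambda>a' h. pt W w (a' * j' h)) (rhoR A a)"
      using w by (simp add: W.tt.tensor_act_pt[OF W.B_linear_mult])
    also have "\<dots> = pt W w (alg_pi a)"
      unfolding alg_pi_def
      by (rule hom_ev[OF right.tensorable_M comm_group_additive W.tt.comm_group_G right.rho_closed, symmetric, simplified])
         (simp_all add: hom_def w W.tt.ptD[simplified])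
    finally show ?thesis .
  qed
  \<comment> \<open>\<open>u = \<pi>(u) j(1)\<close> holds for coinvariant \<open>u\<close> only, \<open>\<pi>(u) j(1) = ?v u \<otimes> 1\<close> for all \<open>u\<close>.\<close>
  have surj: "u = pt W (?v u) 1" if u: "u \<in> carrier (Co (F W))" for u
  proof -
    have uG: "u \<in> carrier (F W)" using u by simp
    have "u = actA (F W) (M.cleft_pi u) (j 1)"
      using M.cleft_pi_coinvariant_eq[of u] u M.da_simps(4,5)[OF uG] j'_one_j_one by (metis coinv_obj_simps(1))
    also have "\<dots> = pt W (?v u) 1"
    proof (rule W.tt.G_ext[OF W.tt.comm_group_G hom_comp[OF M.cleft_pi_hom M.da_hom] hom_comp[OF W.tt.lift_hom[OF bal]] _ uG])
      show "(\<lambda>w. pt W w 1) \<in> hom W (F W)" by (rule homI) (simp_all add: W.tt.ptD[simplified])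
      fix w a assume w: "w \<in> carrier W"
      show "actA (F W) (M.cleft_pi (pt W w a)) (j 1) = pt W (?v (pt W w a)) 1"
        unfolding pi_pt[OF w] W.tt.lift_pt[OF bal w]
        using w W.tt.ptD(4)[OF w pB, of a 1] by (simp add: W.tt.tensor_act_pt[OF W.B_linear_mult])
    qed
    finally show ?thesis .
  qed
  have "bij_betw (unit_map W) (carrier W) (carrier (Co (F W)))"
  proof (rule bij_betwI[where g = ?v])
    show "unit_map W \<in> carrier W \<rightarrow> carrier (Co (F W))" using unit_co by (simp add: unit_map_def)
    have vc: "?v u \<in> carrier W" if "u \<in> carrier (Co (F W))" for u
      using hom_closedD[OF W.tt.lift_hom[OF bal], of u] that by simp
    then show "?v \<in> carrier (Co (F W)) \<rightarrow> carrier W" by blast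
    show "?v (unit_map W w) = w" if "w \<in> carrier W" for w using v_pt[OF that] that by (simp add: unit_map_def)
    show "unit_map W (?v u) = u" if "u \<in> carrier (Co (F W))" for u
      using surj[OF that] vc[OF that] by (simp add: unit_map_def)
  qed
  then show ?thesis by (rule bij_is_iso_module[OF W CF Hom])
qed

definition counit_map :: "('u, 'l, 'r, 'h, 'a) hopf_mod \<Rightarrow> 'u \<Rightarrow> 'u" where
  "counit_map M = (\<lambda>u\<in>carrier (F (Co M)). tensor_transport.lift code B (Co M) M (actA M) u)"

lemma counit_Hom_facts:
  assumes M: "is_hopf_module \<H> A M"
  defines "c \<equiv> tensor_transport.lift code B (Co M) M (actA M)"
  shows counit_pt: "\<And>n a. n \<in> carrier (Co M) \<Longrightarrow> c (pt (Co M) n a) = actA M n a"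
    and counit_hom: "c \<in> hom (F (Co M)) M"
    and counit_comod_hom: "c \<in> comod_hom \<H> (F (Co M)) M"
    and counit_actA: "\<And>u a. u \<in> carrier (F (Co M)) \<Longrightarrow> c (actA (F (Co M)) u a) = actA M (c u) a"
proof -
  note CM = coinv_obj_module[OF M]
  interpret W: extension_module \<H> A B code "Co M" by (rule extension_module[OF CM])
  interpret M: cleft_hopf_module \<H> A B etaL j j' M "actA M" by (rule cleft_hopf_module[OF M])
  have CoM: "n \<in> carrier M" "M.M.coinvariant n" if "n \<in> carrier (Co M)" for n using that by simp_all
  have bal: "W.tt.Bbalanced M (actA M)"
    by (rule balancedI[OF W.tt.tensorable_W M.comm_group_M]) (simp_all add: M.da_simps)
  show cpt: "c (pt (Co M) n a) = actA M n a" if "n \<in> carrier (Co M)" for n a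
    unfolding c_def by (rule W.tt.lift_pt[OF bal that])
  show ch: "c \<in> hom (F (Co M)) M" unfolding c_def by (rule W.tt.lift_hom[OF bal])
  have act: "c (tensor_act code B (Co M) g u) = \<phi> (c u)"
    if g: "W.tt.B_linear g" and u: "u \<in> carrier (F (Co M))" and \<phi>: "\<phi> \<in> hom M M"
      and eq: "\<And>n a. n \<in> carrier (Co M) \<Longrightarrow> actA M n (g a) = \<phi> (actA M n a)" for g u \<phi>
  proof (rule W.tt.G_ext[OF M.comm_group_M hom_comp[OF W.tt.tensor_act_hom[OF g] ch] hom_comp[OF ch \<phi>] _ u])
    show "c (tensor_act code B (Co M) g (pt (Co M) n a)) = \<phi> (c (pt (Co M) n a))" if n: "n \<in> carrier (Co M)" for n a
      unfolding W.tt.tensor_act_pt[OF g n] cpt[OF n] by (rule eq[OF n])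
  qed
  have aR: "c (actR (F (Co M)) u r) = actR M (c u) r" if u: "u \<in> carrier (F (Co M))" for u r
    using act[OF W.B_linear_mult u M.M.right.hom_act] M.da_R_linear by simp
  have aL: "c (actL (F (Co M)) u l) = actL M (c u) l" if u: "u \<in> carrier (F (Co M))" for u l
  proof -
    have "actA M n (actLA A a l) = actL M (actA M n a) l" if n: "n \<in> carrier (Co M)" for n a
      using M.da_L_linear[OF CoM(1)[OF n], of a l] coinvariant_actL[OF M n, of l] M.da_balanced[OF CoM(1)[OF n], of _ a]
      by (simp add: actLA_eq)
    then show ?thesis using act[OF W.B_linear_actLA u M.M.left.hom_act] by simp
  qed
  show aA: "c (actA (F (Co M)) u a) = actA M (c u) a" if u: "u \<in> carrier (F (Co M))" for u a
    using act[OF W.B_linear_mult u M.da_hom] M.da_simps(4) by simp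
  have rho_pt: "coactR M (c (pt (Co M) n a)) = ev M.TM (\<lambda>a' h. pure_tensor M.TM (c (pt (Co M) n a')) h) (rhoR A a)"
    "coactL M (c (pt (Co M) n a)) = ev M.M.left.T (\<lambda>a' h. pure_tensor M.M.left.T (c (pt (Co M) n a')) h) (rhoL A a)"
    if n: "n \<in> carrier (Co M)" for n a
    unfolding cpt[OF n]
    using M.ev_coactR_coinvariant_da[OF balanced_pure_tensor[OF M.M.right.tensorable_M] CoM(2)[OF n], of a]
      M.ev_coactL_coinvariant_da[OF balanced_pure_tensor[OF M.M.left.tensorable_M] CoM(2)[OF n], of a]
      M.M.right.ev_rho_self[OF M.da_simps(1)[OF CoM(1)[OF n]], of a] M.M.left.ev_rho_self[OF M.da_simps(1)[OF CoM(1)[OF n]], of a]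
    by simp_all
  have cR: "coactR M (c u) = tensor_map2 M.TM c id (coactR (F (Co M)) u)"
    and cL: "coactL M (c u) = tensor_map2 M.M.left.T c id (coactL (F (Co M)) u)" if u: "u \<in> carrier (F (Co M))" for u
    using W.R.coact_morphism[OF M.M.right.tensorable_M M.M.right.\<rho>_hom ch _ rho_pt(1) u] aR
      W.L.coact_morphism[OF M.M.left.tensorable_M M.M.left.\<rho>_hom ch _ rho_pt(2) u] aL
    by simp_all
  show "c \<in> comod_hom \<H> (F (Co M)) M"
    unfolding comod_hom_iff coaction_map_def by (intro conjI ballI allI ch aR aL cR cL)
qed

text \<open>
  The inverse of \<open>n \<otimes> a \<mapsto> n a\<close> is \<open>\<sigma>(m) = \<pi>(m\<^sub>0) \<otimes> j(m\<^sub>1)\<close>, well defined since \<open>\<pi>(m l) = \<pi>(m) \<eta>\<^sub>L(l)\<close> with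
  \<open>\<eta>\<^sub>L(l) \<in> B\<close>. One composite is \<open>\<pi>(m\<^sub>0) j(m\<^sub>1) = m\<close>. For the other, coinvariance of \<open>n\<close> under the
  \<open>L\<close>-coaction gives \<open>\<sigma>(n a) = \<pi>(n a\<^sub>0) \<otimes> j(a\<^sub>1) = n \<pi>(a\<^sub>0) \<otimes> j(a\<^sub>1) = n \<otimes> \<pi>(a\<^sub>0) j(a\<^sub>1) = n \<otimes> a\<close>.
\<close>

lemma counit_bij:
  assumes M: "is_hopf_module \<H> A M"
  shows "bij_betw (tensor_transport.lift code B (Co M) M (actA M)) (carrier (F (Co M))) (carrier M)"
proof -
  note CM = coinv_obj_module[OF M]
  interpret W: extension_module \<H> A B code "Co M" by (rule extension_module[OF CM])
  interpret M: cleft_hopf_module \<H> A B etaL j j' M "actA M" by (rule cleft_hopf_module[OF M])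
  let ?c = "W.tt.lift M (actA M)"
  note cpt = counit_pt[OF M] and ch = counit_hom[OF M]
  have CoM: "n \<in> carrier M" "M.M.coinvariant n" if "n \<in> carrier (Co M)" for n using that by simp_all
  have pi: "M.cleft_pi n \<in> carrier (Co M)" if "n \<in> carrier M" for n using M.cleft_pi_coinvariant[OF that] by simp
  note ptD = W.tt.ptD
  define \<sigma> where "\<sigma> m = ev (F (Co M)) (\<lambda>n h. pt (Co M) (M.cleft_pi n) (j h)) (coactL M m)" for m
  have b: "M.Lbalanced (F (Co M)) (\<lambda>n h. pt (Co M) (M.cleft_pi n) (j h))"
  proof (rule balancedI[OF M.M.left.tensorable_M W.tt.comm_group_G])
    fix n n' h h' l assume n: "n \<in> carrier M" "n' \<in> carrier M"
    show "pt (Co M) (M.cleft_pi n) (j h) \<in> carrier (F (Co M))" by (rule ptD(1)[OF pi[OF n(1)]])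
    show "pt (Co M) (M.cleft_pi (n \<otimes>\<^bsub>M\<^esub> n')) (j h) = pt (Co M) (M.cleft_pi n) (j h) \<otimes>\<^bsub>F (Co M)\<^esub> pt (Co M) (M.cleft_pi n') (j h)"
      using ptD(2)[OF pi[OF n(1)] pi[OF n(2)], of "j h"] by (simp add: M.cleft_pi_mult n)
    show "pt (Co M) (M.cleft_pi n) (j (h \<otimes>\<^bsub>additive_group\<^esub> h')) = pt (Co M) (M.cleft_pi n) (j h) \<otimes>\<^bsub>F (Co M)\<^esub> pt (Co M) (M.cleft_pi n) (j h')"
      using ptD(3)[OF pi[OF n(1)], of "j h" "j h'"] by (simp add: j_add)
    show "pt (Co M) (M.cleft_pi (actL M n l)) (j h) = pt (Co M) (M.cleft_pi n) (j (laL l h))"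
      using ptD(4)[OF pi[OF n(1)] B_closed(3), of l "j h"] by (simp add: M.cleft_pi_actL n lb_la_def j_sL)
  qed
  have \<sigma>_hom: "\<sigma> \<in> hom M (F (Co M))"
    unfolding \<sigma>_def by (rule hom_comp[OF M.M.left.\<rho>_hom ev_hom[OF b]])
  have c\<sigma>: "?c (\<sigma> m) = m" if m: "m \<in> carrier M" for m
  proof -
    have "?c (\<sigma> m) = ev M (\<lambda>n h. ?c (pt (Co M) (M.cleft_pi n) (j h))) (coactL M m)"
      unfolding \<sigma>_def
      by (rule M.M.left.hom_ev_rho[OF W.tt.comm_group_G M.comm_group_M m ch]) (rule ptD(1)[OF pi])
    also have "\<dots> = ev M (\<lambda>n h. actA M (M.cleft_pi n) (j h)) (coactL M m)"
    proof (rule M.M.left.ev_rho_cong[OF M.comm_group_M m])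
      fix n h assume n: "n \<in> carrier M"
      show "?c (pt (Co M) (M.cleft_pi n) (j h)) = actA M (M.cleft_pi n) (j h)" by (rule cpt[OF pi[OF n]])
      then show "?c (pt (Co M) (M.cleft_pi n) (j h)) \<in> carrier M" by (simp add: M.da_simps M.cleft_pi_closed n)
    qed
    also have "\<dots> = m" by (rule M.cleft_pi_reconstruct[OF m])
    finally show ?thesis .
  qed
  have \<sigma>c: "\<sigma> (?c u) = u" if u: "u \<in> carrier (F (Co M))" for u
  proof (rule W.tt.G_ext[OF W.tt.comm_group_G hom_comp[OF ch \<sigma>_hom] _ _ u])
    show "(\<lambda>u. u) \<in> hom (F (Co M)) (F (Co M))" by (rule homI) simp_all
    fix n a assume n: "n \<in> carrier (Co M)"
    have "\<sigma> (?c (pt (Co M) n a)) = ev (F (Co M)) (\<lambda>a' h. pt (Co M) (M.cleft_pi (actA M n a')) (j h)) (rhoL A a)"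
      unfolding \<sigma>_def cpt[OF n] by (rule M.ev_coactL_coinvariant_da[OF b CoM(2)[OF n]])
    also have "\<dots> = ev (F (Co M)) (\<lambda>a' h. pt (Co M) n (alg_pi a' * j h)) (rhoL A a)"
      using M.cleft_pi_coinvariant_da[OF CoM(2)[OF n]] ptD(4)[OF n alg_pi_B] by simp
    also have "\<dots> = pt (Co M) n (ev additive_group (\<lambda>a' h. alg_pi a' * j h) (rhoL A a))"
    proof (rule hom_ev[OF left.tensorable_M comm_group_additive W.tt.comm_group_G left.rho_closed, symmetric, simplified])
      show "pt (Co M) n \<in> hom additive_group (F (Co M))" by (rule homI) (use ptD[OF n] in simp_all)
    qed
    finally show "\<sigma> (?c (pt (Co M) n a)) = pt (Co M) n a" by (simp add: alg_pi_reconstruct)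
  qed
  show ?thesis
    by (rule bij_betwI[where g = \<sigma>]) (use hom_closedD[OF ch] hom_closedD[OF \<sigma>_hom] c\<sigma> \<sigma>c in blast)+
qed

lemma counit_iso:
  assumes M: "is_hopf_module \<H> A M"
  shows "is_iso_in HC (F (Co M)) M (counit_map M)"
proof (rule bij_is_iso_hopf_module[OF _ M])
  interpret W: extension_module \<H> A B code "Co M" by (rule extension_module[OF coinv_obj_module[OF M]])
  let ?c = "W.tt.lift M (actA M)"
  show H: "is_hopf_module \<H> A (F (Co M))" by (rule W.hopf_module_G)
  have "counit_map M \<in> comod_hom \<H> (F (Co M)) M"
    by (rule comod_hom_cong[OF is_hopf_moduleD(1)[OF H] is_hopf_moduleD(1)[OF M] counit_comod_hom[OF M]])
       (simp add: counit_map_def)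
  moreover have "counit_map M (actA (F (Co M)) u a) = actA M (counit_map M u) a" if u: "u \<in> carrier (F (Co M))" for u a
    using right_moduleD(3)[OF is_hopf_moduleD(2)[OF H] u UNIV_I, of a] counit_actA[OF M u, of a] u
    by (simp add: counit_map_def del: tensor_obj_simps)
  ultimately show "counit_map M \<in> Hom HC (F (Co M)) M"
    by (simp add: hopf_module_cat_simps del: tensor_obj_simps) (simp add: counit_map_def del: tensor_obj_simps)
  show "bij_betw (counit_map M) (carrier (F (Co M))) (carrier M)"
    using counit_bij[OF M] by (rule bij_betw_cong[THEN iffD1, rotated]) (simp add: counit_map_def)
qed

theorem tensor_equivalence: "is_equivalence MC HC F (tensor_mor B code)"
proof -
  have "natural_iso MC MC id (\<lambda>X Y f. f) (Co \<circ> F) (\<lambda>X Y f. coinv_mor (F X) (F Y) (tensor_mor B code X Y f)) unit_map"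
    unfolding natural_iso_def
  proof (intro conjI ballI, goal_cases)
    case (1 W) then show ?case using unit_iso by (simp add: module_cat_simps)
  next
    case (2 V W f)
    then have V: "right_module B V (act V)" and W: "right_module B W (act W)" and f: "f \<in> Hom MC V W"
      by (simp_all add: module_cat_simps)
    have fc: "f v \<in> carrier W" if "v \<in> carrier V" for v
      using f hom_closedD[of f V W v] that by (simp add: module_cat_simps)
    have co: "unit_map V v \<in> carrier (Co (F V))" if "v \<in> carrier V" for v
      using unit_iso[OF V] hom_closedD[of "unit_map V" V "Co (F V)" v] that
      by (simp add: is_iso_in_def module_cat_simps del: coinv_obj_simps)
    show ?case
    proof (rule ext)
      fix v
      have "unit_map W (f v) = coinv_mor (F V) (F W) (tensor_mor B code V W f) (unit_map V v)" if v: "v \<in> carrier V"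
        using co[OF v] v fc[OF v] tensor_mor_pt[OF V W f v, of 1]
        by (simp add: coinv_mor_def unit_map_def del: coinv_obj_simps tensor_obj_simps)
      then show "Comp MC (id V) (id W) ((Co \<circ> F) W) (unit_map W) f v =
        Comp MC (id V) ((Co \<circ> F) V) ((Co \<circ> F) W) (coinv_mor (F V) (F W) (tensor_mor B code V W f)) (unit_map V) v"
        by (simp add: module_cat_simps compose_def)
    qed
  qed
  moreover have "natural_iso HC HC (F \<circ> Co) (\<lambda>X Y f. tensor_mor B code (Co X) (Co Y) (coinv_mor X Y f)) id (\<lambda>X Y f. f) counit_map"
    unfolding natural_iso_def
  proof (intro conjI ballI, goal_cases)
    case (1 M) then show ?case using counit_iso by (simp add: hopf_module_cat_simps)
  next
    case (2 M N f)
    then have M: "is_hopf_module \<H> A M" and N: "is_hopf_module \<H> A N" and f: "f \<in> Hom HC M N"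
      by (simp_all add: hopf_module_cat_simps)
    note CM = coinv_obj_module[OF M] and CN = coinv_obj_module[OF N]
    have g: "coinv_mor M N f \<in> Hom MC (Co M) (Co N)"
      using coinv_functor 2 unfolding is_functor_def by blast
    interpret W: extension_module \<H> A B code "Co M" by (rule extension_module[OF CM])
    have "f (tensor_transport.lift code B (Co M) M (actA M) u) =
      tensor_transport.lift code B (Co N) N (actA N) (tensor_mor B code (Co M) (Co N) (coinv_mor M N f) u)"
      if u: "u \<in> carrier (F (Co M))" for u
    proof (rule W.tt.G_ext[OF right_moduleD(1)[OF is_hopf_moduleD(2)[OF N]] hom_comp[OF counit_hom[OF M] hopf_Hom_hom[OF f]]
          hom_comp[OF tensor_mor_hom[OF CM CN g] counit_hom[OF N]] _ u, symmetric, THEN sym])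
      fix n a assume n: "n \<in> carrier (Co M)"
      have gn: "coinv_mor M N f n \<in> carrier (Co N)"
        using g n hom_closedD[of "coinv_mor M N f" "Co M" "Co N" n] by (simp add: module_cat_simps del: coinv_obj_simps)
      have "f (actA M n a) = actA N (coinv_mor M N f n) a"
        using f n by (simp add: hopf_module_cat_simps coinv_mor_def)
      then show "f (tensor_transport.lift code B (Co M) M (actA M) (pt (Co M) n a)) =
        tensor_transport.lift code B (Co N) N (actA N) (tensor_mor B code (Co M) (Co N) (coinv_mor M N f) (pt (Co M) n a))"
        unfolding tensor_mor_pt[OF CM CN g n] counit_pt[OF M n] counit_pt[OF N gn] .
    qed
    moreover have "tensor_mor B code (Co M) (Co N) (coinv_mor M N f) u \<in> carrier (F (Co N))" if "u \<in> carrier (F (Co M))" for u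
      by (rule hom_closedD[OF tensor_mor_hom[OF CM CN g] that])
    ultimately show ?case
      by (simp add: hopf_module_cat_simps counit_map_def compose_def fun_eq_iff del: coinv_obj_simps tensor_obj_simps)
  qed
  ultimately show ?thesis
    unfolding is_equivalence_def using module_category hopf_module_category tensor_functor coinv_functor by blast
qed

end

theorem theorem3p27:
  fixes \<H> :: "('k::{comm_ring,comm_monoid_mult}, 'l::{ring,monoid_mult}, 'r::{ring,monoid_mult},
               'h::{ring,monoid_mult}) hopf_algebroid"
    and A :: "('k, 'l, 'r, 'h, 'a::{ring,monoid_mult}) comod_algebra"
    and B :: "'a set"
    and code :: "('u \<times> 'a \<Rightarrow>\<^sub>0 int) \<Rightarrow> 'u"
  assumes "is_hopf_algebroid \<H>"
    and "cleft_extension \<H> A B"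
    and "inj code"
  shows "is_equivalence (module_cat B :: (('u, 'a) rmod, 'u \<Rightarrow> 'u) cat)
           (hopf_module_cat \<H> A) (tensor_obj \<H> A B code) (tensor_mor B code)"
proof -
  have A: "is_comod_algebra \<H> A" and B: "B = coinvariants \<H> A"
    using assms(2) by (simp_all add: cleft_extension_def hopf_extension_def)
  obtain etaL where etaL: "algebra_map (scL \<H>) (scA A) etaL" "unital_subring B" "range etaL \<subseteq> B"
    and "\<exists>j \<in> comod_hom \<H> (regular_comod \<H>) (alg_comod A).
        \<exists>j' \<in> hom additive_group additive_group.
          (\<forall>l h. j (src (lb \<H>) l * h) = etaL l * j h) \<and>
          (\<forall>l h r. j' (tgt (lb \<H>) l * h * tgt (rb \<H>) r) = etaR A r * j' h * etaL l) \<and>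
          (\<forall>h. tensor_eval additive_group (\<lambda>(x, y). j x * j' y) (cop (rb \<H>) h) = etaL (cou (lb \<H>) h)) \<and>
          (\<forall>h. tensor_eval additive_group (\<lambda>(x, y). j' x * j y) (cop (lb \<H>) h) = etaR A (cou (rb \<H>) h))"
    using assms(2) unfolding cleft_extension_def by blast
  then obtain j j' where j: "j \<in> comod_hom \<H> (regular_comod \<H>) (alg_comod A)"
      "j' \<in> hom additive_group additive_group"
      "\<And>l h. j (src (lb \<H>) l * h) = etaL l * j h"
      "\<And>l h r. j' (tgt (lb \<H>) l * h * tgt (rb \<H>) r) = etaR A r * j' h * etaL l"
      "\<And>h. tensor_eval additive_group (\<lambda>(x, y). j x * j' y) (cop (rb \<H>) h) = etaL (cou (lb \<H>) h)"
      "\<And>h. tensor_eval additive_group (\<lambda>(x, y). j' x * j y) (cop (lb \<H>) h) = etaR A (cou (rb \<H>) h)"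
    by blast
  have "cleft_comod_algebra \<H> A B etaL j j'"
    by (rule cleft_comod_algebra.intro[OF A cleft_comod_algebra_axioms.intro[OF B etaL j]])
  then have "cleft_universe \<H> A B etaL j j' code"
    using assms(3) by (intro cleft_universe.intro cleft_universe_axioms.intro)
  then show ?thesis by (rule cleft_universe.tensor_equivalence)
qed

end
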